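(* The Riemann Hypothesis is equivalent to the following statement ("hidden symmetry"): for every pair of real numbers $(\alpha,\alpha')$ with $0<\alpha<\frac12$, $\alpha'>\frac12$ and $$\alpha=\frac12\left(1-\frac{1}{\zeta(2\alpha')}\right)=\frac12\left(1-\prod_{p\ \mathrm{prime}}\left(1-\frac{1}{p^{2\alpha'}}\right)\right)=\frac12\left(1-\sum_{n=1}^{\infty}\frac{\mu(n)}{n^{2\alpha'}}\right),$$ one has $\varphi_{\mathrm{in}}(\alpha)=\varphi_{\mathrm{out}}(\alpha,\alpha')$, where $$\varphi_{\mathrm{in}}(\alpha)=\frac{2}{\pi}\int_0^{\pi/2}\ln\left|\zeta\left(\tfrac12+\alpha+i\left(\tfrac12-\alpha\right)\tan\theta\right)\right|d\theta,$$ $$\varphi_{\mathrm{out}}(\alpha,\alpha')=\frac{2}{\pi}\int_0^{\pi/2}\ln\left|\zeta\left(2\alpha'+\alpha-\tfrac12+i\left(\tfrac12-\alpha\right)\tan\theta\right)\right|d\theta.$$ Moreover, when these equivalent conditions hold, for every such pair $(\alpha,\alpha')$, $$\varphi_{\mathrm{in}}(\alpha)=\ln\left(\frac{1}{1-2\alpha}\right)=\varphi_{\mathrm{out}}(\alpha,\alpha')=\ln\left(\zeta(2\alpha')\right).$$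
   Context: $\zeta$ denotes the Riemann zeta function (meromorphically continued to $\mathbb{C}$), $\mu$ the Möbius function, and $\ln$ the real natural logarithm. The Riemann Hypothesis is the statement that all zeros of $\zeta(s)$ with $0<\mathrm{Re}(s)<1$ satisfy $\mathrm{Re}(s)=\frac12$. The three expressions for $\alpha$ in terms of $\alpha'$ coincide because $2\alpha'>1$; for each $\alpha\in(0,\frac12)$ there is a unique $\alpha'>\frac12$ satisfying the relation. The integrals are Lebesgue integrals. *)

theory Defs
  imports "HOL-Complex_Analysis.Complex_Analysis" "HOL-Computational_Algebra.Squarefree"
begin

text \<open>
  The Riemann zeta function: the meromorphic continuation to the whole plane of the Dirichlet
  series on \<open>Re s > 1\<close>. Requiring \<open>nicely_meromorphic_on\<close> instead of \<open>meromorphic_on\<close> makes the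
  continuation unique as a total function: removable singularities are filled in and the
  value at a pole (that is, at \<open>s = 1\<close>) is \<open>0\<close>.
\<close>

definition zeta :: "complex \<Rightarrow> complex" where
  "zeta = (THE f. f nicely_meromorphic_on UNIV \<and>
     (\<forall>s. Re s > 1 \<longrightarrow> (\<lambda>n. 1 / of_nat (Suc n) powr s) sums f s))"

definition moebius_mu :: "nat \<Rightarrow> int" where
  "moebius_mu n = (if squarefree n then (-1) ^ card (prime_factors n) else 0)"

definition riemann_hypothesis :: bool where
  "riemann_hypothesis \<longleftrightarrow>
     (\<forall>s. zeta s = 0 \<and> 0 < Re s \<and> Re s < 1 \<longrightarrow> Re s = 1 / 2)"

text \<open>
  The first relation is stated in the complex numbers, so that it also says that
  \<open>zeta (2 * \<alpha>')\<close> is real.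
\<close>

definition related_pair :: "real \<Rightarrow> real \<Rightarrow> bool" where
  "related_pair \<alpha> \<alpha>' \<longleftrightarrow>
     0 < \<alpha> \<and> \<alpha> < 1 / 2 \<and> \<alpha>' > 1 / 2 \<and>
     complex_of_real \<alpha> = 1 / 2 * (1 - 1 / zeta (complex_of_real (2 * \<alpha>'))) \<and>
     \<alpha> = 1 / 2 * (1 - (\<Prod>p. if prime p then 1 - 1 / real p powr (2 * \<alpha>') else 1)) \<and>
     \<alpha> = 1 / 2 * (1 - (\<Sum>n. real_of_int (moebius_mu (Suc n)) / real (Suc n) powr (2 * \<alpha>')))"

text \<open>
  Both integrands are only meaningful up to null sets: \<open>tan (pi / 2) = 0\<close> and \<open>ln 0 = 0\<close>
  are dummy values, taken at the right endpoint and at the zeros of \<open>zeta\<close> on the line.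
\<close>

definition phi_in :: "real \<Rightarrow> real" where
  "phi_in \<alpha> = 2 / pi *
     (LINT \<theta>:{0..pi/2}|lebesgue.
        ln (cmod (zeta (1 / 2 + complex_of_real \<alpha> +
          \<i> * (1 / 2 - complex_of_real \<alpha>) * complex_of_real (tan \<theta>)))))"

definition phi_out :: "real \<Rightarrow> real \<Rightarrow> real" where
  "phi_out \<alpha> \<alpha>' = 2 / pi *
     (LINT \<theta>:{0..pi/2}|lebesgue.
        ln (cmod (zeta (2 * complex_of_real \<alpha>' + complex_of_real \<alpha> - 1 / 2 +
          \<i> * (1 / 2 - complex_of_real \<alpha>) * complex_of_real (tan \<theta>)))))"

definition hidden_symmetry :: bool where
  "hidden_symmetry \<longleftrightarrow> (\<forall>\<alpha> \<alpha>'. related_pair \<alpha> \<alpha>' \<longrightarrow> phi_in \<alpha> = phi_out \<alpha> \<alpha>')"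

end

(*
  Write b = 1/2 - alpha. The Cayley map s = 1 - b + b (1 + z) / (1 - z) sends the unit disc to the
  half plane Re s > 1/2 + alpha, the origin to s = 1 and the boundary point z = - exp (- 2 i theta)
  to 1/2 + alpha + i b tan theta. Hence phi_in alpha is the mean over the unit circle of ln |zeta s|.
  The function g z = 2 b z zeta s = (1 - z) (s - 1) zeta s is holomorphic in the disc with g 0 = 1,
  and |g| = 2 b |zeta s| on the circle. By Jensen's formula phi_in alpha + ln (2 b) is a sum of
  positive contributions of the zeros of zeta in the half plane, so it vanishes if and only if there
  are none. On the other hand phi_out is the same kind of mean in a half plane to the right of
  Re s = 1, where ln |zeta| is bounded and harmonic; its value is ln (zeta (2 alpha')), which is
  - ln (2 b). The functional equation moves a zero off the critical line into Re s > 1/2.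
*)
theory Submission
  imports Defs
begin

text \<open>On the boundary circle ln |zeta| may have singularities, and near z = 1 it is not known
  to be bounded, so Jensen's formula cannot be used there directly. It is replaced by an inequality
  for a holomorphic g whose ln |g| has an integrable upper bound: it is elementary on circles of
  radius below 1, and Fatou's lemma carries it to radius 1. Used for g and for 1 / g it gives
  equality; used for g with one zero removed it gives a strict inequality. Under the Riemann
  hypothesis the bound for 1 / g is the delicate point: ln |zeta| needs a lower bound of logarithmic
  size in |s|, which Harnack's inequality supplies. Since the hypothesis is silent about Re s = 1,
  nonvanishing on that line is proved separately. The half plane of \<open>phi_out\<close> lies to
  the right of Re s = 1 because zeta(x) >= 1 / (x - 1) for real x > 1. As \<open>zeta\<close> is a
  definite description over the whole plane, the continuation is built everywhere and shown to be
  unique, although the argument itself takes place in Re s > 0.\<close>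

section \<open>The entire function (s - 1) zeta s to the right of -1\<close>

text \<open>This is \<open>s - 1\<close> times the error (rule minus integral) of the trapezoidal rule for \<open>t powr - s\<close>
  on \<open>[n + 1, n + 2]\<close>. Summing over \<open>n\<close> gives \<open>zeta_P s = (s - 1) * zeta s\<close>.\<close>

definition zeta_term :: "nat \<Rightarrow> complex \<Rightarrow> complex" where
  "zeta_term n s = (s - 1) / 2 * (of_nat (Suc n) powr - s + (of_nat (Suc n) + 1) powr - s)
     + (of_nat (Suc n) + 1) powr (1 - s) - of_nat (Suc n) powr (1 - s)"

text \<open>The error \<open>h z\<close> on \<open>[a, a + z]\<close> vanishes at 0, its derivative
  is \<open>(s - 1) / 2 * k z\<close>, and \<open>k\<close> vanishes at 0 too; two mean value
  estimates give the bound. The derivative of \<open>k\<close> has the exponent - s - 2, and this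
  gain of two powers is what makes the series converge down to Re s > -1. The assumption Re s >= -2
  makes this power decreasing along the segment.\<close>

lemma trapezoid_powr_bound:
  fixes a :: real and s :: complex
  assumes a: "a > 0" and s: "Re s \<ge> -2"
  shows "norm ((s - 1) / 2 * (of_real a powr - s + (of_real a + 1) powr - s)
     + (of_real a + 1) powr (1 - s) - of_real a powr (1 - s))
   \<le> norm (s - 1) / 2 * (norm s * norm (s + 1) * a powr (- Re s - 2))"
proof -
  define S where "S = closed_segment 0 (1::complex)"
  have S: "Im z = 0 \<and> 0 \<le> Re z \<and> Re z \<le> 1" if "z \<in> S" for z
    using that by (auto simp: S_def closed_segment_def)
  have nR: "of_real a + z \<notin> \<real>\<^sub>\<le>\<^sub>0" if "z \<in> S" for z
    using S[OF that] a by (auto simp: complex_nonpos_Reals_iff)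
  define K where "K = norm s * norm (s + 1) * a powr (- Re s - 2)"
  define k where "k = (\<lambda>z. of_real a powr - s - (of_real a + z) powr - s - s * z * (of_real a + z) powr (- s - 1))"
  define h where "h = (\<lambda>z. (s - 1) / 2 * z * (of_real a powr - s + (of_real a + z) powr - s)
     + (of_real a + z) powr (1 - s) - of_real a powr (1 - s))"
  have K0: "K \<ge> 0" by (simp add: K_def)
  have bnd: "norm (s * (s + 1) * z * (of_real a + z) powr (- s - 2)) \<le> K" if z: "z \<in> S" for z
  proof -
    have az: "of_real a + z = of_real (a + Re z)" using S[OF z] by (simp add: complex_eq_iff)
    have "norm (s * (s + 1) * z * (of_real a + z) powr (- s - 2)) 
       = norm s * norm (s + 1) * (norm z * (a + Re z) powr (- Re s - 2))"
      unfolding az using S[OF z] a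
      by (simp add: norm_mult norm_powr_real_powr mult.assoc del: of_real_add)
    also have "norm z = Re z" using S[OF z] by (simp add: cmod_eq_Re)
    also have "Re z * (a + Re z) powr (- Re s - 2) \<le> 1 * a powr (- Re s - 2)"
      using S[OF z] a s by (intro mult_mono powr_mono2') auto
    finally show ?thesis using K0 by (simp add: K_def mult_left_mono mult.assoc)
  qed
  have kb: "norm (k z) \<le> K" if z: "z \<in> S" for z
  proof -
    have "norm (k z - k 0) \<le> K * norm (z - 0)"
    proof (rule field_differentiable_bound[of S k "\<lambda>z. s * (s + 1) * z * (of_real a + z) powr (- s - 2)"])
      show "(k has_field_derivative s * (s + 1) * w * (of_real a + w) powr (- s - 2)) (at w within S)"
        if "w \<in> S" for w
        unfolding k_def
        apply (rule derivative_eq_intros refl nR[OF that])+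
        apply (simp add: algebra_simps)
        done
    qed (use z bnd in \<open>auto simp: S_def\<close>)
    also have "\<dots> \<le> K * 1"
      using S[OF z] K0 by (intro mult_left_mono) (auto simp: cmod_eq_Re)
    finally show ?thesis by (simp add: k_def)
  qed
  have "norm (h 1 - h 0) \<le> norm (s - 1) / 2 * K * norm (1 - 0 :: complex)"
  proof (rule field_differentiable_bound[of S h "\<lambda>z. (s - 1) / 2 * k z"])
    show "(h has_field_derivative (s - 1) / 2 * k w) (at w within S)"
      if "w \<in> S" for w
      unfolding k_def h_def
      apply (rule derivative_eq_intros refl nR[OF that])+
      apply (simp add: field_simps)
      done
    show "norm ((s - 1) / 2 * k w) \<le> norm (s - 1) / 2 * K" if "w \<in> S" for w
      using kb[OF that] by (simp add: norm_mult mult_left_mono norm_divide)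
  qed (auto simp: S_def)
  thus ?thesis by (simp add: h_def K_def)
qed

lemma norm_zeta_term_le:
  assumes "Re s \<ge> -2"
  shows "norm (zeta_term n s) \<le> norm (s - 1) * norm s * norm (s + 1) * real (Suc n) powr (- Re s - 2)"
proof -
  have "norm (zeta_term n s) \<le> norm (s - 1) / 2 * (norm s * norm (s + 1) * real (Suc n) powr (- Re s - 2))"
    using trapezoid_powr_bound[of "real (Suc n)" s] assms unfolding zeta_term_def by simp
  also have "\<dots> \<le> norm (s - 1) * (norm s * norm (s + 1) * real (Suc n) powr (- Re s - 2))"
    by (intro mult_right_mono) auto
  finally show ?thesis by (simp add: mult_ac)
qed

lemma summable_Suc_powr:
  assumes "x < -1" shows "summable (\<lambda>n. real (Suc n) powr x)"
  using assms by (subst summable_Suc_iff) (simp add: summable_real_powr_iff)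

text \<open>The summand is (s - 1) / 2 + 1: the trapezoidal rule counts the term at 1 only by half,
  and (s - 1) times the integral of \<open>t powr - s\<close> from 1 to infinity is 1.\<close>

definition zeta_P :: "complex \<Rightarrow> complex" where
  "zeta_P s = (s + 1) / 2 + (\<Sum>n. zeta_term n s)"

lemma summable_zeta_term:
  assumes "Re s > -1" shows "summable (\<lambda>n. zeta_term n s)"
proof (rule summable_comparison_test')
  show "summable (\<lambda>n. norm (s - 1) * norm s * norm (s + 1) * real (Suc n) powr (- Re s - 2))"
    using assms by (intro summable_mult summable_Suc_powr) auto
  show "norm (zeta_term n s) \<le> norm (s - 1) * norm s * norm (s + 1) * real (Suc n) powr (- Re s - 2)" for n
    using assms by (intro norm_zeta_term_le) auto
qed

lemma holomorphic_zeta_P: "zeta_P holomorphic_on {s. Re s > -1}"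
proof -
  have "(\<lambda>s. \<Sum>n. zeta_term n s) holomorphic_on {s. Re s > -1}"
  proof (rule holomorphic_uniform_sequence[where f = "\<lambda>N s. \<Sum>n<N. zeta_term n s"])
    show "open {s. Re s > -1}" by (rule open_halfspace_Re_gt)
    show "(\<lambda>s. \<Sum>n<N. zeta_term n s) holomorphic_on {s. Re s > -1}" for N
      unfolding zeta_term_def by (intro holomorphic_intros) (auto simp: complex_nonpos_Reals_iff)
    show "\<exists>d>0. cball x d \<subseteq> {s. Re s > -1} \<and> uniform_limit (cball x d) (\<lambda>N s. \<Sum>n<N. zeta_term n s) (\<lambda>s. \<Sum>n. zeta_term n s) sequentially"
      if "x \<in> {s. Re s > -1}" for x
    proof -
      define d where "d = (Re x + 1) / 2"
      have d: "d > 0" using that by (simp add: d_def)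
      define C where "C = (norm x + d + 1) ^ 3"
      have Re: "Re y \<ge> -1 + d" if "y \<in> cball x d" for y
        using that abs_Re_le_cmod[of "x - y"] by (auto simp: d_def dist_norm field_simps abs_le_iff)
      show ?thesis
      proof (intro exI[of _ d] conjI d)
        show "cball x d \<subseteq> {s. Re s > -1}" using Re d by force
        show "uniform_limit (cball x d) (\<lambda>N s. \<Sum>n<N. zeta_term n s) (\<lambda>s. \<Sum>n. zeta_term n s) sequentially"
        proof (rule Weierstrass_m_test)
          show "summable (\<lambda>n. C * real (Suc n) powr (-1 - d))"
            using d by (intro summable_mult summable_Suc_powr) auto
          fix n y assume y: "y \<in> cball x d"
          have ny: "norm y \<le> norm x + d"
            using y norm_triangle_ineq2[of y x] by (auto simp: dist_norm norm_minus_commute)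
          have "norm (zeta_term n y) \<le> norm (y - 1) * norm y * norm (y + 1) * real (Suc n) powr (- Re y - 2)"
            using Re[OF y] d by (intro norm_zeta_term_le) auto
          also have "\<dots> \<le> ((norm x + d + 1) * (norm x + d + 1) * (norm x + d + 1)) * real (Suc n) powr (-1 - d)"
            using Re[OF y] d ny norm_triangle_ineq[of y 1] norm_triangle_ineq4[of y 1] 
            by (intro mult_mono powr_mono) auto
          finally show "norm (zeta_term n y) \<le> C * real (Suc n) powr (-1 - d)"
            by (simp add: C_def power3_eq_cube)
        qed
      qed
    qed
  qed
  thus ?thesis unfolding zeta_P_def by (intro holomorphic_intros) auto
qed

text \<open>The exponent 3 stems from the factors s - 1, s and s + 1 in the bound for
  \<open>zeta_term\<close>. Polynomial growth is enough, since only the logarithm of the modulus is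
  ever integrated.\<close>

lemma zeta_P_bound:
  obtains C where "C \<ge> 1" "\<And>s. Re s \<ge> 0 \<Longrightarrow> norm (zeta_P s) \<le> C * (1 + norm s) ^ 3"
proof -
  define B where "B = (\<Sum>n. real (Suc n) powr - 2)"
  have sB: "summable (\<lambda>n. real (Suc n) powr - 2)" by (intro summable_Suc_powr) auto
  have B0: "B \<ge> 0" unfolding B_def by (intro suminf_nonneg sB) auto
  have "norm (zeta_P s) \<le> (B + 1) * (1 + norm s) ^ 3" if s: "Re s \<ge> 0" for s
  proof -
    define A where "A = norm (s - 1) * norm s * norm (s + 1)"
    have A: "A \<le> (1 + norm s) ^ 3"
      unfolding A_def power3_eq_cube using norm_triangle_ineq[of s 1] norm_triangle_ineq4[of s 1] 
      by (intro mult_mono) auto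
    have A0: "A \<ge> 0" by (simp add: A_def)
    have "norm (zeta_term n s) \<le> A * real (Suc n) powr -2" for n
    proof -
      have "norm (zeta_term n s) \<le> A * real (Suc n) powr (- Re s - 2)"
        unfolding A_def using s by (intro norm_zeta_term_le) auto
      also have "\<dots> \<le> A * real (Suc n) powr -2"
        using s A0 by (intro mult_left_mono powr_mono) auto
      finally show ?thesis .
    qed
    hence "norm (\<Sum>n. zeta_term n s) \<le> (\<Sum>n. A * real (Suc n) powr -2)"
      by (intro norm_suminf_le summable_mult sB) auto
    also have "\<dots> = A * B" unfolding B_def by (intro suminf_mult sB)
    also have "\<dots> \<le> B * (1 + norm s) ^ 3" using mult_right_mono[OF A B0] by (simp add: mult.commute)
    finally have 1: "norm (\<Sum>n. zeta_term n s) \<le> B * (1 + norm s) ^ 3" .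
    have "norm ((s + 1) / 2) \<le> 1 + norm s" using norm_triangle_ineq[of s 1] norm_ge_zero[of s] unfolding norm_divide norm_numeral norm_one by linarith
    also have "\<dots> \<le> (1 + norm s) ^ 3" by (rule self_le_power) auto
    finally show ?thesis unfolding zeta_P_def
      using 1 norm_triangle_ineq[of "(s+1)/2" "\<Sum>n. zeta_term n s"] by (simp add: algebra_simps)
  qed
  with that[of "B + 1"] B0 show ?thesis by auto
qed

lemma zeta_P_1: "zeta_P 1 = 1"
proof -
  have "zeta_term n 1 = 0" for n
    using of_nat_neq_0[of n, where 'a = complex] of_nat_neq_0[of "Suc n", where 'a = complex]
    by (simp add: zeta_term_def add_ac)
  thus ?thesis by (simp add: zeta_P_def)
qed

lemma zeta_P_cnj:
  assumes "Re s > -1" shows "zeta_P (cnj s) = cnj (zeta_P s)"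
proof -
  have p: "of_nat (Suc n) powr cnj w = cnj (of_nat (Suc n) powr w)" for n w
    by (subst cnj_powr) (simp_all del: of_nat_Suc)
  have "zeta_term n (cnj s) = cnj (zeta_term n s)" for n
    using p[of n "-s"] p[of "Suc n" "-s"] p[of n "1-s"] p[of "Suc n" "1-s"]
    by (simp add: zeta_term_def add_ac)
  moreover have "(\<lambda>n. cnj (zeta_term n s)) sums cnj (\<Sum>n. zeta_term n s)"
    using summable_zeta_term[OF assms] by (subst sums_cnj) (auto simp: sums_iff)
  ultimately show ?thesis by (simp add: zeta_P_def sums_iff)
qed

lemma tendsto_of_nat_powr_0:
  assumes "Re w < 0" shows "(\<lambda>n. of_nat (Suc n) powr w :: complex) \<longlonglongrightarrow> 0"
proof -
  have "(\<lambda>n. real (Suc n) powr Re w) \<longlonglongrightarrow> 0"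
    using assms by real_asymp
  moreover have "norm (of_nat (Suc n) powr w :: complex) = real (Suc n) powr Re w" for n
    by (subst norm_powr_real_powr) auto
  ultimately show ?thesis by (subst tendsto_norm_zero_iff[symmetric]) simp
qed

lemma sum_zeta_term:
  "(\<Sum>n<N. zeta_term n s) = (s - 1) * (\<Sum>n<N. of_nat (Suc n) powr - s) 
     + (s - 1) / 2 * (of_nat (Suc N) powr - s - 1) + of_nat (Suc N) powr (1 - s) - 1"
proof (induction N)
  case (Suc N)
  define a b c d where "a = of_nat (Suc N) powr - s" and "b = (of_nat (Suc N) + 1) powr - s"
    and "c = of_nat (Suc N) powr (1 - s)" and "d = (of_nat (Suc N) + 1) powr (1 - s)"
  have "(\<Sum>n<Suc N. zeta_term n s) = (s - 1) * (\<Sum>n<N. of_nat (Suc n) powr - s) + (s - 1) / 2 * (a - 1) + c - 1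
      + ((s - 1) / 2 * (a + b) + d - c)"
    using Suc by (simp add: zeta_term_def a_def b_def c_def d_def)
  also have "\<dots> = (s - 1) * ((\<Sum>n<N. of_nat (Suc n) powr - s) + a) + (s - 1) / 2 * (b - 1) + d - 1"
    by (simp add: field_simps)
  finally show ?case by (simp add: a_def b_def d_def add_ac)
qed auto

lemma zeta_P_sums:
  assumes "Re s > 1"
  shows "(\<lambda>n. 1 / of_nat (Suc n) powr s) sums (zeta_P s / (s - 1))"
proof -
  have [simp]: "s \<noteq> 1" using assms by auto
  have "(\<lambda>N. ((\<Sum>n<N. zeta_term n s) - (s - 1) / 2 * (of_nat (Suc N) powr - s - 1) - of_nat (Suc N) powr (1 - s) + 1) / (s - 1))
     \<longlonglongrightarrow> ((\<Sum>n. zeta_term n s) - (s - 1) / 2 * (0 - 1) - 0 + 1) / (s - 1)"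
    using assms by (intro tendsto_intros tendsto_of_nat_powr_0 summable_LIMSEQ summable_zeta_term) auto
  also have "((\<Sum>n. zeta_term n s) - (s - 1) / 2 * (0 - 1) - 0 + 1) / (s - 1) = zeta_P s / (s - 1)"
    by (simp add: zeta_P_def field_simps)
  also have "(\<lambda>N. ((\<Sum>n<N. zeta_term n s) - (s - 1) / 2 * (of_nat (Suc N) powr - s - 1) - of_nat (Suc N) powr (1 - s) + 1) / (s - 1))
     = (\<lambda>N. \<Sum>n<N. 1 / of_nat (Suc n) powr s)"
    by (subst sum_zeta_term) (simp add: powr_minus_divide)
  finally show ?thesis by (simp add: sums_def)
qed

section \<open>The functional equation on a real segment\<close>

text \<open>Differentiating the reflection formula rGamma(z) rGamma(1 - z) = sin(pi z) / pi in two
  ways yields Digamma(1 - z) - Digamma(z) = pi cot(pi z). At the imaginary point z = i x / (2 pi)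
  the cotangent becomes a hyperbolic one, and the series of Digamma supplies the fractions.\<close>

lemma coth_partial_fractions:
  fixes x :: real assumes x: "x > 0"
  shows "(\<lambda>m. 2 * x / (x\<^sup>2 + 4 * pi\<^sup>2 * real (Suc m) ^ 2)) sums ((1 + exp (-x)) / (1 - exp (-x)) / 2 - 1 / x)"
proof -
  define z :: complex where "z = \<i> * of_real (x / (2 * pi))"
  have zim: "Im z \<noteq> 0" using x by (simp add: z_def)
  have zZ: "z \<notin> \<int>" "1 - z \<notin> \<int>" 
    using zim by (auto elim!: Ints_cases simp: complex_eq_iff)
  have zZ': "z \<notin> \<int>\<^sub>\<le>\<^sub>0" "1 - z \<notin> \<int>\<^sub>\<le>\<^sub>0" "1 + z \<noteq> 0" "1 - z \<noteq> 0" "z \<noteq> 0"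
    using zZ zim nonpos_Ints_subset_Ints by (auto simp: complex_eq_iff)
  have d1: "((\<lambda>w. rGamma w * rGamma (1 - w)) has_field_derivative
      (- rGamma z * Digamma z) * rGamma (1 - z) + (rGamma (1 - z) * Digamma (1 - z)) * rGamma z) (at z)"
    using zZ' by (auto intro!: derivative_eq_intros simp: algebra_simps)
  have d2: "((\<lambda>w. rGamma w * rGamma (1 - w)) has_field_derivative cos (of_real pi * z)) (at z)"
    unfolding rGamma_reflection_complex by (auto intro!: derivative_eq_intros)
  from DERIV_unique[OF d1 d2]
  have "(rGamma z * rGamma (1 - z)) * (Digamma (1 - z) - Digamma z) = cos (of_real pi * z)"
    by (simp add: algebra_simps)
  hence *: "sin (of_real pi * z) / of_real pi * (Digamma (1 - z) - Digamma z) = cos (of_real pi * z)"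
    by (simp add: rGamma_reflection_complex)
  \<comment> \<open>\<open>E\<close> is exp(i pi z); sine and cosine at pi z are rational in
    it.\<close>
  define E where "E = exp (- x / 2)"
  have E: "E > 0" "E < 1" "E * E = exp (-x)" using x by (auto simp: E_def simp flip: exp_add)
  have piz: "\<i> * (of_real pi * z) = of_real (- x / 2)"
    by (auto simp: z_def complex_eq_iff)
  have e2: "exp (x / 2) = 1 / E" by (simp add: E_def exp_minus field_simps)
  have ex: "exp (of_real (- x / 2)) = complex_of_real E" "exp (- of_real (- x / 2)) = complex_of_real (1 / E)"
    using e2 by (simp_all only: exp_of_real E_def flip: of_real_minus) simp_all
  have sin: "sin (of_real pi * z) = of_real (E - 1 / E) / (2 * \<i>)"
    unfolding sin_exp_eq piz ex by simp
  have cos: "cos (of_real pi * z) = of_real (E + 1 / E) / 2"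
    unfolding cos_exp_eq piz ex by simp
  have nz: "complex_of_real (E - 1 / E) \<noteq> 0" 
    using E mult_strict_mono[of E 1 E 1] unfolding of_real_eq_0_iff by (auto simp: field_simps)
  have "Digamma (1 - z) - Digamma z = \<i> * of_real (pi * ((E + 1 / E) / (E - 1 / E)))"
  proof -
    define u v D where "u = complex_of_real (E - 1 / E)" and "v = complex_of_real (E + 1 / E)"
      and "D = Digamma (1 - z) - Digamma z"
    have "u / (2 * \<i>) / of_real pi * D = v / 2" using * unfolding sin cos u_def v_def D_def by simp
    hence "D = \<i> * (of_real pi * (v / u))" using nz unfolding u_def[symmetric] by (simp add: field_simps)
    thus ?thesis by (simp add: u_def v_def D_def)
  qed
  also have "(E + 1 / E) / (E - 1 / E) = - ((1 + E * E) / (1 - E * E))"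
    using E mult_strict_mono[of E 1 E 1] by (auto simp: divide_simps) (auto simp: algebra_simps)
  finally have D1: "Digamma (1 - z) - Digamma z = - \<i> * of_real (pi * ((1 + exp (-x)) / (1 - exp (-x))))"
    using E by simp
  have D2: "Digamma (1 + z) = Digamma z + 1 / z"
    using Digamma_plus1[of z] zZ' by (simp add: add.commute)
  \<comment> \<open>Moving from z to 1 + z splits off 1 / z, which becomes the term 1 / x; the two
    series then pair up as 1 / (w - z) - 1 / (w + z) with w = n + 1.\<close>
  have "(\<lambda>n. (inverse (of_nat (Suc n)) - inverse (1 + z + of_nat n)) - (inverse (of_nat (Suc n)) - inverse (1 - z + of_nat n)))
     sums ((Digamma (1 + z) + euler_mascheroni) - (Digamma (1 - z) + euler_mascheroni))"
    unfolding Digamma_def using zZ' summable_Digamma[of "1 + z"] summable_Digamma[of "1 - z"]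
    by (intro sums_diff) (auto simp: sums_iff)
  also have "((Digamma (1 + z) + euler_mascheroni) - (Digamma (1 - z) + euler_mascheroni)) 
     = 2 * pi * \<i> * of_real ((1 + exp (-x)) / (1 - exp (-x)) / 2 - 1 / x)"
  proof -
    define C where "C = (1 + exp (-x)) / (1 - exp (-x))"
    have "Digamma (1 + z) - Digamma (1 - z) = 1 / z - (Digamma (1 - z) - Digamma z)"
      by (simp add: D2)
    also have "1 / z = - \<i> * of_real (2 * pi / x)" using x by (simp add: z_def field_simps)
    finally have "Digamma (1 + z) - Digamma (1 - z) = - \<i> * of_real (2 * pi / x) + \<i> * of_real (pi * C)"
      unfolding D1 by (simp add: C_def)
    also have "\<dots> = 2 * pi * \<i> * of_real (C / 2 - 1 / x)" using x by (simp add: complex_eq_iff field_simps)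
    finally show ?thesis by (simp add: C_def)
  qed
  also have "(\<lambda>n. (inverse (of_nat (Suc n)) - inverse (1 + z + of_nat n)) - (inverse (of_nat (Suc n)) - inverse (1 - z + of_nat n)))
     = (\<lambda>n. 2 * pi * \<i> * of_real (2 * x / (x\<^sup>2 + 4 * pi\<^sup>2 * real (Suc n) ^ 2)))"
  proof
    fix n
    define w where "w = complex_of_real (real (Suc n))"
    have w: "w + z \<noteq> 0" "w - z \<noteq> 0" using zim by (auto simp: w_def complex_eq_iff)
    have ww: "w\<^sup>2 - z\<^sup>2 = of_real ((x\<^sup>2 + 4 * pi\<^sup>2 * real (Suc n) ^ 2) / (4 * pi\<^sup>2))"
      by (simp add: w_def z_def field_simps power_mult_distrib)
    have "(inverse (of_nat (Suc n)) - inverse (1 + z + of_nat n)) - (inverse (of_nat (Suc n)) - inverse (1 - z + of_nat n))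
      = inverse (w - z) - inverse (w + z)" by (simp add: w_def add_ac)
    also have "\<dots> = 2 * z / (w\<^sup>2 - z\<^sup>2)" using w by (simp add: field_simps power2_eq_square)
    also have "\<dots> = 2 * pi * \<i> * of_real (2 * x / (x\<^sup>2 + 4 * pi\<^sup>2 * real (Suc n) ^ 2))"
      unfolding ww by (simp add: z_def field_simps power2_eq_square del: of_nat_Suc)
    finally show "(inverse (of_nat (Suc n)) - inverse (1 + z + of_nat n)) - (inverse (of_nat (Suc n)) - inverse (1 - z + of_nat n)) = \<dots>" .
  qed
  finally have "(\<lambda>n. complex_of_real (2 * x / (x\<^sup>2 + 4 * pi\<^sup>2 * real (Suc n) ^ 2))) sums 
      of_real ((1 + exp (-x)) / (1 - exp (-x)) / 2 - 1 / x)"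
    by (subst (asm) sums_mult_iff) auto
  thus ?thesis by (simp only: sums_of_real_iff)
qed

section \<open>Mellin integrals evaluated by Tonelli's theorem\<close>

lemma nn_integral_Gamma_scaled:
  fixes a t :: real assumes a: "a > 0" and t: "t > 0"
  shows "(\<integral>\<^sup>+x. ennreal (indicator {0<..} x * x powr (a - 1) * exp (- t * x)) \<partial>lborel) = ennreal (Gamma a * t powr - a)"
proof -
  have "ennreal (Gamma a) = (\<integral>\<^sup>+x. ennreal (indicator {0..} x * x powr (a - 1) / exp x) \<partial>lborel)"
    by (rule Gamma_conv_nn_integral_real[OF a])
  also have "\<dots> = ennreal \<bar>t\<bar> * (\<integral>\<^sup>+x. ennreal (indicator {0..} (0 + t * x) * (0 + t * x) powr (a - 1) / exp (0 + t * x)) \<partial>lborel)"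
    using t by (intro nn_integral_real_affine) auto
  also have "\<dots> = (\<integral>\<^sup>+x. ennreal t * ennreal (indicator {0..} (0 + t * x) * (0 + t * x) powr (a - 1) / exp (0 + t * x)) \<partial>lborel)"
    using t by (subst nn_integral_cmult) auto
  also have "\<dots> = (\<integral>\<^sup>+x. ennreal (t powr a) * ennreal (indicator {0<..} x * x powr (a - 1) * exp (- t * x)) \<partial>lborel)"
  proof (intro nn_integral_cong)
    fix x :: real
    have "t * (indicator {0..} (0 + t * x) * (0 + t * x) powr (a - 1) / exp (0 + t * x)) =
       t powr a * (indicator {0<..} x * x powr (a - 1) * exp (- t * x))"
    proof (cases "x > 0")
      case True
      thus ?thesis using t by (simp add: powr_mult powr_diff exp_minus divide_simps)
    next
      case False
      thus ?thesis using t by (cases "x = 0") (auto simp: indicator_def zero_le_mult_iff)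
    qed
    thus "ennreal t * ennreal (indicator {0..} (0 + t * x) * (0 + t * x) powr (a - 1) / exp (0 + t * x)) =
       ennreal (t powr a) * ennreal (indicator {0<..} x * x powr (a - 1) * exp (- t * x))"
      using t by (simp flip: ennreal_mult')
  qed
  also have "\<dots> = ennreal (t powr a) * (\<integral>\<^sup>+x. ennreal (indicator {0<..} x * x powr (a - 1) * exp (- t * x)) \<partial>lborel)"
    by (subst nn_integral_cmult) auto
  finally have "ennreal (t powr - a) * ennreal (Gamma a) = ennreal (t powr -a) * ennreal (t powr a) * 
     (\<integral>\<^sup>+x. ennreal (indicator {0<..} x * x powr (a - 1) * exp (- t * x)) \<partial>lborel)"
    by (simp add: mult.assoc)
  also have "ennreal (t powr -a) * ennreal (t powr a) = 1"
    using t by (simp add: powr_minus flip: ennreal_mult')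
  finally show ?thesis using a by (simp add: ennreal_mult' mult.commute Gamma_real_pos less_imp_le)
qed

text \<open>For s < 0 the Mellin integral of exp(- a x) diverges at 0; subtracting it from 1 repairs
  this. The difference is the integral of x exp(- t x) over t in [0, a], so exchanging the integrals
  leads to the Gamma integral at s + 1 > 0. The constant is - Gamma(s).\<close>

lemma nn_integral_one_minus_exp:
  fixes s a :: real assumes s: "-1 < s" "s < 0" and a: "a \<ge> 0"
  shows "(\<integral>\<^sup>+x. ennreal (indicator {0<..} x * x powr (s - 1) * (1 - exp (- a * x))) \<partial>lborel)
     = ennreal (Gamma (s + 1) / (- s) * a powr - s)"
proof -
  have "(\<integral>\<^sup>+x. ennreal (indicator {0<..} x * x powr (s - 1) * (1 - exp (- a * x))) \<partial>lborel)
    = (\<integral>\<^sup>+x. \<integral>\<^sup>+t. ennreal (indicator {0..a} t * indicator {0<..} x * x powr s * exp (- t * x)) \<partial>lborel \<partial>lborel)"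
  proof (intro nn_integral_cong)
    fix x :: real
    show "ennreal (indicator {0<..} x * x powr (s - 1) * (1 - exp (- a * x))) 
       = (\<integral>\<^sup>+t. ennreal (indicator {0..a} t * indicator {0<..} x * x powr s * exp (- t * x)) \<partial>lborel)"
    proof (cases "x > 0")
      case True
      have "(\<integral>\<^sup>+t. ennreal (x * exp (- t * x)) * indicator {0..a} t \<partial>lborel) = ennreal (- exp (- a * x) - (- exp (- 0 * x)))"
        using a True by (intro nn_integral_FTC_Icc) (auto intro!: derivative_eq_intros)
      hence "ennreal (x powr (s - 1)) * ennreal (1 - exp (- a * x)) = ennreal (x powr (s - 1)) * (\<integral>\<^sup>+t. ennreal (x * exp (- t * x)) * indicator {0..a} t \<partial>lborel)"
        by simp
      also have "\<dots> = (\<integral>\<^sup>+t. ennreal (x powr (s - 1)) * (ennreal (x * exp (- t * x)) * indicator {0..a} t) \<partial>lborel)"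
        by (subst nn_integral_cmult) auto
      also have "\<dots> = (\<integral>\<^sup>+t. ennreal (indicator {0..a} t * indicator {0<..} x * x powr s * exp (- t * x)) \<partial>lborel)"
        using True by (intro nn_integral_cong) (auto simp: indicator_def powr_diff simp flip: ennreal_mult')
      finally show ?thesis using True a by (simp flip: ennreal_mult')
    qed auto
  qed
  also have "\<dots> = (\<integral>\<^sup>+t. \<integral>\<^sup>+x. ennreal (indicator {0..a} t * indicator {0<..} x * x powr s * exp (- t * x)) \<partial>lborel \<partial>lborel)"
    by (subst lborel_pair.Fubini') (auto simp: case_prod_unfold)
  also have "\<dots> = (\<integral>\<^sup>+t. ennreal (Gamma (s + 1)) * ennreal (indicator {0..a} t * t powr (- s - 1)) \<partial>lborel)"
  proof (intro nn_integral_cong_AE)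
    \<comment> \<open>At t = 0 the inner integral diverges, so this single point has to be
      discarded.\<close>
    have "AE t in lborel. t \<noteq> (0::real)" by (rule AE_lborel_singleton)
    thus "AE t in lborel. (\<integral>\<^sup>+x. ennreal (indicator {0..a} t * indicator {0<..} x * x powr s * exp (- t * x)) \<partial>lborel)
       = ennreal (Gamma (s + 1)) * ennreal (indicator {0..a} t * t powr (- s - 1))"
    proof eventually_elim
      case (elim t)
      show ?case
      proof (cases "t \<in> {0..a}")
        case True
        have "(\<integral>\<^sup>+x. ennreal (indicator {0..a} t * indicator {0<..} x * x powr s * exp (- t * x)) \<partial>lborel)
          = (\<integral>\<^sup>+x. ennreal (indicator {0<..} x * x powr ((s + 1) - 1) * exp (- t * x)) \<partial>lborel)"
          using True by simp
        also have "\<dots> = ennreal (Gamma (s + 1) * t powr - (s + 1))"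
          using True elim s by (intro nn_integral_Gamma_scaled) auto
        also have "\<dots> = ennreal (Gamma (s + 1)) * ennreal (t powr (- s - 1))"
          using s by (subst ennreal_mult') (auto simp: Gamma_real_pos less_imp_le)
        finally show ?thesis using True by simp
      qed auto
    qed
  qed
  also have "\<dots> = ennreal (Gamma (s + 1)) * (\<integral>\<^sup>+t. ennreal (indicator {0..a} t * t powr (- s - 1)) \<partial>lborel)"
    by (subst nn_integral_cmult) auto
  also have "(\<integral>\<^sup>+t. ennreal (indicator {0..a} t * t powr (- s - 1)) \<partial>lborel) = ennreal (a powr (- s - 1 + 1) / (- s - 1 + 1))"
    using s a by (intro nn_integral_has_integral_lebesgue has_integral_powr_from_0) auto
  finally show ?thesis using s by (simp add: Gamma_real_pos less_imp_le mult.commute flip: ennreal_mult')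
qed

text \<open>This is the Gamma integral after replacing its variable by \<open>x\<^sup>2\<close>,
  with Jacobian 2 x.\<close>

lemma nn_integral_gaussian_powr:
  fixes a t :: real assumes a: "a > 0" and t: "t > 0"
  shows "(\<integral>\<^sup>+x. ennreal (indicator {0<..} x * (2 * x powr (2 * a - 1)) * exp (- t * x\<^sup>2)) \<partial>lborel) = ennreal (Gamma a * t powr - a)"
proof -
  define f where "f = (\<lambda>x::real. x powr (a - 1) * exp (- t * x))"
  have nn: "(\<integral>\<^sup>+x. ennreal (indicator {0<..} x * f x) \<partial>lborel) = ennreal (Gamma a * t powr - a)"
    using nn_integral_Gamma_scaled[OF a t] by (simp add: f_def mult.assoc)
  have G0: "0 \<le> Gamma a * t powr - a" using a by (simp add: Gamma_real_pos less_imp_le)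
  have "((\<lambda>x. indicator {0<..} x * f x) has_integral (Gamma a * t powr - a)) UNIV"
    by (rule nn_integral_has_integral) (use nn G0 in \<open>auto simp: f_def\<close>)
  hence "(f has_integral (Gamma a * t powr - a)) {0<..}"
    by (subst has_integral_restrict_UNIV[symmetric], elim has_integral_eq_rhs[OF has_integral_eq, rotated 1])
       (auto simp: indicator_def)
  hence "f absolutely_integrable_on {0<..} \<and> integral {0<..} f = Gamma a * t powr - a"
    by (auto intro!: nonnegative_absolutely_integrable_1 simp: integral_unique f_def dest: has_integral_integrable)
  moreover have im: "(\<lambda>x::real. x\<^sup>2) ` {0<..} = {0<..}"
  proof safe
    fix x :: real assume "x > 0"
    thus "x \<in> (\<lambda>x. x\<^sup>2) ` {0<..}" by (intro image_eqI[of _ _ "sqrt x"]) auto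
  qed auto
  ultimately have "(\<lambda>x. \<bar>2 * x\<bar> * f (x\<^sup>2)) absolutely_integrable_on {0<..} \<and>
     integral {0<..} (\<lambda>x. \<bar>2 * x\<bar> * f (x\<^sup>2)) = Gamma a * t powr - a"
    by (subst has_absolute_integral_change_of_variables_1'[where g = "\<lambda>x. x\<^sup>2"])
       (auto intro!: derivative_eq_intros inj_onI)
  hence "((\<lambda>x. \<bar>2 * x\<bar> * f (x\<^sup>2)) has_integral Gamma a * t powr - a) {0<..}"
    by (metis absolutely_integrable_on_def integrable_integral set_lebesgue_integral_eq_integral(1))
  hence "(\<integral>\<^sup>+x. ennreal (indicator {0<..} x * (\<bar>2 * x\<bar> * f (x\<^sup>2))) \<partial>lborel) = ennreal (Gamma a * t powr - a)"
    by (intro nn_integral_has_integral_lebesgue) (auto simp: f_def)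
  also have "(\<lambda>x. indicator {0<..} x * (\<bar>2 * x\<bar> * f (x\<^sup>2))) = (\<lambda>x. indicator {0<..} x * (2 * x powr (2 * a - 1)) * exp (- t * x\<^sup>2))"
  proof
    fix x :: real
    show "indicator {0<..} x * (\<bar>2 * x\<bar> * f (x\<^sup>2)) = indicator {0<..} x * (2 * x powr (2 * a - 1)) * exp (- t * x\<^sup>2)"
    proof (cases "x > 0")
      case True
      have "x * x\<^sup>2 powr (a - 1) = x powr (1 + 2 * (a - 1))"
        using True powr_mult_base[of x "2 * (a - 1)"] by (simp add: powr_powr flip: powr_numeral)
      thus ?thesis using True by (simp add: f_def)
    qed auto
  qed
  finally show ?thesis .
qed

text \<open>Writing 1 / (x^2 + d^2) as the integral of exp(- t (x^2 + d^2)) over t > 0 leaves a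
  Gaussian integral in x and then a Gamma integral in t. The value is kept as a product of two Gamma
  values, the form in which it enters the functional equation.\<close>

lemma nn_integral_powr_over_sum_squares:
  fixes s d :: real assumes s: "-1 < s" "s < 1" and d: "d > 0"
  shows "(\<integral>\<^sup>+x. ennreal (indicator {0<..} x * x powr (s - 1) * (2 * x / (x\<^sup>2 + d\<^sup>2))) \<partial>lborel)
     = ennreal (Gamma ((s + 1) / 2) * Gamma ((1 - s) / 2) * d powr (s - 1))"
proof -
  have "(\<integral>\<^sup>+x. ennreal (indicator {0<..} x * x powr (s - 1) * (2 * x / (x\<^sup>2 + d\<^sup>2))) \<partial>lborel) =
    (\<integral>\<^sup>+x. \<integral>\<^sup>+t. ennreal (indicator {0<..} t * indicator {0<..} x * (2 * x powr s) * exp (- t * x\<^sup>2) * exp (- t * d\<^sup>2)) \<partial>lborel \<partial>lborel)"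
  proof (intro nn_integral_cong)
    fix x :: real
    show "ennreal (indicator {0<..} x * x powr (s - 1) * (2 * x / (x\<^sup>2 + d\<^sup>2))) =
      (\<integral>\<^sup>+t. ennreal (indicator {0<..} t * indicator {0<..} x * (2 * x powr s) * exp (- t * x\<^sup>2) * exp (- t * d\<^sup>2)) \<partial>lborel)"
    proof (cases "x > 0")
      case True
      define c where "c = x\<^sup>2 + d\<^sup>2"
      have c: "c > 0" using True by (simp add: c_def add_pos_nonneg)
      have "(\<integral>\<^sup>+t. ennreal (indicator {0<..} t * indicator {0<..} x * (2 * x powr s) * exp (- t * x\<^sup>2) * exp (- t * d\<^sup>2)) \<partial>lborel)
        = (\<integral>\<^sup>+t. ennreal (2 * x powr s) * ennreal (indicator {0<..} t * t powr (1 - 1) * exp (- c * t)) \<partial>lborel)"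
        using True by (intro nn_integral_cong) (auto simp: indicator_def c_def algebra_simps simp flip: ennreal_mult' exp_add)
      also have "\<dots> = ennreal (2 * x powr s) * (\<integral>\<^sup>+t. ennreal (indicator {0<..} t * t powr (1 - 1) * exp (- c * t)) \<partial>lborel)"
        by (subst nn_integral_cmult) auto
      also have "(\<integral>\<^sup>+t. ennreal (indicator {0<..} t * t powr (1 - 1) * exp (- c * t)) \<partial>lborel) = ennreal (Gamma 1 * c powr - 1)"
        using c by (intro nn_integral_Gamma_scaled) auto
      also have "ennreal (2 * x powr s) * \<dots> = ennreal (x powr (s - 1) * (2 * x / (x\<^sup>2 + d\<^sup>2)))"
        using True c by (subst ennreal_mult'[symmetric]) (auto simp: powr_minus powr_diff c_def divide_simps)
      finally show ?thesis using True by simp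
    qed auto
  qed
  also have "\<dots> = (\<integral>\<^sup>+t. \<integral>\<^sup>+x. ennreal (indicator {0<..} t * indicator {0<..} x * (2 * x powr s) * exp (- t * x\<^sup>2) * exp (- t * d\<^sup>2)) \<partial>lborel \<partial>lborel)"
    by (subst lborel_pair.Fubini') (auto simp: case_prod_unfold)
  also have "\<dots> = (\<integral>\<^sup>+t. ennreal (Gamma ((s + 1) / 2)) * ennreal (indicator {0<..} t * t powr ((1 - s) / 2 - 1) * exp (- d\<^sup>2 * t)) \<partial>lborel)"
  proof (intro nn_integral_cong)
    fix t :: real
    show "(\<integral>\<^sup>+x. ennreal (indicator {0<..} t * indicator {0<..} x * (2 * x powr s) * exp (- t * x\<^sup>2) * exp (- t * d\<^sup>2)) \<partial>lborel)
      = ennreal (Gamma ((s + 1) / 2)) * ennreal (indicator {0<..} t * t powr ((1 - s) / 2 - 1) * exp (- d\<^sup>2 * t))"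
    proof (cases "t > 0")
      case True
      have "(\<integral>\<^sup>+x. ennreal (indicator {0<..} t * indicator {0<..} x * (2 * x powr s) * exp (- t * x\<^sup>2) * exp (- t * d\<^sup>2)) \<partial>lborel)
        = (\<integral>\<^sup>+x. ennreal (exp (- t * d\<^sup>2)) * ennreal (indicator {0<..} x * (2 * x powr (2 * ((s + 1) / 2) - 1)) * exp (- t * x\<^sup>2)) \<partial>lborel)"
        using True by (intro nn_integral_cong) (auto simp: field_simps simp flip: ennreal_mult')
      also have "\<dots> = ennreal (exp (- t * d\<^sup>2)) * (\<integral>\<^sup>+x. ennreal (indicator {0<..} x * (2 * x powr (2 * ((s + 1) / 2) - 1)) * exp (- t * x\<^sup>2)) \<partial>lborel)"
        by (subst nn_integral_cmult) auto
      also have "(\<integral>\<^sup>+x. ennreal (indicator {0<..} x * (2 * x powr (2 * ((s + 1) / 2) - 1)) * exp (- t * x\<^sup>2)) \<partial>lborel)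
         = ennreal (Gamma ((s + 1) / 2) * t powr - ((s + 1) / 2))"
        using s True by (intro nn_integral_gaussian_powr) auto
      also have "ennreal (exp (- t * d\<^sup>2)) * \<dots> = ennreal (Gamma ((s + 1) / 2)) * ennreal (t powr ((1 - s) / 2 - 1) * exp (- d\<^sup>2 * t))"
        proof -
          have "- ((s + 1) / 2) = (1 - s) / 2 - 1" by (simp add: field_simps)
          moreover have "Gamma ((s + 1) / 2) \<ge> 0" using s by (intro less_imp_le Gamma_real_pos) auto
          ultimately show ?thesis by (simp only: ennreal_mult'[symmetric] exp_ge_zero) (simp add: mult_ac)
        qed
      finally show ?thesis using True by simp
    qed auto
  qed
  also have "\<dots> = ennreal (Gamma ((s + 1) / 2)) * (\<integral>\<^sup>+t. ennreal (indicator {0<..} t * t powr ((1 - s) / 2 - 1) * exp (- d\<^sup>2 * t)) \<partial>lborel)"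
    by (subst nn_integral_cmult) auto
  also have "(\<integral>\<^sup>+t. ennreal (indicator {0<..} t * t powr ((1 - s) / 2 - 1) * exp (- d\<^sup>2 * t)) \<partial>lborel) = ennreal (Gamma ((1 - s) / 2) * d\<^sup>2 powr - ((1 - s) / 2))"
    using s d by (intro nn_integral_Gamma_scaled) auto
  also have "d\<^sup>2 powr - ((1 - s) / 2) = d powr (s - 1)"
  proof -
    have "d\<^sup>2 powr - ((1 - s) / 2) = d powr (2 * - ((1 - s) / 2))"
      using d by (simp only: powr_powr[symmetric] powr_numeral)
    also have "2 * - ((1 - s) / 2) = s - 1" by (simp add: field_simps)
    finally show ?thesis .
  qed
  finally show ?thesis using s by (simp add: Gamma_real_pos less_imp_le mult.assoc flip: ennreal_mult')
qed

section \<open>Trapezoidal defects as Mellin integrals\<close>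

definition trap_defect :: "real \<Rightarrow> nat \<Rightarrow> real" where
  "trap_defect s n = ((real n + 1) powr (1 - s) - real n powr (1 - s)) / (1 - s) 
     - (real n powr - s + (real n + 1) powr - s) / 2"

text \<open>This is rule minus integral for exp(- t x) on t in [n, n + 1], equivalently integral
  minus rule for 1 - exp(- t x). As \<open>t powr - s\<close> is a Mellin integral of 1 - exp(- t
  x), \<open>trap_defect\<close> is the same Mellin integral of this kernel.\<close>

definition trap_kernel :: "nat \<Rightarrow> real \<Rightarrow> real" where
  "trap_kernel n x = (exp (- real n * x) + exp (- (real n + 1) * x)) / 2 
     - (exp (- real n * x) - exp (- (real n + 1) * x)) / x"

lemma trap_kernel_eq: "trap_kernel n x = exp (- x) ^ n * ((1 + exp (- x)) / 2 - (1 - exp (- x)) / x)"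
proof -
  have "exp (- real n * x) = exp (- x) ^ n" by (simp flip: exp_of_nat_mult)
  moreover have "exp (- (real n + 1) * x) = exp (- x) ^ n * exp (- x)"
    by (simp add: exp_add[symmetric] algebra_simps flip: exp_of_nat_mult)
  ultimately show ?thesis unfolding trap_kernel_def by (simp only:) (simp add: algebra_simps add_divide_distrib diff_divide_distrib)
qed

text \<open>The trapezoidal rule overestimates the integral of a convex function; after factoring
  out a power of exp(- x) this becomes the monotonicity of \<open>h\<close>.\<close>

lemma trap_kernel_nonneg:
  assumes "x > 0" shows "trap_kernel n x \<ge> 0"
proof -
  define h where "h = (\<lambda>y::real. y * (1 + exp (- y)) - 2 * (1 - exp (- y)))"
  have "h 0 \<le> h x"
  proof (rule DERIV_nonneg_imp_nondecreasing[of 0 x h])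
    fix y :: real assume y: "0 \<le> y"
    have "(h has_real_derivative (1 - (1 + y) * exp (- y))) (at y)"
      unfolding h_def by (auto intro!: derivative_eq_intros simp: algebra_simps)
    moreover have "(1 + y) * exp (- y) \<le> 1"
      using exp_ge_add_one_self[of y] by (simp add: exp_minus field_simps)
    ultimately show "\<exists>z. (h has_real_derivative z) (at y) \<and> 0 \<le> z" by force
  qed (use assms in auto)
  hence "(1 - exp (- x)) / x \<le> (1 + exp (- x)) / 2" using assms by (simp add: h_def field_simps)
  thus ?thesis unfolding trap_kernel_eq by simp
qed

lemma trap_kernel_sums:
  assumes x: "x > 0"
  shows "(\<lambda>n. trap_kernel n x) sums ((1 + exp (-x)) / (1 - exp (-x)) / 2 - 1 / x)"
proof -
  have "(\<lambda>n. exp (-x) ^ n * ((1 + exp (- x)) / 2 - (1 - exp (- x)) / x)) sums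
          (1 / (1 - exp (-x)) * ((1 + exp (- x)) / 2 - (1 - exp (- x)) / x))"
    using x by (intro sums_mult2 geometric_sums) auto
  moreover have "1 - exp (-x) \<noteq> 0" using x by simp
  hence "1 / (1 - exp (-x)) * ((1 + exp (- x)) / 2 - (1 - exp (- x)) / x) = (1 + exp (-x)) / (1 - exp (-x)) / 2 - 1 / x"
    using x by (simp add: divide_simps)
  ultimately show ?thesis by (simp add: trap_kernel_eq)
qed

text \<open>The representation of \<open>t powr - s\<close> is applied at the two endpoints, giving
  \<open>A\<close>, and under the integral over [n, n + 1], giving \<open>B\<close>. Subtraction is
  awkward for extended nonnegative values, so the endpoint part is added to both sides and cancelled
  once everything is known to be finite. Nonnegativity of the defect is then read off from the
  integral.\<close>

lemma trap_defect_nn_integral: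
  fixes s :: real assumes s: "-1 < s" "s < 0"
  shows "(\<integral>\<^sup>+x. ennreal (indicator {0<..} x * x powr (s - 1) * trap_kernel n x) \<partial>lborel)
       = ennreal (Gamma (s + 1) / (- s) * trap_defect s n)" (is "?I = _")
    and "trap_defect s n \<ge> 0"
proof -
  define c where "c = Gamma (s + 1) / (- s)"
  have c: "c > 0" using s by (auto simp: c_def intro!: divide_pos_neg Gamma_real_pos)
  define A where "A = (real n powr - s + (real n + 1) powr - s) / 2"
  define B where "B = ((real n + 1) powr (1 - s) - real n powr (1 - s)) / (1 - s)"
  have A0: "A \<ge> 0" by (simp add: A_def)
  have B0: "B \<ge> 0" using s by (auto simp: B_def intro!: divide_nonneg_pos powr_mono2)
  define f where "f = (\<lambda>a x::real. indicator {0<..} x * x powr (s - 1) * (1 - exp (- a * x)) :: real)"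
  have f0: "f a x \<ge> 0" if "a \<ge> 0" for a x using that by (auto simp: f_def indicator_def)
  have fm[measurable]: "case_prod f \<in> borel_measurable (borel \<Otimes>\<^sub>M borel)"
    unfolding f_def case_prod_unfold by measurable
  have J: "(\<integral>\<^sup>+x. ennreal (f a x) \<partial>lborel) = ennreal (c * a powr - s)" if "a \<ge> 0" for a
    using nn_integral_one_minus_exp[OF s that] by (simp add: f_def c_def)
  have "?I + ennreal (c * A) = ?I + (\<integral>\<^sup>+x. ennreal (f n x / 2) + ennreal (f (real n + 1) x / 2) \<partial>lborel)"
  proof -
    have h: "(\<integral>\<^sup>+x. ennreal (f a x / 2) \<partial>lborel) = ennreal (c * a powr - s / 2)" if "a \<ge> 0" for a
    proof -
      have "(\<integral>\<^sup>+x. ennreal (f a x / 2) \<partial>lborel) = (\<integral>\<^sup>+x. ennreal (1/2) * ennreal (f a x) \<partial>lborel)"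
        by (intro nn_integral_cong, subst ennreal_mult'[symmetric]) auto
      also have "\<dots> = ennreal (1/2) * ennreal (c * a powr - s)"
        by (subst nn_integral_cmult) (use J that in \<open>auto simp: f_def\<close>)
      also have "\<dots> = ennreal (c * a powr - s / 2)" by (subst ennreal_mult'[symmetric]) auto
      finally show ?thesis .
    qed
    have "(\<integral>\<^sup>+x. ennreal (f n x / 2) + ennreal (f (real n + 1) x / 2) \<partial>lborel) = ennreal (c * real n powr - s / 2) + ennreal (c * (real n + 1) powr - s / 2)"
      by (subst nn_integral_add) (use h in \<open>auto simp: f_def\<close>)
    also have "\<dots> = ennreal (c * A)" using c by (simp add: A_def algebra_simps add_divide_distrib flip: ennreal_plus)
    finally show ?thesis by simp
  qed
  also have "\<dots> = (\<integral>\<^sup>+x. ennreal (indicator {0<..} x * x powr (s - 1) * trap_kernel n x) + (ennreal (f n x / 2) + ennreal (f (real n + 1) x / 2)) \<partial>lborel)"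
    by (subst nn_integral_add[symmetric]) (auto simp: f_def trap_kernel_def)
  also have "\<dots> = (\<integral>\<^sup>+x. \<integral>\<^sup>+t. ennreal (indicator {real n..real n + 1} t * f t x) \<partial>lborel \<partial>lborel)"
  proof (intro nn_integral_cong)
    fix x :: real
    show "ennreal (indicator {0<..} x * x powr (s - 1) * trap_kernel n x) + (ennreal (f n x / 2) + ennreal (f (real n + 1) x / 2))
       = (\<integral>\<^sup>+t. ennreal (indicator {real n..real n + 1} t * f t x) \<partial>lborel)"
    proof (cases "x > 0")
      case True
      have "(\<integral>\<^sup>+t. ennreal (1 - exp (- t * x)) * indicator {real n..real n + 1} t \<partial>lborel) = 
         ennreal ((real n + 1 + exp (- (real n + 1) * x) / x) - (real n + exp (- real n * x) / x))"
        using True by (intro nn_integral_FTC_Icc) (auto intro!: derivative_eq_intros)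
      hence "ennreal (x powr (s - 1)) * (\<integral>\<^sup>+t. ennreal (1 - exp (- t * x)) * indicator {real n..real n + 1} t \<partial>lborel)
         = ennreal (x powr (s - 1) * (1 - (exp (- real n * x) - exp (- (real n + 1) * x)) / x))"
        by (simp add: diff_divide_distrib algebra_simps flip: ennreal_mult')
      also have "x powr (s - 1) * (1 - (exp (- real n * x) - exp (- (real n + 1) * x)) / x) = 
        x powr (s - 1) * trap_kernel n x + (f n x / 2 + f (real n + 1) x / 2)"
        using True by (simp add: trap_kernel_def f_def algebra_simps add_divide_distrib diff_divide_distrib)
      also have "ennreal \<dots> = ennreal (indicator {0<..} x * x powr (s - 1) * trap_kernel n x) + (ennreal (f n x / 2) + ennreal (f (real n + 1) x / 2))"
        using True f0 trap_kernel_nonneg by (simp flip: ennreal_plus)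
      finally have "ennreal (indicator {0<..} x * x powr (s - 1) * trap_kernel n x) + (ennreal (f n x / 2) + ennreal (f (real n + 1) x / 2))
         = ennreal (x powr (s - 1)) * (\<integral>\<^sup>+t. ennreal (1 - exp (- t * x)) * indicator {real n..real n + 1} t \<partial>lborel)" ..
      also have "\<dots> = (\<integral>\<^sup>+t. ennreal (x powr (s - 1)) * (ennreal (1 - exp (- t * x)) * indicator {real n..real n + 1} t) \<partial>lborel)"
        by (subst nn_integral_cmult) auto
      also have "\<dots> = (\<integral>\<^sup>+t. ennreal (indicator {real n..real n + 1} t * f t x) \<partial>lborel)"
        using True by (intro nn_integral_cong) (auto simp: f_def indicator_def simp flip: ennreal_mult')
      finally show ?thesis .
    qed (auto simp: f_def)
  qed
  also have "\<dots> = (\<integral>\<^sup>+t. \<integral>\<^sup>+x. ennreal (indicator {real n..real n + 1} t * f t x) \<partial>lborel \<partial>lborel)"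
    by (subst lborel_pair.Fubini') (auto simp: case_prod_unfold f_def)
  also have "\<dots> = (\<integral>\<^sup>+t. ennreal c * ennreal (indicator {real n..real n + 1} t * t powr - s) \<partial>lborel)"
    using c J by (intro nn_integral_cong) (auto simp: indicator_def simp flip: ennreal_mult')
  also have "\<dots> = ennreal c * (\<integral>\<^sup>+t. ennreal (indicator {real n..real n + 1} t * t powr - s) \<partial>lborel)"
    by (subst nn_integral_cmult) auto
  also have "(\<integral>\<^sup>+t. ennreal (indicator {real n..real n + 1} t * t powr - s) \<partial>lborel) = ennreal B"
  proof (rule nn_integral_has_integral_lebesgue)
    have "((\<lambda>t. t powr - s) has_integral ((real n + 1) powr (1 - s) / (1 - s) - real n powr (1 - s) / (1 - s))) {real n..real n + 1}"
    proof (rule fundamental_theorem_of_calculus_interior)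
      show "continuous_on {real n..real n + 1} (\<lambda>t. t powr (1 - s) / (1 - s))"
        using s by (intro continuous_intros continuous_on_powr') auto
      show "((\<lambda>t. t powr (1 - s) / (1 - s)) has_vector_derivative x powr - s) (at x)"
        if "x \<in> {real n<..<real n + 1}" for x
        using s that unfolding has_real_derivative_iff_has_vector_derivative[symmetric] 
        by (auto intro!: derivative_eq_intros)
    qed auto
    thus "((\<lambda>t. t powr - s) has_integral B) {real n..real n + 1}" by (simp add: B_def diff_divide_distrib)
  qed auto
  finally have eq: "?I + ennreal (c * A) = ennreal (c * B)" using c B0 by (simp flip: ennreal_mult')
  hence "?I \<noteq> \<infinity>" by auto
  then obtain i where i: "?I = ennreal i" "i \<ge> 0" by (cases ?I) auto
  have "i + c * A = c * B" using eq i A0 B0 c by (simp flip: ennreal_plus)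
  hence i': "i = c * trap_defect s n" by (simp add: trap_defect_def A_def B_def algebra_simps)
  show "?I = ennreal (Gamma (s + 1) / (- s) * trap_defect s n)" using i i' by (simp add: c_def)
  show "trap_defect s n \<ge> 0" using i i' c by (simp add: zero_le_mult_iff)
qed

lemma of_nat_powr_of_real: "of_nat n powr complex_of_real x = complex_of_real (real n powr x)"
  using powr_of_real[of "real n" x] by simp

text \<open>Both sides come from the Mellin transform of \<open>1 / (exp x - 1) - 1 / x + 1 / 2\<close>, expanded once
  into the kernels \<open>trap_kernel n\<close> and once into partial fractions. For real \<open>s\<close> between \<open>-1\<close> and \<open>0\<close>
  all terms are nonnegative, so sums and integrals commute.\<close>

lemma zeta_P_functional_real:
  fixes s :: real assumes s: "-1 < s" "s < 0"
  shows "Gamma (of_real s + 1) * zeta_P (of_real s) = 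
     2 * Gamma ((of_real s + 1) / 2) * Gamma ((3 - of_real s) / 2) * of_real (2 * pi) powr (of_real s - 1) * zeta_P (1 - of_real s)"
proof -
  define G where "G = Gamma ((s + 1) / 2) * Gamma ((1 - s) / 2)"
  have G: "G \<ge> 0" using s by (auto simp: G_def intro!: mult_nonneg_nonneg less_imp_le Gamma_real_pos)
  have G1: "Gamma (s + 1) > 0" using s by (auto intro!: Gamma_real_pos)
  have zt: "zeta_term n (of_real s) = of_real ((1 - s) * trap_defect s (Suc n))" for n
  proof -
    have "zeta_term n (of_real s) = of_real ((s - 1) / 2 * (real (Suc n) powr - s + (real (Suc n) + 1) powr - s)
       + (real (Suc n) + 1) powr (1 - s) - real (Suc n) powr (1 - s))"
      using of_nat_powr_of_real[of "Suc n" "-s"] of_nat_powr_of_real[of "Suc (Suc n)" "-s"] 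
        of_nat_powr_of_real[of "Suc n" "1-s"] of_nat_powr_of_real[of "Suc (Suc n)" "1-s"] 
      by (simp add: zeta_term_def add_ac)
    also have "(s - 1) / 2 * (real (Suc n) powr - s + (real (Suc n) + 1) powr - s)
       + (real (Suc n) + 1) powr (1 - s) - real (Suc n) powr (1 - s) = (1 - s) * trap_defect s (Suc n)"
      using s by (simp add: trap_defect_def right_diff_distrib del: of_nat_Suc) (simp add: field_simps del: of_nat_Suc)
    finally show ?thesis .
  qed
  have "(\<lambda>n. zeta_term n (of_real s)) sums (zeta_P s - (s + 1) / 2)"
    using summable_zeta_term[of "of_real s"] s by (simp add: sums_iff zeta_P_def)
  hence "(\<lambda>n. zeta_term n (of_real s) / (1 - s)) sums ((zeta_P s - (s + 1) / 2) / (1 - s))"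
    by (rule sums_divide)
  also have "(\<lambda>n. zeta_term n (of_real s) / (1 - s)) = (\<lambda>n. of_real (trap_defect s (Suc n)))"
    using s by (intro ext) (simp add: zt)
  finally have "(\<lambda>n. of_real (trap_defect s n)) sums ((zeta_P s - (s + 1) / 2) / (1 - s) + of_real (trap_defect s 0))"
    by (subst sums_Suc_iff[symmetric]) simp
  \<comment> \<open>Since \<open>0 powr x\<close> is 0, the interval [0, 1] contributes exactly the
    summand (s + 1) / 2 of \<open>zeta_P\<close>, divided by 1 - s. Starting at index 0 thus absorbs
    it.\<close>
  also have "trap_defect s 0 = (s + 1) / 2 / (1 - s)" using s by (simp add: trap_defect_def field_simps)
  also have "(zeta_P s - (s + 1) / 2) / (1 - s) + of_real ((s + 1) / 2 / (1 - s)) = zeta_P s / (1 - s)"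
    by (simp add: diff_divide_distrib)
  finally have sums1: "(\<lambda>n. complex_of_real (trap_defect s n)) sums (zeta_P s / (1 - s))" .
  define p where "p = Re (zeta_P s / (1 - s))"
  have sump: "trap_defect s sums p" using sums_Re[OF sums1] by (simp add: p_def)
  hence p: "zeta_P s / (1 - s) = of_real p" using sums_unique2[OF sums1] by (simp flip: sums_of_real_iff[where 'a = complex])
  have p0: "p \<ge> 0" using sums_le[OF _ sums_zero sump] trap_defect_nn_integral(2)[OF s] by auto

  have sums2: "(\<lambda>n. complex_of_real (real (Suc n) powr (s - 1))) sums (zeta_P (1 - s) / (- s))"
  proof -
    have "1 / of_nat (Suc n) powr (1 - complex_of_real s) = complex_of_real (real (Suc n) powr (s - 1))" for n
      using of_nat_powr_of_real[of "Suc n" "1 - s"] powr_minus_divide[of "real (Suc n)" "1 - s"]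
      by (simp del: of_nat_Suc)
    thus ?thesis using zeta_P_sums[of "1 - of_real s"] s by simp
  qed
  define q where "q = Re (zeta_P (1 - s) / (- s))"
  have sumq: "(\<lambda>n. real (Suc n) powr (s - 1)) sums q" using sums_Re[OF sums2] by (simp add: q_def)
  hence q: "zeta_P (1 - s) / (- s) = of_real q" using sums_unique2[OF sums2] by (simp flip: sums_of_real_iff[where 'a = complex])
  have q0: "q \<ge> 0" using sums_le[OF _ sums_zero sumq] by auto

  have "ennreal (Gamma (s + 1) / (- s) * p) = (\<Sum>n. ennreal (Gamma (s + 1) / (- s) * trap_defect s n))"
    using s G1 trap_defect_nn_integral(2)[OF s]
    by (intro suminf_ennreal_eq[symmetric] sums_mult sump mult_nonneg_nonneg) (auto intro!: divide_nonneg_neg)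
  also have "\<dots> = (\<Sum>n. (\<integral>\<^sup>+x. ennreal (indicator {0<..} x * x powr (s - 1) * trap_kernel n x) \<partial>lborel))"
    by (simp add: trap_defect_nn_integral(1)[OF s])
  also have "\<dots> = (\<integral>\<^sup>+x. (\<Sum>n. ennreal (indicator {0<..} x * x powr (s - 1) * trap_kernel n x)) \<partial>lborel)"
    by (subst nn_integral_suminf) (auto simp: trap_kernel_def)
  also have "\<dots> = (\<integral>\<^sup>+x. (\<Sum>n. ennreal (indicator {0<..} x * x powr (s - 1) * (2 * x / (x\<^sup>2 + (2 * pi * real (Suc n))\<^sup>2)))) \<partial>lborel)"
  proof (intro nn_integral_cong)
    fix x :: real
    show "(\<Sum>n. ennreal (indicator {0<..} x * x powr (s - 1) * trap_kernel n x)) = 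
       (\<Sum>n. ennreal (indicator {0<..} x * x powr (s - 1) * (2 * x / (x\<^sup>2 + (2 * pi * real (Suc n))\<^sup>2))))"
    proof (cases "x > 0")
      case True
      define S where "S = (1 + exp (-x)) / (1 - exp (-x)) / 2 - 1 / x"
      have "(\<Sum>n. ennreal (indicator {0<..} x * x powr (s - 1) * trap_kernel n x)) = ennreal (indicator {0<..} x * x powr (s - 1) * S)"
        using True trap_kernel_nonneg[OF True] unfolding S_def
        by (intro suminf_ennreal_eq sums_mult trap_kernel_sums) auto
      moreover have "(\<Sum>n. ennreal (indicator {0<..} x * x powr (s - 1) * (2 * x / (x\<^sup>2 + (2 * pi * real (Suc n))\<^sup>2)))) = ennreal (indicator {0<..} x * x powr (s - 1) * S)"
        using True coth_partial_fractions[OF True] unfolding S_def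
        by (intro suminf_ennreal_eq sums_mult) (auto simp: power_mult_distrib)
      ultimately show ?thesis by simp
    qed auto
  qed
  also have "\<dots> = (\<Sum>n. (\<integral>\<^sup>+x. ennreal (indicator {0<..} x * x powr (s - 1) * (2 * x / (x\<^sup>2 + (2 * pi * real (Suc n))\<^sup>2))) \<partial>lborel))"
    by (subst nn_integral_suminf) auto
  also have "\<dots> = (\<Sum>n. ennreal (G * (2 * pi * real (Suc n)) powr (s - 1)))"
    using s by (subst nn_integral_powr_over_sum_squares) (auto simp: G_def)
  also have "\<dots> = ennreal (G * ((2 * pi) powr (s - 1) * q))"
  proof (rule suminf_ennreal_eq)
    have "(\<lambda>n. G * ((2 * pi) powr (s - 1) * real (Suc n) powr (s - 1))) sums (G * ((2 * pi) powr (s - 1) * q))"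
      by (intro sums_mult sumq)
    thus "(\<lambda>n. G * (2 * pi * real (Suc n)) powr (s - 1)) sums (G * ((2 * pi) powr (s - 1) * q))"
      by (subst powr_mult) auto
  qed (use G in auto)
  finally have "Gamma (s + 1) / (- s) * p = G * ((2 * pi) powr (s - 1) * q)"
    using s G G1 p0 q0 by (subst (asm) ennreal_inj) (auto intro!: mult_nonneg_nonneg divide_nonneg_neg)
  hence "Gamma (s + 1) * p = G * (2 * pi) powr (s - 1) * (q * (-s))"
    using s by (simp add: field_simps)
  hence "complex_of_real (Gamma (s + 1) * p) * (1 - s) = of_real (G * (2 * pi) powr (s - 1) * (q * (-s))) * (1 - s)"
    by simp
  moreover have "zeta_P s = of_real p * (1 - s)" using p s by (simp add: field_simps)
  moreover have "zeta_P (1 - s) = of_real (q * (- s))"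
  proof -
    have "zeta_P (1 - s) = zeta_P (1 - s) / (- s) * (- s)" using s by simp
    thus ?thesis unfolding q by simp
  qed
  ultimately have "of_real (Gamma (s + 1)) * zeta_P s = of_real ((1 - s) * G * (2 * pi) powr (s - 1)) * zeta_P (1 - s)"
    by (simp add: mult_ac)
  \<comment> \<open>The factor 1 - s cancels the pole of Gamma((1 - s) / 2) at s = 1, so that the
    identity can later be continued past this point.\<close>
  also have "(1 - s) * G = 2 * Gamma ((s + 1) / 2) * Gamma ((3 - s) / 2)"
  proof -
    have "Gamma ((1 - s) / 2 + 1) = (1 - s) / 2 * Gamma ((1 - s) / 2)" using s by (intro Gamma_plus1) auto
    moreover have "(1 - s) / 2 + 1 = (3 - s) / 2" by (simp add: field_simps)
    ultimately show ?thesis by (simp add: G_def)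
  qed
  also have "complex_of_real (Gamma (s + 1)) = Gamma (of_real s + 1)"
    using Gamma_complex_of_real[of "s + 1"] by simp
  also have "complex_of_real (2 * Gamma ((s + 1) / 2) * Gamma ((3 - s) / 2) * (2 * pi) powr (s - 1)) 
     = 2 * Gamma ((of_real s + 1) / 2) * Gamma ((3 - of_real s) / 2) * of_real (2 * pi) powr (of_real s - 1)"
    using Gamma_complex_of_real[of "(s + 1) / 2"] Gamma_complex_of_real[of "(3 - s) / 2"] powr_of_real[of "2 * pi" "s - 1"]
    by (simp del: Gamma_complex_of_real)
  finally show ?thesis by simp
qed

section \<open>Meromorphic continuation\<close>

text \<open>The identity theorem extends the equation from the segment (-1, 0). The strip is the
  region where s and 1 - s both have real part above -1, and there all Gamma arguments have positive
  real part.\<close>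

lemma zeta_P_functional:
  assumes s: "-1 < Re s" "Re s < 2"
  shows "Gamma (s + 1) * zeta_P s = 
     2 * Gamma ((s + 1) / 2) * Gamma ((3 - s) / 2) * of_real (2 * pi) powr (s - 1) * zeta_P (1 - s)"
proof -
  define f where "f = (\<lambda>s. Gamma (s + 1) * zeta_P s - 
     2 * Gamma ((s + 1) / 2) * Gamma ((3 - s) / 2) * of_real (2 * pi) powr (s - 1) * zeta_P (1 - s))"
  define S where "S = {s. Re s > -1} \<inter> {s. Re s < 2}"
  have nonpos: "z \<notin> \<int>\<^sub>\<le>\<^sub>0" if "Re z > 0" for z
    using that by (auto elim!: nonpos_Ints_cases)
  have "f s = 0"
  proof (rule analytic_continuation[of f S "complex_of_real ` {-1<..<0}" "of_real (-1/2)" s])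
    have "(\<lambda>s. zeta_P (1 - s)) holomorphic_on S"
      by (intro holomorphic_on_compose_gen[OF _ holomorphic_zeta_P, unfolded o_def] holomorphic_intros)
         (auto simp: S_def)
    moreover have "zeta_P holomorphic_on S"
      by (rule holomorphic_on_subset[OF holomorphic_zeta_P]) (auto simp: S_def)
    ultimately show "f holomorphic_on S"
      unfolding f_def by (intro holomorphic_intros) (auto simp: S_def intro!: nonpos)
    show "open S" unfolding S_def by (intro open_Int open_halfspace_Re_gt open_halfspace_Re_lt)
    show "connected S" unfolding S_def 
      by (intro convex_connected convex_Int convex_halfspace_Re_gt convex_halfspace_Re_lt)
    show "of_real ` {-1<..<0} \<subseteq> S" by (auto simp: S_def)
    show "complex_of_real (-1/2) \<in> S" by (auto simp: S_def)
    have "(-1/2::real) islimpt {-1<..<0}" by (intro open_imp_islimpt) auto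
    thus "complex_of_real (-1/2) islimpt of_real ` {-1<..<0}"
      by (intro islimpt_isCont_image) (auto simp: eventually_at_filter complex_eq_iff intro!: always_eventually)
    show "f z = 0" if "z \<in> of_real ` {-1<..<0}" for z
      using that zeta_P_functional_real by (auto simp: f_def)
    show "s \<in> S" using s by (auto simp: S_def)
  qed
  thus ?thesis by (simp add: f_def)
qed

lemma zeta_P_reflect_zero:
  assumes s: "0 < Re s" "Re s < 1" and 0: "zeta_P s = 0"
  shows "zeta_P (1 - s) = 0"
proof -
  have "Gamma z \<noteq> 0" if "Re z > 0" for z :: complex
    using that by (auto simp: Gamma_eq_zero_iff elim!: nonpos_Ints_cases)
  from this[of "(s + 1) / 2"] this[of "(3 - s) / 2"] show ?thesis
    using zeta_P_functional[of s] s 0 by simp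
qed

text \<open>The second branch is the functional equation, rewritten with the duplication formula so that the
  poles of \<open>Gamma ((s + 1) / 2)\<close> are absorbed into \<open>rGamma\<close>.\<close>

definition zeta_F :: "complex \<Rightarrow> complex" where
  "zeta_F s = (if Re s > -1 then zeta_P s else 
     2 * exp (- s * of_real (ln 2)) * of_real (sqrt pi) * rGamma (s / 2 + 1) * Gamma ((3 - s) / 2) * of_real (2 * pi) powr (s - 1) * zeta_P (1 - s))"

text \<open>Agreement of the two branches on -1 < Re s < 0 is the point: two holomorphic functions
  on overlapping open half planes then glue to an entire one.\<close>

lemma zeta_F_left:
  assumes "Re s < 0"
  shows "zeta_F s = 2 * exp (- s * of_real (ln 2)) * of_real (sqrt pi) * rGamma (s / 2 + 1) * Gamma ((3 - s) / 2) * of_real (2 * pi) powr (s - 1) * zeta_P (1 - s)"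
proof (cases "Re s > -1")
  case True
  have nonpos: "z \<notin> \<int>\<^sub>\<le>\<^sub>0" if "Re z > 0" for z
    using that by (auto elim!: nonpos_Ints_cases)
  have "Gamma ((s + 1) / 2) * Gamma ((s + 1) / 2 + 1 / 2) =
     exp ((1 - 2 * ((s + 1) / 2)) * of_real (ln 2)) * of_real (sqrt pi) * Gamma (2 * ((s + 1) / 2))"
    using True by (intro Gamma_legendre_duplication nonpos) (simp_all add: add_pos_pos)
  moreover have "(s + 1) / 2 + 1 / 2 = s / 2 + 1" "1 - 2 * ((s + 1) / 2) = - s" "2 * ((s + 1) / 2) = s + 1"
    by (simp_all add: field_simps)
  ultimately have dup: "Gamma ((s + 1) / 2) * Gamma (s / 2 + 1) = exp (- s * of_real (ln 2)) * of_real (sqrt pi) * Gamma (s + 1)"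
    by (simp only:)
  have nz: "Gamma (s + 1) \<noteq> 0" "Gamma (s / 2 + 1) \<noteq> 0"
    using True by (auto simp: Gamma_eq_zero_iff intro!: nonpos)
  hence g: "Gamma ((s + 1) / 2) = exp (- s * of_real (ln 2)) * of_real (sqrt pi) * Gamma (s + 1) * rGamma (s / 2 + 1)"
    using dup by (simp add: rGamma_inverse_Gamma field_simps)
  have "Gamma (s + 1) * zeta_P s = Gamma (s + 1) * (2 * exp (- s * of_real (ln 2)) * of_real (sqrt pi) * rGamma (s / 2 + 1) * Gamma ((3 - s) / 2) * of_real (2 * pi) powr (s - 1) * zeta_P (1 - s))"
    using zeta_P_functional[of s] True assms unfolding g by (simp add: mult_ac)
  thus ?thesis using nz True unfolding zeta_F_def by simp
qed (simp add: zeta_F_def)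

lemma zeta_F_eq_P: "Re s > -1 \<Longrightarrow> zeta_F s = zeta_P s"
  by (simp add: zeta_F_def)

lemma holomorphic_zeta_F: "zeta_F holomorphic_on A"
proof -
  have nonpos: "z \<notin> \<int>\<^sub>\<le>\<^sub>0" if "Re z > 0" for z
    using that by (auto elim!: nonpos_Ints_cases)
  have "(\<lambda>s. zeta_P (1 - s)) holomorphic_on {s. Re s < 0}"
    by (intro holomorphic_on_compose_gen[OF _ holomorphic_zeta_P, unfolded o_def] holomorphic_intros) auto
  hence "(\<lambda>s. 2 * exp (- s * of_real (ln 2)) * of_real (sqrt pi) * rGamma (s / 2 + 1) * Gamma ((3 - s) / 2) * of_real (2 * pi) powr (s - 1) * zeta_P (1 - s)) holomorphic_on {s. Re s < 0}"
    by (intro holomorphic_intros) (auto intro!: nonpos)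
  hence "zeta_F holomorphic_on {s. Re s < 0}"
    by (rule holomorphic_transform) (use zeta_F_left in auto)
  moreover have "zeta_F holomorphic_on {s. Re s > -1}"
    by (rule holomorphic_transform[OF holomorphic_zeta_P]) (simp add: zeta_F_def)
  ultimately have "zeta_F holomorphic_on ({s. Re s < 0} \<union> {s. Re s > -1})"
    by (intro holomorphic_on_Un open_halfspace_Re_gt open_halfspace_Re_lt)
  also have "{s. Re s < 0} \<union> {s. Re s > -1} = UNIV" by auto
  finally show ?thesis by (rule holomorphic_on_subset) auto
qed

text \<open>The only singularity is s = 1, a genuine pole because \<open>zeta_P 1 = 1\<close>.
  Division by zero yields 0 there, which is the value that \<open>nicely_meromorphic_on\<close>
  prescribes at a pole.\<close>

lemma nicely_meromorphic_zeta_F: "(\<lambda>s. zeta_F s / (s - 1)) nicely_meromorphic_on UNIV"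
proof (rule nicely_meromorphic_onI_open)
  have hol: "(\<lambda>s. zeta_F s / (s - 1)) holomorphic_on (UNIV - {1})"
    by (intro holomorphic_intros holomorphic_zeta_F) auto
  thus an: "(\<lambda>s. zeta_F s / (s - 1)) analytic_on (UNIV - {1})"
    by (subst analytic_on_open) auto
  have "isCont zeta_F 1"
    using holomorphic_zeta_F[of UNIV] holomorphic_on_imp_continuous_on continuous_on_eq_continuous_at by blast
  moreover have "filterlim (\<lambda>s. s - 1) (at 0) (at (1::complex))"
    by (intro filterlim_atI tendsto_eq_intros) (auto simp: eventually_at_filter)
  ultimately have "is_pole (\<lambda>s. zeta_F s / (s - 1)) 1"
    by (intro is_pole_divide) (auto simp: zeta_F_eq_P zeta_P_1)
  thus "is_pole (\<lambda>s. zeta_F s / (s - 1)) x \<and> zeta_F x / (x - 1) = 0" if "x \<in> {1}" for x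
    using that by auto
  show "isolated_singularity_at (\<lambda>s. zeta_F s / (s - 1)) x" for x
  proof (cases "x = 1")
    case True
    thus ?thesis using isolated_singularity_at_holomorphic[OF hol] by auto
  next
    case False
    hence "(\<lambda>s. zeta_F s / (s - 1)) analytic_on {x}" using an by (rule_tac analytic_on_subset) auto
    thus ?thesis by (rule isolated_singularity_at_analytic)
  qed
qed auto

text \<open>The difference is zero off a sparse set or nonzero off one, and its behaviour near
  \<open>z0\<close> excludes the latter. Every value is determined by a punctured neighbourhood: it
  is 0 at a pole and the limit elsewhere. Hence equality off a sparse set is equality
  everywhere.\<close>

lemma nicely_meromorphic_eqI:
  assumes f: "f nicely_meromorphic_on UNIV" and g: "g nicely_meromorphic_on UNIV"
    and eq: "eventually (\<lambda>z. f z = g z) (at z0)"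
  shows "f = g"
proof
  fix z
  have "(\<lambda>z. f z - g z) meromorphic_on UNIV"
    using f g by (auto simp: nicely_meromorphic_on_def intro!: meromorphic_intros)
  moreover have "\<not> (\<forall>\<^sub>\<approx>z\<in>UNIV. f z - g z \<noteq> 0)"
  proof
    assume "\<forall>\<^sub>\<approx>z\<in>UNIV. f z - g z \<noteq> 0"
    hence "eventually (\<lambda>z. f z - g z \<noteq> 0) (at z0)" by (simp add: eventually_cosparse_open_eq)
    with eq have "eventually (\<lambda>z. False) (at z0)" by eventually_elim auto
    thus False by simp
  qed
  ultimately have "\<forall>\<^sub>\<approx>z\<in>UNIV. f z - g z = 0"
    using meromorphic_imp_constant_or_avoid[of "\<lambda>z. f z - g z" UNIV 0] by auto
  hence ev: "eventually (\<lambda>z. f z = g z) (at z)" by (simp add: eventually_cosparse_open_eq)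
  have pole: "is_pole f z \<longleftrightarrow> is_pole g z" by (intro is_pole_cong ev refl)
  have lim: "f \<midarrow>z\<rightarrow> c \<longleftrightarrow> g \<midarrow>z\<rightarrow> c" for c by (intro tendsto_cong ev)
  have dich: "(is_pole h z \<and> h z = 0) \<or> (h \<midarrow>z\<rightarrow> h z \<and> \<not> is_pole h z)" if "h nicely_meromorphic_on UNIV" for h
    using that unfolding nicely_meromorphic_on_def is_pole_def 
    by (meson UNIV_I at_neq_bot not_tendsto_and_filterlim_at_infinity)
  show "f z = g z"
    using dich[OF f] dich[OF g] pole lim by (metis LIM_unique)
qed

lemma zeta_eq: "zeta s = zeta_F s / (s - 1)"
proof -
  have sums: "(\<lambda>n. 1 / of_nat (Suc n) powr s) sums (zeta_F s / (s - 1))" if "Re s > 1" for s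
    using zeta_P_sums[OF that] that by (simp add: zeta_F_eq_P)
  have "zeta = (\<lambda>s. zeta_F s / (s - 1))"
    unfolding zeta_def
  proof (rule the_equality)
    show "(\<lambda>s. zeta_F s / (s - 1)) nicely_meromorphic_on UNIV \<and>
      (\<forall>s. Re s > 1 \<longrightarrow> (\<lambda>n. 1 / of_nat (Suc n) powr s) sums (zeta_F s / (s - 1)))"
      using nicely_meromorphic_zeta_F sums by blast
    fix f assume f: "f nicely_meromorphic_on UNIV \<and> (\<forall>s. Re s > 1 \<longrightarrow> (\<lambda>n. 1 / of_nat (Suc n) powr s) sums f s)"
    have eq: "f s = zeta_F s / (s - 1)" if "Re s > 1" for s
      using f sums[OF that] that sums_unique2 by blast
    show "f = (\<lambda>s. zeta_F s / (s - 1))"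
    proof (rule nicely_meromorphic_eqI)
      have "eventually (\<lambda>s. s \<in> {s. Re s > 1}) (at 2)"
        by (intro eventually_at_in_open' open_halfspace_Re_gt) auto
      thus "eventually (\<lambda>s. f s = zeta_F s / (s - 1)) (at 2)"
        by eventually_elim (simp add: eq)
    qed (use f nicely_meromorphic_zeta_F in auto)
  qed
  thus ?thesis by (rule fun_cong)
qed

lemma zeta_eq_P: "Re s > -1 \<Longrightarrow> zeta s = zeta_P s / (s - 1)"
  by (simp add: zeta_eq zeta_F_eq_P)

lemma zeta_sums: "Re s > 1 \<Longrightarrow> (\<lambda>n. 1 / of_nat (Suc n) powr s) sums zeta s"
  using zeta_P_sums[of s] by (simp add: zeta_eq_P)

lemma zeta_cnj: "Re s > -1 \<Longrightarrow> zeta (cnj s) = cnj (zeta s)"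
  by (simp add: zeta_eq_P zeta_P_cnj)

lemma zeta_measurable [measurable]: "zeta \<in> borel_measurable borel"
proof -
  have [measurable]: "zeta_F \<in> borel_measurable borel"
    by (intro borel_measurable_continuous_onI holomorphic_on_imp_continuous_on holomorphic_zeta_F)
  show ?thesis unfolding zeta_eq[abs_def] by measurable
qed

section \<open>The Euler product and the line Re s = 1\<close>

text \<open>These are the integers that survive the sieve by all primes below \<open>N\<close>:
  multiplying the full sum of f by the factors 1 - f p with p < N leaves the sum over this
  set.\<close>

definition rough_nats :: "nat \<Rightarrow> nat set" where
  "rough_nats N = {n. n > 0 \<and> (\<forall>p. prime p \<and> p dvd n \<longrightarrow> p \<ge> N)}"

text \<open>Expanding the product of 1 - f p over the primes p < N gives one term mu(n) f(n) for
  each n in this set.\<close>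

definition squarefree_smooth_nats :: "nat \<Rightarrow> nat set" where
  "squarefree_smooth_nats N = {n. squarefree n \<and> (\<forall>p. prime p \<and> p dvd n \<longrightarrow> p < N)}"

lemma rough_nats_Suc_not_prime:
  assumes "\<not> prime N" shows "rough_nats (Suc N) = rough_nats N"
  unfolding rough_nats_def using assms by (auto simp: Suc_le_eq dest: le_neq_trans) 

lemma rough_nats_Suc_prime:
  assumes N: "prime N"
  shows "(*) N ` rough_nats N \<subseteq> rough_nats N" "rough_nats (Suc N) = rough_nats N - (*) N ` rough_nats N"
proof -
  show "(*) N ` rough_nats N \<subseteq> rough_nats N"
    using N by (auto simp: rough_nats_def prime_dvd_mult_iff prime_gt_0_nat dest: primes_dvd_imp_eq)
  show "rough_nats (Suc N) = rough_nats N - (*) N ` rough_nats N"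
  proof (intro set_eqI iffI)
    fix n assume n: "n \<in> rough_nats (Suc N)"
    hence "\<not> N dvd n" using N by (auto simp: rough_nats_def)
    thus "n \<in> rough_nats N - (*) N ` rough_nats N"
      using n by (auto simp: rough_nats_def)
  next
    fix n assume n: "n \<in> rough_nats N - (*) N ` rough_nats N"
    have "p \<noteq> N" if p: "prime p" "p dvd n" for p
    proof
      assume "p = N"
      then obtain m where m: "n = N * m" using p by auto
      hence "m \<in> rough_nats N" using n by (auto simp: rough_nats_def)
      thus False using n m by auto
    qed
    moreover have "N \<le> p" if "prime p" "p dvd n" for p using n that by (auto simp: rough_nats_def)
    ultimately have "Suc N \<le> p" if "prime p" "p dvd n" for p using that by (metis Suc_leI le_neq_implies_less)
    moreover have "n > 0" using n by (auto simp: rough_nats_def)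
    ultimately show "n \<in> rough_nats (Suc N)" by (simp add: rough_nats_def)
  qed
qed

lemma squarefree_smooth_nats_Suc_not_prime:
  assumes "\<not> prime N" shows "squarefree_smooth_nats (Suc N) = squarefree_smooth_nats N"
  unfolding squarefree_smooth_nats_def using assms less_Suc_eq by auto

lemma squarefree_smooth_nats_Suc_prime:
  assumes N: "prime N"
  shows "squarefree_smooth_nats (Suc N) = squarefree_smooth_nats N \<union> (*) N ` squarefree_smooth_nats N"
    and "squarefree_smooth_nats N \<inter> (*) N ` squarefree_smooth_nats N = {}"
proof -
  show "squarefree_smooth_nats N \<inter> (*) N ` squarefree_smooth_nats N = {}"
    using N by (auto simp: squarefree_smooth_nats_def)
  show "squarefree_smooth_nats (Suc N) = squarefree_smooth_nats N \<union> (*) N ` squarefree_smooth_nats N"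
  proof (intro set_eqI iffI)
    fix n assume n: "n \<in> squarefree_smooth_nats (Suc N)"
    show "n \<in> squarefree_smooth_nats N \<union> (*) N ` squarefree_smooth_nats N"
    proof (cases "N dvd n")
      case True
      then obtain m where m: "n = N * m" by auto
      have "\<not> N dvd m"
      proof
        assume "N dvd m"
        hence "N\<^sup>2 dvd n" using m by (auto simp: power2_eq_square)
        thus False using n squarefreeD[of n N] N by (auto simp: squarefree_smooth_nats_def)
      qed
      moreover have "squarefree m" using n m squarefree_multD(2)[of N m] by (auto simp: squarefree_smooth_nats_def)
      ultimately have "m \<in> squarefree_smooth_nats N"
        using n m by (auto simp: squarefree_smooth_nats_def) (metis dvd_mult less_SucE)
      thus ?thesis using m by auto
    next
      case False
      thus ?thesis using n by (auto simp: squarefree_smooth_nats_def) (metis less_SucE)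
    qed
  next
    fix n assume "n \<in> squarefree_smooth_nats N \<union> (*) N ` squarefree_smooth_nats N"
    thus "n \<in> squarefree_smooth_nats (Suc N)"
    proof
      assume "n \<in> (*) N ` squarefree_smooth_nats N"
      then obtain m where m: "n = N * m" "m \<in> squarefree_smooth_nats N" by auto
      hence "\<not> N dvd m" using N by (auto simp: squarefree_smooth_nats_def)
      hence "coprime N m" using N by (simp add: prime_imp_coprime)
      hence "squarefree n" using m N \<open>coprime N m\<close> squarefree_mult_coprime[of N m] squarefree_prime[of N] by (auto simp: squarefree_smooth_nats_def)
      thus ?thesis using m N by (auto simp: squarefree_smooth_nats_def prime_dvd_mult_iff primes_dvd_imp_eq less_Suc_eq)
    qed (auto simp: squarefree_smooth_nats_def less_Suc_eq)
  qed
qed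

lemma moebius_mu_prime_mult:
  assumes N: "prime N" and m: "m \<in> squarefree_smooth_nats N"
  shows "moebius_mu (N * m) = - moebius_mu m"
proof -
  have Nm: "\<not> N dvd m" using m N by (auto simp: squarefree_smooth_nats_def)
  have sq: "squarefree m" using m by (simp add: squarefree_smooth_nats_def)
  have sq': "squarefree (N * m)" using m squarefree_smooth_nats_Suc_prime(1)[OF N]
    by (auto simp: squarefree_smooth_nats_def)
  have m0: "m \<noteq> 0" using sq not_squarefree_0 by metis
  have "prime_factors (N * m) = insert N (prime_factors m)"
    using N m0 by (subst prime_factors_product) (auto simp: prime_prime_factors)
  moreover have "N \<notin> prime_factors m" using Nm by auto
  ultimately show ?thesis using sq sq' by (simp add: moebius_mu_def)
qed

lemma abs_moebius_mu_le: "\<bar>moebius_mu n\<bar> \<le> 1"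
  by (simp add: moebius_mu_def power_abs)

text \<open>\<open>S N\<close> and \<open>T\<close> can differ only from index \<open>N\<close> on,
  so the two sums differ by at most twice the absolute tail.\<close>

lemma tendsto_infsum_of_agree_below:
  fixes g :: "nat \<Rightarrow> complex"
  assumes g: "(\<lambda>n. norm (g n)) summable_on UNIV" and eq: "\<And>N n. n < N \<Longrightarrow> n \<in> S N \<longleftrightarrow> n \<in> T"
  shows "(\<lambda>N. infsum g (S N)) \<longlonglongrightarrow> infsum g T"
proof -
  define t where "t = (\<lambda>N. infsum (\<lambda>n. norm (g n)) {N..})"
  have gs: "g summable_on A" for A
    using abs_summable_summable[OF g] summable_on_subset_banach by blast
  have ngs: "(\<lambda>n. norm (g n)) summable_on A" for A
    using g summable_on_subset_banach by blast
  have t: "t N = infsum (\<lambda>n. norm (g n)) UNIV - (\<Sum>n<N. norm (g n))" for N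
  proof -
    have "infsum (\<lambda>n. norm (g n)) ({..<N} \<union> {N..}) = infsum (\<lambda>n. norm (g n)) {..<N} + t N"
      unfolding t_def by (intro infsum_Un_disjoint ngs) auto
    also have "{..<N} \<union> {N..} = UNIV" by auto
    finally show ?thesis by simp
  qed
  have "(\<lambda>N. \<Sum>n<N. norm (g n)) \<longlonglongrightarrow> infsum (\<lambda>n. norm (g n)) UNIV"
    using has_sum_imp_sums[OF has_sum_infsum[OF ngs]] by (simp add: sums_def)
  hence "t \<longlonglongrightarrow> infsum (\<lambda>n. norm (g n)) UNIV - infsum (\<lambda>n. norm (g n)) UNIV"
    unfolding t by (intro tendsto_intros)
  hence t0: "(\<lambda>N. 2 * t N) \<longlonglongrightarrow> 0" by (auto intro: tendsto_mult_right_zero)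
  have split: "infsum g A = infsum g (A \<inter> {..<N}) + infsum g (A \<inter> {N..})" for A N
  proof -
    have "infsum g ((A \<inter> {..<N}) \<union> (A \<inter> {N..})) = infsum g (A \<inter> {..<N}) + infsum g (A \<inter> {N..})"
      by (intro infsum_Un_disjoint gs) auto
    also have "(A \<inter> {..<N}) \<union> (A \<inter> {N..}) = A" by auto
    finally show ?thesis .
  qed
  have tail: "norm (infsum g (A \<inter> {N..})) \<le> t N" for A N
  proof -
    have "norm (infsum g (A \<inter> {N..})) \<le> infsum (\<lambda>n. norm (g n)) (A \<inter> {N..})"
      by (rule norm_infsum_bound) (rule ngs)
    also have "\<dots> \<le> t N" unfolding t_def by (intro infsum_mono2 ngs) auto
    finally show ?thesis .
  qed
  have "norm (infsum g (S N) - infsum g T) \<le> 2 * t N" for N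
  proof -
    have "S N \<inter> {..<N} = T \<inter> {..<N}" using eq by auto
    hence "infsum g (S N) - infsum g T = infsum g (S N \<inter> {N..}) - infsum g (T \<inter> {N..})"
      using split[of "S N" N] split[of T N] by simp
    also have "norm \<dots> \<le> t N + t N" by (rule order.trans[OF norm_triangle_ineq4 add_mono[OF tail tail]])
    finally show ?thesis by simp
  qed
  hence "(\<lambda>N. infsum g (S N) - infsum g T) \<longlonglongrightarrow> 0"
    by (intro Lim_null_comparison[OF _ t0]) auto
  thus ?thesis by (simp add: LIM_zero_iff)
qed

section \<open>Euler product and Moebius inversion for a completely multiplicative function\<close>

context
  fixes f :: "nat \<Rightarrow> complex"
  assumes f: "(\<lambda>n. norm (f n)) summable_on UNIV" and f0: "f 0 = 0" and f1: "f 1 = 1"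
    and fmult: "\<And>m n. f (m * n) = f m * f n"
begin

definition euler_factor :: "nat \<Rightarrow> complex" where
  "euler_factor p = (if prime p then 1 - f p else 1)"

lemma mult_summable: "f summable_on A"
  using abs_summable_summable[OF f] summable_on_subset_banach by blast

text \<open>One sieving step: the \<open>N\<close>-rough numbers divisible by a prime
  \<open>N\<close> are \<open>N\<close> times all \<open>N\<close>-rough numbers, so removing them
  multiplies the sum by 1 - f N.\<close>

lemma prod_euler_factor_times_infsum:
  "(\<Prod>p<N. euler_factor p) * infsum f UNIV = infsum f (rough_nats N)"
proof (induction N)
  case 0
  have "infsum f (rough_nats 0) = infsum f UNIV"
    by (rule infsum_cong_neutral) (auto simp: rough_nats_def f0)
  thus ?case by simp
next
  case (Suc N)
  show ?case
  proof (cases "prime N")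
    case True
    note R = rough_nats_Suc_prime[OF True]
    have inj: "inj_on ((*) N) (rough_nats N)" using prime_gt_0_nat[OF True] by (auto intro!: inj_onI)
    have "infsum f (rough_nats N) = infsum f (rough_nats (Suc N) \<union> (*) N ` rough_nats N)"
      using R by (intro arg_cong[where f = "infsum f"]) auto
    also have "\<dots> = infsum f (rough_nats (Suc N)) + infsum f ((*) N ` rough_nats N)"
      using R by (intro infsum_Un_disjoint mult_summable) auto
    also have "infsum f ((*) N ` rough_nats N) = f N * infsum f (rough_nats N)"
      by (subst infsum_reindex[OF inj]) (simp add: o_def fmult infsum_cmult_right')
    finally have "infsum f (rough_nats (Suc N)) = infsum f (rough_nats N) - f N * infsum f (rough_nats N)"
      by (metis add_diff_cancel_right')
    hence "infsum f (rough_nats (Suc N)) = (1 - f N) * infsum f (rough_nats N)"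
      by (simp only: left_diff_distrib mult_1)
    thus ?thesis using Suc True by (simp add: euler_factor_def mult_ac)
  next
    case False
    thus ?thesis using Suc by (simp add: euler_factor_def rough_nats_Suc_not_prime)
  qed
qed

lemma prod_euler_factor_eq_infsum_moebius:
  "(\<Prod>p<N. euler_factor p) = infsum (\<lambda>n. of_int (moebius_mu n) * f n) (squarefree_smooth_nats N)"
proof -
  have msum: "(\<lambda>n. of_int (moebius_mu n) * f n) summable_on A" for A
  proof (rule abs_summable_summable, rule Infinite_Sum.abs_summable_on_comparison_test)
    show "(\<lambda>n. norm (f n)) summable_on A" using f summable_on_subset_banach by blast
    show "norm (of_int (moebius_mu n) * f n) \<le> norm (f n)" for n
      using abs_moebius_mu_le[of n] mult_right_mono[of "real_of_int \<bar>moebius_mu n\<bar>" 1 "norm (f n)"] by (simp add: norm_mult)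
  qed
  show ?thesis
  proof (induction N)
    case 0
    have "squarefree_smooth_nats 0 = {1}"
    proof -
      have "\<exists>p. prime p \<and> p dvd n" if "n \<noteq> 1" for n :: nat
        using prime_factor_nat[OF that] by blast
      thus ?thesis by (auto simp: squarefree_smooth_nats_def)
    qed
    thus ?case by (simp add: moebius_mu_def f1[simplified])
  next
    case (Suc N)
    show ?case
    proof (cases "prime N")
      case True
      note R = squarefree_smooth_nats_Suc_prime[OF True]
      have inj: "inj_on ((*) N) (squarefree_smooth_nats N)" using prime_gt_0_nat[OF True] by (auto intro!: inj_onI)
      have "infsum (\<lambda>n. of_int (moebius_mu n) * f n) (squarefree_smooth_nats (Suc N)) =
        infsum (\<lambda>n. of_int (moebius_mu n) * f n) (squarefree_smooth_nats N) +
        infsum (\<lambda>n. of_int (moebius_mu n) * f n) ((*) N ` squarefree_smooth_nats N)"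
        unfolding R(1) by (intro infsum_Un_disjoint msum R)
      also have "infsum (\<lambda>n. of_int (moebius_mu n) * f n) ((*) N ` squarefree_smooth_nats N) 
         = infsum (\<lambda>n. (- f N) * (of_int (moebius_mu n) * f n)) (squarefree_smooth_nats N)"
        by (subst infsum_reindex[OF inj], rule infsum_cong) (simp add: fmult moebius_mu_prime_mult[OF True])
      also have "\<dots> = (- f N) * infsum (\<lambda>n. of_int (moebius_mu n) * f n) (squarefree_smooth_nats N)"
        by (rule infsum_cmult_right')
      finally show ?thesis using Suc True by (simp add: euler_factor_def algebra_simps)
    next
      case False
      thus ?thesis using Suc by (simp add: euler_factor_def squarefree_smooth_nats_Suc_not_prime)
    qed
  qed
qed

text \<open>Below \<open>N\<close> only 1 is \<open>N\<close>-rough, since a prime divisor of n is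
  at most n; the sieved sums therefore tend to f 1 = 1. A vanishing full sum would make this
  sequence constantly 0, hence the nonvanishing that follows.\<close>

lemma infsum_times_prod_tendsto_1: "(\<lambda>N. (\<Prod>p<N. euler_factor p) * infsum f UNIV) \<longlonglongrightarrow> 1"
proof -
  have "(\<lambda>N. infsum f (rough_nats N)) \<longlonglongrightarrow> infsum f {1}"
  proof (rule tendsto_infsum_of_agree_below[OF f])
    fix N n :: nat assume n: "n < N"
    show "n \<in> rough_nats N \<longleftrightarrow> n \<in> {1}"
    proof
      assume r: "n \<in> rough_nats N"
      show "n \<in> {1}"
      proof (rule ccontr)
        assume "n \<notin> {1}"
        then obtain p where p: "prime p" "p dvd n" using prime_factor_nat[of n] by auto
        hence "p \<le> n" using r by (auto simp: rough_nats_def intro: dvd_imp_le)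
        thus False using p r n by (auto simp: rough_nats_def)
      qed
    qed (auto simp: rough_nats_def)
  qed
  thus ?thesis by (simp add: f1[simplified] prod_euler_factor_times_infsum)
qed

lemma infsum_mult_nonzero: "infsum f UNIV \<noteq> 0"
  using infsum_times_prod_tendsto_1 by (auto simp: LIMSEQ_const_iff)

lemma prod_euler_factor_tendsto: "(\<lambda>N. \<Prod>p<N. euler_factor p) \<longlonglongrightarrow> 1 / infsum f UNIV"
proof -
  have "(\<lambda>N. (\<Prod>p<N. euler_factor p) * infsum f UNIV / infsum f UNIV) \<longlonglongrightarrow> 1 / infsum f UNIV"
    using infsum_mult_nonzero by (intro tendsto_divide infsum_times_prod_tendsto_1) auto
  thus ?thesis using infsum_mult_nonzero by simp
qed

lemma moebius_abs_summable: "(\<lambda>n. norm (of_int (moebius_mu n) * f n)) summable_on UNIV"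
proof (rule Infinite_Sum.abs_summable_on_comparison_test[OF f])
  show "norm (of_int (moebius_mu n) * f n) \<le> norm (f n)" for n
    using abs_moebius_mu_le[of n] mult_right_mono[of "real_of_int \<bar>moebius_mu n\<bar>" 1 "norm (f n)"] by (simp add: norm_mult)
qed

lemma infsum_moebius: "infsum (\<lambda>n. of_int (moebius_mu n) * f n) UNIV = 1 / infsum f UNIV"
proof -
  have "(\<lambda>N. infsum (\<lambda>n. of_int (moebius_mu n) * f n) (squarefree_smooth_nats N)) \<longlonglongrightarrow> infsum (\<lambda>n. of_int (moebius_mu n) * f n) {n. squarefree n}"
  proof (rule tendsto_infsum_of_agree_below[OF moebius_abs_summable])
    fix N n :: nat assume n: "n < N"
    show "n \<in> squarefree_smooth_nats N \<longleftrightarrow> n \<in> {n. squarefree n}"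
    proof (cases "n = 0")
      case False
      hence "p < N" if "p dvd n" for p using n dvd_imp_le[OF that] by linarith
      thus ?thesis by (auto simp: squarefree_smooth_nats_def)
    qed (auto simp: squarefree_smooth_nats_def)
  qed
  also have "infsum (\<lambda>n. of_int (moebius_mu n) * f n) {n. squarefree n} = infsum (\<lambda>n. of_int (moebius_mu n) * f n) UNIV"
    by (rule infsum_cong_neutral) (auto simp: moebius_mu_def)
  finally show ?thesis 
    using prod_euler_factor_tendsto LIMSEQ_unique unfolding prod_euler_factor_eq_infsum_moebius by blast
qed

end

section \<open>The Euler product and the Moebius series of zeta\<close>

definition npow :: "complex \<Rightarrow> nat \<Rightarrow> complex" where
  "npow s n = 1 / of_nat n powr s"

text \<open>The value at 0 is 1 / 0 = 0, so \<open>npow s\<close> is completely multiplicative on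
  all natural numbers and fits the context above.\<close>

lemma npow_0: "npow s 0 = 0" and npow_1: "npow s 1 = 1"
  by (simp_all add: npow_def)

lemma npow_mult: "npow s (m * n) = npow s m * npow s n"
  using powr_times_real[of "of_nat m" "of_nat n" s] by (simp add: npow_def)

lemma norm_npow: "norm (npow s n) = real n powr - Re s"
  by (simp add: npow_def norm_divide norm_powr_real_powr powr_minus_divide)

lemma npow_abs_summable:
  assumes "Re s > 1" shows "(\<lambda>n. norm (npow s n)) summable_on UNIV"
proof -
  have "summable (\<lambda>n. real n powr - Re s)" using assms by (simp add: summable_real_powr_iff)
  thus ?thesis unfolding norm_npow
    by (intro norm_summable_imp_summable_on) auto
qed

lemma infsum_npow:
  assumes "Re s > 1" shows "infsum (npow s) UNIV = zeta s"
proof -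
  have "(\<lambda>n. npow s (Suc n)) sums zeta s" using zeta_sums[OF assms] by (simp add: npow_def)
  hence "npow s sums zeta s" by (subst (asm) sums_Suc_iff) (simp add: npow_0)
  moreover have "npow s sums infsum (npow s) UNIV"
    using abs_summable_summable[OF npow_abs_summable[OF assms]] has_sum_imp_sums has_sum_infsum by blast
  ultimately show ?thesis using sums_unique2 by blast
qed

lemma zeta_nonzero: "Re s > 1 \<Longrightarrow> zeta s \<noteq> 0"
  using infsum_mult_nonzero[OF npow_abs_summable npow_0 npow_1 npow_mult] infsum_npow by simp

lemma zeta_euler_product:
  assumes s: "Re s > 1"
  shows "(\<lambda>N. \<Prod>p<N. if prime p then 1 - npow s p else 1) \<longlonglongrightarrow> 1 / zeta s"
  using prod_euler_factor_tendsto[OF npow_abs_summable[OF s] npow_0 npow_1 npow_mult] 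
  unfolding euler_factor_def[OF npow_abs_summable[OF s] npow_0 npow_1 npow_mult] by (simp add: infsum_npow[OF s])

lemma zeta_moebius_sums:
  assumes s: "Re s > 1"
  shows "(\<lambda>n. of_int (moebius_mu (Suc n)) * npow s (Suc n)) sums (1 / zeta s)"
proof -
  have "(\<lambda>n. of_int (moebius_mu n) * npow s n) sums infsum (\<lambda>n. of_int (moebius_mu n) * npow s n) UNIV"
    using abs_summable_summable[OF moebius_abs_summable[OF npow_abs_summable[OF s] npow_0 npow_1 npow_mult]] has_sum_imp_sums has_sum_infsum by blast
  hence "(\<lambda>n. of_int (moebius_mu n) * npow s n) sums (1 / zeta s)"
    by (simp add: infsum_moebius[OF npow_abs_summable[OF s] npow_0 npow_1 npow_mult] infsum_npow[OF s])
  thus ?thesis by (subst sums_Suc_iff) (simp add: npow_0)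
qed

text \<open>By |mu| <= 1 the series of zeta and of 1 / zeta have the same majorant. To the right of
  Re s = c > 1 this bounds ln |zeta| from both sides by constants.\<close>

lemma norm_zeta_bounds:
  assumes c: "c > 1" and s: "Re s \<ge> c"
  shows "norm (zeta s) \<le> (\<Sum>n. real (Suc n) powr - c)" "norm (1 / zeta s) \<le> (\<Sum>n. real (Suc n) powr - c)"
proof -
  have sm: "summable (\<lambda>n. real (Suc n) powr - c)" using c by (intro summable_Suc_powr) auto
  have b: "norm (npow s (Suc n)) \<le> real (Suc n) powr - c" for n
    using s unfolding norm_npow by (intro powr_mono) auto
  have "(\<lambda>n. npow s (Suc n)) sums zeta s" using zeta_sums[of s] c s by (simp add: npow_def)
  moreover have "norm (\<Sum>n. npow s (Suc n)) \<le> (\<Sum>n. real (Suc n) powr - c)"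
    by (intro norm_suminf_le sm b)
  ultimately show "norm (zeta s) \<le> (\<Sum>n. real (Suc n) powr - c)" by (simp add: sums_iff)
  have "norm (\<Sum>n. of_int (moebius_mu (Suc n)) * npow s (Suc n)) \<le> (\<Sum>n. real (Suc n) powr - c)"
  proof (intro norm_suminf_le sm)
    show "norm (of_int (moebius_mu (Suc n)) * npow s (Suc n)) \<le> real (Suc n) powr - c" for n
      using abs_moebius_mu_le[of "Suc n"] b[of n]
        mult_mono[of "real_of_int \<bar>moebius_mu (Suc n)\<bar>" 1 "norm (npow s (Suc n))" "real (Suc n) powr - c"] by (simp add: norm_mult)
  qed
  thus "norm (1 / zeta s) \<le> (\<Sum>n. real (Suc n) powr - c)"
    using zeta_moebius_sums[of s] s c by (simp add: sums_iff)
qed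

text \<open>This is \<open>3 + 4 * cos t + cos (2 * t) \<ge> 0\<close>, applied termwise to the series of the logarithm.\<close>

lemma mertens_inequality:
  fixes x :: real and w :: complex
  assumes x: "0 \<le> x" "x < 1" and w: "norm w = 1"
  shows "norm (1 - of_real x :: complex) ^ 3 * norm (1 - of_real x * w) ^ 4 * norm (1 - of_real x * w\<^sup>2) \<le> 1"
proof -
  have ln: "(\<lambda>n. - (x ^ n * Re (u ^ n)) / real n) sums ln (norm (1 - of_real x * u))" "1 - of_real x * u \<noteq> 0"
    if "norm u = 1" for u :: complex
  proof -
    have nu: "norm (of_real x * u) < 1" using x that by (simp add: norm_mult)
    show nz: "1 - of_real x * u \<noteq> 0" using nu by auto
    have "(\<lambda>n. - ((- (- (of_real x * u)))^n) / of_nat n) sums Ln (1 + (- (of_real x * u)))"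
      using nu by (intro Ln_series') auto
    hence "(\<lambda>n. Re (- ((of_real x * u)^n) / of_nat n)) sums Re (Ln (1 - of_real x * u))"
      by (intro sums_Re) auto
    also have "Re (Ln (1 - of_real x * u)) = ln (norm (1 - of_real x * u))" using nz by simp
    also have "(\<lambda>n. Re (- ((of_real x * u)^n) / of_nat n)) = (\<lambda>n. - (x ^ n * Re (u ^ n)) / real n)"
    proof
      fix n
      have "- ((of_real x * u)^n) / of_nat n = of_real (- (x ^ n) / real n) * u ^ n"
        by (simp add: power_mult_distrib)
      thus "Re (- ((of_real x * u)^n) / of_nat n) = - (x ^ n * Re (u ^ n)) / real n"
        by (simp only: times_complex.sel Re_complex_of_real Im_complex_of_real) simp
    qed
    finally show "(\<lambda>n. - (x ^ n * Re (u ^ n)) / real n) sums ln (norm (1 - of_real x * u))" .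
  qed
  have w2: "norm (w\<^sup>2) = 1" using w by (simp add: norm_power)
  have S: "(\<lambda>n. 3 * (- (x ^ n * Re (1 ^ n)) / real n) + 4 * (- (x ^ n * Re (w ^ n)) / real n) + - (x ^ n * Re ((w\<^sup>2) ^ n)) / real n) sums
     (3 * ln (norm (1 - of_real x * 1 :: complex)) + 4 * ln (norm (1 - of_real x * w)) + ln (norm (1 - of_real x * w\<^sup>2)))"
    by (intro sums_add sums_mult ln) (use w w2 in auto)
  have L: "3 * (- (x ^ n * Re (1 ^ n)) / real n) + 4 * (- (x ^ n * Re (w ^ n)) / real n) + - (x ^ n * Re ((w\<^sup>2) ^ n)) / real n \<le> 0" for n
  proof -
    define v where "v = w ^ n"
    have v: "(Re v)\<^sup>2 + (Im v)\<^sup>2 = 1" using w by (simp add: v_def norm_power flip: cmod_power2)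
    have "(w\<^sup>2) ^ n = v\<^sup>2" by (simp add: v_def mult.commute flip: power_mult)
    hence "3 * (- (x ^ n * Re (1 ^ n)) / real n) + 4 * (- (x ^ n * Re (w ^ n)) / real n) + - (x ^ n * Re ((w\<^sup>2) ^ n)) / real n
      = - (x ^ n / real n * (3 + 4 * Re v + ((Re v)\<^sup>2 - (Im v)\<^sup>2)))"
      by (simp add: v_def[symmetric] Re_power2 algebra_simps add_divide_distrib diff_divide_distrib)
    also have "3 + 4 * Re v + ((Re v)\<^sup>2 - (Im v)\<^sup>2) = 2 * (1 + Re v)\<^sup>2"
      using v by (simp add: power2_eq_square algebra_simps)
    finally show ?thesis using x by simp
  qed
  have le: "3 * ln (norm (1 - of_real x * 1 :: complex)) + 4 * ln (norm (1 - of_real x * w)) + ln (norm (1 - of_real x * w\<^sup>2)) \<le> 0"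
    by (rule sums_le[OF L S sums_zero])
  have nz: "norm (1 - of_real x :: complex) > 0" "norm (1 - of_real x * w) > 0" "norm (1 - of_real x * w\<^sup>2) > 0"
    using ln(2)[of 1] ln(2)[of w] ln(2)[of "w\<^sup>2"] w w2 by auto
  have "ln (norm (1 - of_real x :: complex) ^ 3 * norm (1 - of_real x * w) ^ 4 * norm (1 - of_real x * w\<^sup>2)) \<le> 0"
    using le nz by (simp add: ln_mult ln_realpow)
  thus ?thesis using nz by (subst (asm) ln_le_zero_iff) auto
qed

text \<open>The inequality for a single Euler factor, with x = p^(-\<sigma>) and w = p^(-it), is
  multiplied over p < N. The finite products approximate 1 / zeta, so in the limit the bound <= 1
  turns into >= 1 for zeta.\<close>

lemma zeta_mertens:
  assumes \<sigma>: "\<sigma> > 1"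
  shows "norm (zeta (of_real \<sigma>)) ^ 3 * norm (zeta (Complex \<sigma> t)) ^ 4 * norm (zeta (Complex \<sigma> (2 * t))) \<ge> 1"
proof -
  define E where "E = (\<lambda>s N. \<Prod>p<N. if prime p then 1 - npow s p else 1)"
  have lim: "(\<lambda>N. norm (E s N)) \<longlonglongrightarrow> norm (1 / zeta s)" if "Re s > 1" for s
    unfolding E_def using zeta_euler_product[OF that] by (intro tendsto_norm)
  have "(\<lambda>N. norm (E (of_real \<sigma>) N) ^ 3 * norm (E (Complex \<sigma> t) N) ^ 4 * norm (E (Complex \<sigma> (2 * t)) N)) \<longlonglongrightarrow>
     norm (1 / zeta (of_real \<sigma>)) ^ 3 * norm (1 / zeta (Complex \<sigma> t)) ^ 4 * norm (1 / zeta (Complex \<sigma> (2 * t)))"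
    using \<sigma> by (intro tendsto_intros lim) auto
  moreover have "norm (E (of_real \<sigma>) N) ^ 3 * norm (E (Complex \<sigma> t) N) ^ 4 * norm (E (Complex \<sigma> (2 * t)) N) \<le> 1" for N
  proof -
    have "norm (E (of_real \<sigma>) N) ^ 3 * norm (E (Complex \<sigma> t) N) ^ 4 * norm (E (Complex \<sigma> (2 * t)) N) =
      (\<Prod>p<N. norm (if prime p then 1 - npow (of_real \<sigma>) p else 1) ^ 3 * norm (if prime p then 1 - npow (Complex \<sigma> t) p else 1) ^ 4 *
          norm (if prime p then 1 - npow (Complex \<sigma> (2 * t)) p else 1))"
      by (simp add: E_def prod.distrib flip: prod_power_distrib prod_norm)
    also have "\<dots> \<le> 1"
    proof (rule prod_le_1, safe)
      fix p :: nat
      define x where "x = real p powr - \<sigma>"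
      define w where "w = npow (\<i> * of_real t) p"
      show "norm (if prime p then 1 - npow (of_real \<sigma>) p else 1) ^ 3 * norm (if prime p then 1 - npow (Complex \<sigma> t) p else 1) ^ 4 *
          norm (if prime p then 1 - npow (Complex \<sigma> (2 * t)) p else 1) \<le> 1"
      proof (cases "prime p")
        case True
        hence p: "p > 1" by (rule prime_gt_1_nat)
        have x: "npow (of_real \<sigma>) p = of_real x"
          using of_nat_powr_of_real[of p \<sigma>] by (simp add: npow_def x_def powr_minus_divide)
        have "norm w = 1" using p by (simp add: w_def norm_npow)
        moreover have "npow (Complex \<sigma> t) p = of_real x * w" "npow (Complex \<sigma> (2 * t)) p = of_real x * w\<^sup>2"
        proof -
          have add: "npow (a + b) p = npow a p * npow b p" for a b
            using p by (simp add: npow_def powr_add)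
          have "Complex \<sigma> t = of_real \<sigma> + \<i> * of_real t" "Complex \<sigma> (2 * t) = of_real \<sigma> + (\<i> * of_real t + \<i> * of_real t)"
            by (simp_all add: complex_eq_iff)
          thus "npow (Complex \<sigma> t) p = of_real x * w" "npow (Complex \<sigma> (2 * t)) p = of_real x * w\<^sup>2"
            by (simp_all only: add x w_def power2_eq_square)
        qed
        moreover have "0 \<le> x" "x < 1" using p \<sigma> powr_less_mono[of "-\<sigma>" 0 "real p"] by (auto simp: x_def)
        ultimately show ?thesis using mertens_inequality[of x w] True x by simp
      qed auto
    qed auto
    finally show ?thesis .
  qed
  ultimately have "norm (1 / zeta (of_real \<sigma>)) ^ 3 * norm (1 / zeta (Complex \<sigma> t)) ^ 4 * norm (1 / zeta (Complex \<sigma> (2 * t))) \<le> 1"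
    by (intro LIMSEQ_le_const2) auto
  moreover have "zeta (of_real \<sigma>) \<noteq> 0" "zeta (Complex \<sigma> t) \<noteq> 0" "zeta (Complex \<sigma> (2 * t)) \<noteq> 0"
    using \<sigma> by (auto intro!: zeta_nonzero)
  ultimately show ?thesis
    by (simp add: norm_divide power_divide field_simps)
qed

text \<open>A zero at 1 + i t would enter \<open>zeta_mertens\<close> with exponent 4 against the
  simple pole at 1 with exponent 3, so the product would tend to 0 as the real part decreases to 1.
  The point 1 + 2 i t only contributes a bounded factor.\<close>

lemma zeta_P_nonzero_1_line:
  assumes s: "Re s = 1" shows "zeta_P s \<noteq> 0"
proof
  assume 0: "zeta_P s = 0"
  define t where "t = Im s"
  have s_eq: "s = Complex 1 t" using s by (simp add: complex_eq_iff t_def)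
  have t: "t \<noteq> 0" using 0 zeta_P_1 by (auto simp: s_eq complex_eq_iff Complex_eq)
  have cont: "isCont zeta_P z" if "Re z > -1" for z
    using holomorphic_on_imp_continuous_on[OF holomorphic_zeta_P] that
    by (auto simp: continuous_on_eq_continuous_at open_halfspace_Re_gt)
  have lim0: "((\<lambda>h. zeta_P (Complex (1 + h) u)) \<longlongrightarrow> zeta_P (Complex 1 u)) (at_right 0)" for u
  proof (rule isCont_tendsto_compose[OF cont])
    have "((\<lambda>h. Complex (1 + h) u) \<longlongrightarrow> Complex (1 + 0) u) (at_right 0)"
      by (intro tendsto_intros)
    thus "((\<lambda>h. Complex (1 + h) u) \<longlongrightarrow> Complex 1 u) (at_right 0)" by simp
  qed auto
  have "(zeta_P has_field_derivative deriv zeta_P s) (at s)"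
    using holomorphic_derivI[OF holomorphic_zeta_P open_halfspace_Re_gt, of s] s by simp
  hence "((\<lambda>z. (zeta_P z - zeta_P s) / (z - s)) \<longlongrightarrow> deriv zeta_P s) (at s)"
    by (simp add: has_field_derivative_iff)
  moreover have "filterlim (\<lambda>h. s + of_real h) (at s) (at_right 0)"
    by (intro filterlim_atI tendsto_eq_intros) (auto simp: eventually_at_filter)
  ultimately have *: "((\<lambda>h. (zeta_P (s + of_real h) - zeta_P s) / (s + of_real h - s)) \<longlongrightarrow> deriv zeta_P s) (at_right 0)"
    by (rule filterlim_compose)
  hence lim1: "((\<lambda>h. zeta_P (Complex (1 + h) t) / of_real h) \<longlongrightarrow> deriv zeta_P s) (at_right 0)"
  proof -
    have "s + of_real h = Complex (1 + h) t" "Complex (1 + h) t - s = of_real h" for h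
      by (simp_all add: s_eq complex_eq_iff)
    with * 0 show ?thesis by simp
  qed
  have limC: "((\<lambda>h. Complex h u) \<longlongrightarrow> Complex 0 u) (at_right 0)" for u by (intro tendsto_intros)
  \<comment> \<open>This is the product in \<open>zeta_mertens\<close> at 1 + h, written with
    \<open>zeta_P\<close>: the zero gives h^4, the pole takes away h^3, and the factor h that
    remains forces the limit 0.\<close>
  have "((\<lambda>h. norm (zeta_P (Complex (1 + h) 0)) ^ 3 * norm (zeta_P (Complex (1 + h) t) / of_real h) ^ 4 * norm (zeta_P (Complex (1 + h) (2 * t))) 
       * h / (norm (Complex h t) ^ 4 * norm (Complex h (2 * t)))) \<longlongrightarrow> 
      norm (zeta_P (Complex 1 0)) ^ 3 * norm (deriv zeta_P s) ^ 4 * norm (zeta_P (Complex 1 (2 * t))) 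
       * 0 / (norm (Complex 0 t) ^ 4 * norm (Complex 0 (2 * t)))) (at_right 0)"
    using t by (intro tendsto_intros lim0 lim1 limC) (auto simp: complex_eq_iff)
  hence "eventually (\<lambda>h. norm (zeta_P (Complex (1 + h) 0)) ^ 3 * norm (zeta_P (Complex (1 + h) t) / of_real h) ^ 4 * norm (zeta_P (Complex (1 + h) (2 * t))) 
       * h / (norm (Complex h t) ^ 4 * norm (Complex h (2 * t))) < 1) (at_right 0)"
    by (intro order_tendstoD(2)[where y = 0]) auto
  moreover have "eventually (\<lambda>h. h > (0::real)) (at_right 0)" by (simp add: eventually_at_right_less)
  ultimately have "eventually (\<lambda>h. False) (at_right (0::real))"
  proof eventually_elim
    case (elim h)
    have "zeta (of_real (1 + h)) = zeta_P (Complex (1 + h) 0) / Complex h 0"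
      using elim by (subst zeta_eq_P) (auto simp: Complex_eq)
    moreover have "zeta (Complex (1 + h) t) = zeta_P (Complex (1 + h) t) / Complex h t"
      using elim by (subst zeta_eq_P) (auto simp: Complex_eq)
    moreover have "zeta (Complex (1 + h) (2 * t)) = zeta_P (Complex (1 + h) (2 * t)) / Complex h (2 * t)"
      using elim by (subst zeta_eq_P) (auto simp: Complex_eq)
    moreover have "norm (Complex h 0) = h" using elim by (simp add: cmod_eq_Re)
    ultimately have "1 \<le> (norm (zeta_P (Complex (1 + h) 0)) / h) ^ 3 * (norm (zeta_P (Complex (1 + h) t)) / norm (Complex h t)) ^ 4 
       * (norm (zeta_P (Complex (1 + h) (2 * t))) / norm (Complex h (2 * t)))"
      using zeta_mertens[of "1 + h" t] elim by (simp add: norm_divide)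
    also have "\<dots> = norm (zeta_P (Complex (1 + h) 0)) ^ 3 * norm (zeta_P (Complex (1 + h) t) / of_real h) ^ 4 * norm (zeta_P (Complex (1 + h) (2 * t))) 
       * h / (norm (Complex h t) ^ 4 * norm (Complex h (2 * t)))"
      using elim by (simp add: norm_divide power_divide power4_eq_xxxx power3_eq_cube)
    finally show False using elim by linarith
  qed
  thus False by simp
qed

section \<open>Jensen's inequality on the unit disc\<close>

text \<open>The angle is chosen so that the Cayley map sends \<open>circ 1 \<theta>\<close> to \<open>\<i> * tan \<theta>\<close>.\<close>

definition circ :: "real \<Rightarrow> real \<Rightarrow> complex" where
  "circ r \<theta> = - (of_real r * cis (- 2 * \<theta>))"

lemma norm_circ [simp]: "norm (circ r \<theta>) = \<bar>r\<bar>"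
  by (simp add: circ_def norm_mult)

lemma continuous_on_circ [continuous_intros]: "continuous_on A (circ r)"
  unfolding circ_def by (intro continuous_intros)

lemma holomorphic_mean_value:
  assumes h: "h holomorphic_on cball 0 r" and r: "r > 0"
  shows "((\<lambda>\<theta>. h (circ r \<theta>)) has_integral (of_real pi * h 0)) {-pi/2..pi/2}"
proof -
  have "((\<lambda>u. h u / (u - 0)) has_contour_integral 2 * of_real pi * \<i> * h 0) (circlepath 0 r)"
    by (rule Cauchy_integral_circlepath_simple) (use h r in auto)
  hence "((\<lambda>x. h (circlepath 0 r x) / circlepath 0 r x * vector_derivative (circlepath 0 r) (at x within {0..1}))
     has_integral 2 * of_real pi * \<i> * h 0) {0..1}"
    by (simp add: has_contour_integral_def)
  hence "((\<lambda>x. 2 * of_real pi * \<i> * h (circlepath 0 r x)) has_integral 2 * of_real pi * \<i> * h 0) {0..1}"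
  proof (rule has_integral_eq[rotated])
    fix x :: real assume "x \<in> {0..1}"
    hence v: "vector_derivative (circlepath 0 r) (at x within {0..1}) = 2 * pi * \<i> * r * exp (2 * of_real pi * \<i> * x)"
      by (intro vector_derivative_circlepath01) auto
    show "h (circlepath 0 r x) / circlepath 0 r x * vector_derivative (circlepath 0 r) (at x within {0..1}) = 2 * of_real pi * \<i> * h (circlepath 0 r x)"
      unfolding v using r by (simp add: circlepath)
  qed
  hence "((\<lambda>x. h (circlepath 0 r x)) has_integral h 0) {0..1}"
    by (subst (asm) has_integral_mult_right_iff) auto
  hence "((\<lambda>x. h (circlepath 0 r x)) has_integral h 0) (cbox 0 1)" by simp
  \<comment> \<open>The substitution x = 1/2 - \<theta> / pi turns exp(2 pi i x) into - exp(- 2 i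
    \<theta>), which is the parametrisation \<open>circ\<close>.\<close>
  from has_integral_affinity[OF this, of "-1/pi" "1/2"]
  have "((\<lambda>x. h (circlepath 0 r (-1/pi * x + 1/2))) has_integral (pi *\<^sub>R h 0)) ((\<lambda>x. - pi * x + pi / 2) ` {0..1})"
    by (simp add: mult.commute)
  also have "(\<lambda>x. - pi * x + pi / 2) ` {0..1} = {-pi/2..pi/2}"
  proof -
    have "\<not> 0 \<le> - pi" using pi_gt_zero by linarith
    thus ?thesis unfolding image_affinity_atLeastAtMost by (simp add: field_simps)
  qed
  also have "(\<lambda>x. h (circlepath 0 r (-1/pi * x + 1/2))) = (\<lambda>\<theta>. h (circ r \<theta>))"
  proof
    fix \<theta> :: real
    have "2 * of_real pi * \<i> * of_real (-1/pi * \<theta> + 1/2) = \<i> * of_real (- 2 * \<theta>) + of_real pi * \<i>"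
      by (simp add: field_simps complex_eq_iff)
    hence "exp (2 * of_real pi * \<i> * of_real (-1/pi * \<theta> + 1/2)) = cis (- 2 * \<theta>) * exp (of_real pi * \<i>)"
      by (simp only: exp_add cis_conv_exp)
    hence "circlepath 0 r (-1/pi * \<theta> + 1/2) = circ r \<theta>"
      unfolding circlepath circ_def by (simp only:) simp
    thus "h (circlepath 0 r (-1/pi * \<theta> + 1/2)) = h (circ r \<theta>)" by simp
  qed
  finally show ?thesis by (simp add: scaleR_conv_of_real)
qed

lemma ln_norm_mean_value:
  assumes g: "g holomorphic_on ball 0 R" "\<And>z. z \<in> ball 0 R \<Longrightarrow> g z \<noteq> 0" and r: "0 < r" "r < R"
  shows "((\<lambda>\<theta>. ln (norm (g (circ r \<theta>)))) has_integral (pi * ln (norm (g 0)))) {-pi/2..pi/2}"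
proof -
  have "0 \<in> ball (0::complex) R" using r by auto
  with g obtain h where h: "h holomorphic_on ball 0 R" "\<And>x. x \<in> ball 0 R \<Longrightarrow> exp (h x) = g x"
    using holomorphic_logarithm_exists[OF convex_ball open_ball, of g 0 R 0] by metis
  have ln: "ln (norm (g x)) = Re (h x)" if "x \<in> ball 0 R" for x
    using h(2)[OF that] by (metis ln_exp norm_exp_eq_Re)
  have "((\<lambda>\<theta>. h (circ r \<theta>)) has_integral (of_real pi * h 0)) {-pi/2..pi/2}"
    using r by (intro holomorphic_mean_value holomorphic_on_subset[OF h(1)]) auto
  hence "((\<lambda>\<theta>. Re (h (circ r \<theta>))) has_integral Re (of_real pi * h 0)) {-pi/2..pi/2}"
    by (rule has_integral_Re)
  thus ?thesis using r by (simp add: ln)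
qed

text \<open>The quotient of \<open>f\<close> by the power is holomorphic away from \<open>a\<close>,
  and near \<open>a\<close> it is the nonvanishing local factor \<open>zor_poly\<close>; the two
  pieces glue. The order \<open>n\<close> may be 0.\<close>

lemma holomorphic_factor_out_zero:
  assumes f: "f holomorphic_on S" and S: "open S" "connected S" and a: "a \<in> S" and nz: "\<exists>w\<in>S. f w \<noteq> 0"
  obtains n h where "h holomorphic_on S" "h a \<noteq> 0" "\<And>w. w \<in> S \<Longrightarrow> f w = h w * (w - a) ^ n"
proof -
  define n where "n = nat (zorder f a)"
  obtain r where r: "r > 0" "cball a r \<subseteq> S" "zor_poly f a holomorphic_on cball a r"
    "\<And>w. w \<in> cball a r \<Longrightarrow> f w = zor_poly f a w * (w - a) ^ n \<and> zor_poly f a w \<noteq> 0"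
    using zorder_exist_zero[OF f S a nz] unfolding n_def by blast
  define h where "h = (\<lambda>w. if w = a then zor_poly f a a else f w / (w - a) ^ n)"
  have "h holomorphic_on (S - {a}) \<union> ball a r"
  proof (rule holomorphic_on_Un)
    have "(\<lambda>w. f w / (w - a) ^ n) holomorphic_on (S - {a})"
      by (intro holomorphic_intros holomorphic_on_subset[OF f]) auto
    thus "h holomorphic_on S - {a}" by (rule holomorphic_transform) (auto simp: h_def)
    have "zor_poly f a holomorphic_on ball a r" by (rule holomorphic_on_subset[OF r(3)]) auto
    thus "h holomorphic_on ball a r" 
      by (rule holomorphic_transform) (use r(4) in \<open>auto simp: h_def\<close>)
  qed (use S in auto)
  also have "(S - {a}) \<union> ball a r = S" using r(1,2) a by auto
  finally have "h holomorphic_on S" .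
  moreover have "h a \<noteq> 0" using r(1) r(4)[of a] by (auto simp: h_def)
  moreover have "f w = h w * (w - a) ^ n" if "w \<in> S" for w
    using r(1) r(4)[of a] by (auto simp: h_def)
  ultimately show ?thesis using that by blast
qed

lemma finite_zeros_cball:
  assumes g: "g holomorphic_on ball 0 R" and r: "r < R" and g0: "g 0 \<noteq> 0"
  shows "finite {z \<in> cball 0 r. g z = 0}"
proof (cases "g constant_on ball 0 R")
  case True
  then obtain c where c: "\<And>z. z \<in> ball 0 R \<Longrightarrow> g z = c" unfolding constant_on_def by blast
  have "g z \<noteq> 0" if "z \<in> cball 0 r" for z
    using c[of z] c[of 0] g0 that r by auto (metis le_less_trans norm_ge_zero)
  hence "{z \<in> cball 0 r. g z = 0} = {}" by blast
  thus ?thesis by (simp only: finite.emptyI)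
next
  case False
  thus ?thesis using g r by (intro holomorphic_compact_finite_zeros[where S = "ball 0 R"]) auto
qed

text \<open>The zeros inside the circle are removed one at a time by multiplying with a power of the
  inverse Blaschke factor, which has modulus 1 on the circle and modulus at least 1 at the origin.\<close>

lemma ln_norm_sub_mean_value:
  assumes g: "g holomorphic_on ball 0 R" and r: "0 < r" "r < R" and g0: "g 0 \<noteq> 0"
    and circ_nz: "\<And>z. norm z = r \<Longrightarrow> g z \<noteq> 0"
  shows "pi * ln (norm (g 0)) \<le> integral {-pi/2..pi/2} (\<lambda>\<theta>. ln (norm (g (circ r \<theta>))))"
  using g g0 circ_nz
proof (induction "card {z \<in> cball 0 r. g z = 0}" arbitrary: g)
  case 0
  have fin: "finite {z \<in> cball 0 r. g z = 0}"
    using finite_zeros_cball[OF 0(2) r(2) 0(3)] .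
  hence nz: "g z \<noteq> 0" if "z \<in> cball 0 r" for z using 0(1) that by auto
  \<comment> \<open>The mean value formula wants a zero-free open disc that contains the circle. By
    compactness the zero-free closed disc has a slightly larger one around it; \<open>w\<close>
    below is the radial projection to the circle.\<close>
  have "\<exists>R'. r < R' \<and> R' \<le> R \<and> (\<forall>z\<in>ball 0 R'. g z \<noteq> 0)"
  proof -
    define U where "U = {z \<in> ball 0 R. g z \<noteq> 0}"
    have "open U" unfolding U_def 
      using continuous_open_preimage[OF holomorphic_on_imp_continuous_on[OF 0(2)] open_ball, of "-{0}"]
      by (simp add: vimage_def Int_def open_Compl)
    moreover have "cball 0 r \<subseteq> U" using nz r by (auto simp: U_def)
    ultimately obtain e where e: "e > 0" "(\<Union>x\<in>cball 0 r. ball x e) \<subseteq> U"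
      using compact_subset_open_imp_ball_epsilon_subset[OF compact_cball] by blast
    have "g z \<noteq> 0" if "z \<in> ball 0 (min R (r + e))" for z
    proof (cases "norm z \<le> r")
      case False
      define w where "w = of_real (r / norm z) * z"
      have z0: "norm z > 0" using False r by linarith
      have "norm w = r" unfolding w_def norm_mult norm_of_real using False r by auto
      have "z - w = of_real (1 - r / norm z) * z" by (simp add: w_def algebra_simps)
      hence "norm (z - w) = \<bar>1 - r / norm z\<bar> * norm z" by (simp only: norm_mult norm_of_real)
      moreover have "r / norm z \<le> 1" using False r z0 by simp
      ultimately have "norm (z - w) = (1 - r / norm z) * norm z" by simp
      hence "norm (z - w) = norm z - r" using z0 by (simp add: left_diff_distrib)
      hence "z \<in> (\<Union>x\<in>cball 0 r. ball x e)" 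
        using that \<open>norm w = r\<close> by (auto simp: dist_norm norm_minus_commute intro!: bexI[of _ w])
      hence "z \<in> U" using e(2) by blast
      thus ?thesis by (simp add: U_def)
    qed (use nz in auto)
    thus ?thesis using e r by (intro exI[of _ "min R (r + e)"]) auto
  qed
  then obtain R' where R': "r < R'" "R' \<le> R" "\<And>z. z \<in> ball 0 R' \<Longrightarrow> g z \<noteq> 0" by blast
  have "((\<lambda>\<theta>. ln (norm (g (circ r \<theta>)))) has_integral (pi * ln (norm (g 0)))) {-pi/2..pi/2}"
    by (rule ln_norm_mean_value[of _ R']) (use R' r holomorphic_on_subset[OF 0(2) subset_ball[OF R'(2)]] in auto)
  thus ?case by (simp add: integral_unique)
next
  case (Suc k)
  define Z where "Z = {z \<in> cball 0 r. g z = 0}"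
  have fin: "finite Z" using Suc(2) unfolding Z_def by (metis card.infinite nat.distinct(1))
  have "Z \<noteq> {}" using Suc(2) unfolding Z_def by (metis card.empty nat.distinct(1))
  then obtain a where a: "a \<in> Z" by blast
  have a': "norm a < r" "a \<noteq> 0" "g a = 0" "a \<in> ball 0 R" 
    using a Suc.prems r by (auto simp: Z_def le_less)
  obtain n h where h: "h holomorphic_on ball 0 R" "h a \<noteq> 0" "\<And>w. w \<in> ball 0 R \<Longrightarrow> g w = h w * (w - a) ^ n"
    using holomorphic_factor_out_zero[OF Suc(3) open_ball connected_ball a'(4)] Suc.prems r by (metis centre_in_ball order.strict_trans)
  \<comment> \<open>\<open>B z / (z - a)\<close> is the inverse Blaschke factor for the circle of
    radius \<open>r\<close>. Putting \<open>B z\<close> in place of z - a in all \<open>n\<close>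
    factors at once removes exactly the point \<open>a\<close> from the zero set.\<close>
  define B where "B = (\<lambda>z. (of_real (r\<^sup>2) - cnj a * z) / of_real r)"
  define g1 where "g1 = (\<lambda>z. h z * B z ^ n)"
  have Bnz: "B z \<noteq> 0" if "norm z \<le> r" for z
  proof
    assume "B z = 0"
    hence "cnj a * z = of_real (r\<^sup>2)" using r by (auto simp: B_def)
    hence "norm a * norm z = r\<^sup>2" by (metis norm_mult complex_mod_cnj norm_of_real abs_power2)
    moreover have "norm a * norm z < r * r"
      using mult_left_mono[OF that norm_ge_zero[of a]] mult_strict_right_mono[OF a'(1) r(1)] by linarith
    ultimately show False by (simp add: power2_eq_square)
  qed
  have Bcirc: "norm (B z) = norm (z - a)" if "norm z = r" for z
  proof -
    have "of_real (r\<^sup>2) = z * cnj z" using complex_norm_square[of z] unfolding that .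
    hence "B z = z * cnj (z - a) / of_real r" by (simp add: B_def algebra_simps)
    also have "norm \<dots> = norm (z - a)" using that r by (simp add: norm_mult norm_divide del: complex_cnj_diff)
    finally show ?thesis .
  qed
  have "{z \<in> cball 0 r. g1 z = 0} = Z - {a}"
    using h a' r Bnz by (auto simp: g1_def Z_def)
  hence "card {z \<in> cball 0 r. g1 z = 0} = k" using Suc(2) a fin by (simp add: Z_def)
  moreover have "g1 holomorphic_on ball 0 R"
    unfolding g1_def B_def by (intro holomorphic_intros h) (use r in auto)
  moreover have ng1: "norm (g1 z) = norm (g z)" if "norm z = r" for z
    using h(3)[of z] that r Bcirc[OF that] by (simp add: g1_def norm_mult norm_power)
  have h0: "g 0 = h 0 * (- a) ^ n" using h(3)[of 0] r by simp
  moreover have "h 0 \<noteq> 0" using h0 Suc.prems by auto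
  hence "g1 0 \<noteq> 0" using Bnz[of 0] r by (simp add: g1_def)
  moreover have "g1 z \<noteq> 0" if "norm z = r" for z using ng1[OF that] Suc.prems(3)[OF that] by auto
  ultimately have IH: "pi * ln (norm (g1 0)) \<le> integral {-pi/2..pi/2} (\<lambda>\<theta>. ln (norm (g1 (circ r \<theta>))))"
    by (intro Suc(1)) auto
  \<comment> \<open>At the origin |B| is r while |z - a| is |a| < r, so the value there can only
    grow.\<close>
  have "norm (g 0) \<le> norm (g1 0)"
  proof -
    have "B 0 = of_real r" using r by (simp add: B_def power2_eq_square)
    hence "norm (g1 0) = norm (h 0) * r ^ n" using r by (simp add: g1_def norm_mult norm_power)
    moreover have "norm (g 0) = norm (h 0) * norm a ^ n" by (simp add: h0 norm_mult norm_power)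
    ultimately show ?thesis using a' by (simp add: mult_left_mono power_mono)
  qed
  hence "pi * ln (norm (g 0)) \<le> pi * ln (norm (g1 0))"
    using Suc.prems(2) \<open>g1 0 \<noteq> 0\<close> by (intro mult_left_mono iffD2[OF ln_le_cancel_iff]) auto
  also note IH
  also have "(\<lambda>\<theta>. ln (norm (g1 (circ r \<theta>)))) = (\<lambda>\<theta>. ln (norm (g (circ r \<theta>))))"
    using r by (simp add: ng1)
  finally show ?case .
qed

text \<open>Jensen's inequality on the whole disc. Only an upper bound is needed: Fatou's lemma
  also yields the integrability of the boundary function.\<close>

lemma ln_norm_boundary_integral:
  fixes g :: "complex \<Rightarrow> complex" and u M :: "real \<Rightarrow> real"
  assumes g: "g holomorphic_on ball 0 1" and g0: "g 0 \<noteq> 0"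
    and M: "set_integrable lborel {-pi/2..pi/2} M"
    and r0: "0 < r0" "r0 < 1"
    and bound: "\<And>r \<theta>. r0 \<le> r \<Longrightarrow> r < 1 \<Longrightarrow> \<theta> \<in> {-pi/2<..<pi/2} \<Longrightarrow> g (circ r \<theta>) \<noteq> 0 \<Longrightarrow> ln (norm (g (circ r \<theta>))) \<le> M \<theta>"
    and u[measurable]: "u \<in> borel_measurable borel"
    and lim: "AE \<theta> in lborel. \<theta> \<in> {-pi/2<..<pi/2} \<longrightarrow> ((\<lambda>r. ln (norm (g (circ r \<theta>)))) \<longlongrightarrow> u \<theta>) (at_left 1)"
  shows "set_integrable lborel {-pi/2..pi/2} u"
    and "pi * ln (norm (g 0)) \<le> (LINT \<theta>:{-pi/2..pi/2}|lborel. u \<theta>)"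
proof -
  define I where "I = {-pi/2..pi/2::real}"
  have [measurable]: "I \<in> sets borel" by (simp add: I_def)
  define iM where "iM = (\<lambda>\<theta>. indicator I \<theta> * M \<theta>)"
  have iM: "integrable lborel iM" using M by (simp add: set_integrable_def iM_def I_def)
  hence [measurable]: "iM \<in> borel_measurable borel" by auto
  have "{z \<in> ball 0 1. g z = 0} = (\<Union>n. {z \<in> cball 0 (1 - 1 / real (Suc n)). g z = 0})"
  proof (intro equalityI subsetI)
    fix z assume z: "z \<in> {z \<in> ball 0 1. g z = 0}"
    then obtain n where "1 / real (Suc n) < 1 - norm z"
      using reals_Archimedean[of "1 - norm z"] by (auto simp: inverse_eq_divide)
    thus "z \<in> (\<Union>n. {z \<in> cball 0 (1 - 1 / real (Suc n)). g z = 0})" using z by (auto intro!: exI[of _ n])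
  next
    fix z assume "z \<in> (\<Union>n. {z \<in> cball 0 (1 - 1 / real (Suc n)). g z = 0})"
    then obtain n where "norm z \<le> 1 - 1 / real (Suc n)" "g z = 0" by auto
    moreover have "1 / real (Suc n) > 0" by simp
    ultimately have "norm z < 1" "g z = 0" by linarith+
    thus "z \<in> {z \<in> ball 0 1. g z = 0}" by simp
  qed
  moreover have "countable \<dots>"
    by (intro countable_UN[OF countableI_type] countable_finite finite_zeros_cball[OF g _ g0]) auto
  ultimately have "countable {z \<in> ball 0 1. g z = 0}" by simp
  hence cn: "countable (norm ` {z \<in> ball 0 1. g z = 0})" by simp
  \<comment> \<open>The zeros are countable, so radii tending to 1 can be chosen that avoid all
    their moduli; the sub-mean inequality needs circles without zeros.\<close>
  have "\<exists>r. max r0 (1 - 1 / real (Suc n)) < r \<and> r < 1 \<and> r \<notin> norm ` {z \<in> ball 0 1. g z = 0}" for n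
  proof -
    have "max r0 (1 - 1 / real (Suc n)) < 1" using r0 by simp
    from real_interval_avoid_countable_set[OF this cn] show ?thesis by (metis greaterThanLessThan_iff)
  qed
  then obtain \<rho> where \<rho>: "\<And>n. max r0 (1 - 1 / real (Suc n)) < \<rho> n" "\<And>n. \<rho> n < 1" 
    "\<And>n. \<rho> n \<notin> norm ` {z \<in> ball 0 1. g z = 0}" by metis
  have \<rho>pos: "\<rho> n > 0" "\<rho> n \<ge> r0" for n using \<rho>(1)[of n] r0 by simp_all
  have "\<rho> \<longlonglongrightarrow> 1"
  proof (rule tendsto_sandwich[of "\<lambda>n. 1 - 1 / real (Suc n)" _ _ "\<lambda>_. 1"])
    show "(\<lambda>n. 1 - 1 / real (Suc n)) \<longlonglongrightarrow> 1" by real_asymp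
    show "\<forall>\<^sub>F n in sequentially. 1 - 1 / real (Suc n) \<le> \<rho> n" using \<rho>(1) by (intro always_eventually) (auto intro: less_imp_le)
    show "\<forall>\<^sub>F n in sequentially. \<rho> n \<le> 1" using \<rho>(2) by (intro always_eventually) (auto intro: less_imp_le)
  qed auto
  hence \<rho>lim: "filterlim \<rho> (at_left 1) sequentially"
    using \<rho>(2) by (intro tendsto_imp_filterlim_at_left) auto
  have nz: "g z \<noteq> 0" if "norm z = \<rho> n" for z n using \<rho>(2,3)[of n] that by force
  define v where "v = (\<lambda>n \<theta>. ln (norm (g (circ (\<rho> n) \<theta>))))"
  have vcont: "continuous_on A (v n)" for n A
  proof -
    have "continuous_on A (\<lambda>\<theta>. g (circ (\<rho> n) \<theta>))"
      using \<rho>(2)[of n] \<rho>pos[of n]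
      by (intro continuous_on_compose2[OF holomorphic_on_imp_continuous_on[OF g]] continuous_intros) auto
    thus ?thesis unfolding v_def using nz \<rho>pos[of n] by (intro continuous_intros) auto
  qed
  have [measurable]: "v n \<in> borel_measurable borel" for n
    by (intro borel_measurable_continuous_onI vcont)
  have vint: "integrable lborel (\<lambda>\<theta>. indicator I \<theta> * v n \<theta>)" for n
    using borel_integrable_atLeastAtMost'[OF vcont, of "-pi/2" "pi/2" n] by (simp add: set_integrable_def I_def)
  have vge: "pi * ln (norm (g 0)) \<le> (\<integral>\<theta>. indicator I \<theta> * v n \<theta> \<partial>lborel)" for n
  proof -
    have "pi * ln (norm (g 0)) \<le> integral I (v n)"
      unfolding I_def v_def using \<rho>(2)[of n] \<rho>pos[of n] g0 nz[of _ n]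
      by (intro ln_norm_sub_mean_value[OF g]) auto
    also have "\<dots> = (LINT \<theta>:I|lborel. v n \<theta>)"
      using borel_integrable_atLeastAtMost'[OF vcont, of "-pi/2" "pi/2" n] unfolding I_def
      by (intro set_borel_integral_eq_integral(2)[symmetric])
    finally show ?thesis by (simp add: set_lebesgue_integral_def)
  qed
  \<comment> \<open>The bound and the limit are assumed on the open interval only; both endpoints
    correspond to the point z = 1.\<close>
  have AEI: "AE \<theta> in lborel. \<theta> \<noteq> - pi/2 \<and> \<theta> \<noteq> pi/2"
    using AE_lborel_singleton[of "-pi/2"] AE_lborel_singleton[of "pi/2"] by eventually_elim auto
  have nonneg: "AE \<theta> in lborel. 0 \<le> iM \<theta> - indicator I \<theta> * v n \<theta>" for n
    using AEI
  proof eventually_elim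
    case (elim \<theta>)
    thus ?case using bound[of "\<rho> n" \<theta>] nz[of "circ (\<rho> n) \<theta>" n] \<rho>(2)[of n] \<rho>pos[of n]
      by (auto simp: indicator_def iM_def v_def I_def)
  qed
  have limI: "AE \<theta> in lborel. (\<lambda>n. indicator I \<theta> * v n \<theta>) \<longlonglongrightarrow> indicator I \<theta> * u \<theta>"
    using AEI lim
  proof eventually_elim
    case (elim \<theta>)
    show ?case
    proof (cases "\<theta> \<in> I")
      case True
      hence "((\<lambda>r. ln (norm (g (circ r \<theta>)))) \<longlongrightarrow> u \<theta>) (at_left 1)"
        using elim by (auto simp: I_def)
      from filterlim_compose[OF this \<rho>lim] show ?thesis
        unfolding v_def by (intro tendsto_intros)
    qed auto
  qed
  \<comment> \<open>By the sub-mean inequality \<open>K\<close> bounds the integral of M - v n for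
    every n; Fatou's lemma for these nonnegative functions passes the bound on to M - u.\<close>
  define K where "K = (\<integral>\<theta>. iM \<theta> \<partial>lborel) - pi * ln (norm (g 0))"
  have "(\<integral>\<^sup>+\<theta>. ennreal (iM \<theta> - indicator I \<theta> * u \<theta>) \<partial>lborel) = 
    (\<integral>\<^sup>+\<theta>. liminf (\<lambda>n. ennreal (iM \<theta> - indicator I \<theta> * v n \<theta>)) \<partial>lborel)"
  proof (rule nn_integral_cong_AE)
    show "AE \<theta> in lborel. ennreal (iM \<theta> - indicator I \<theta> * u \<theta>) = liminf (\<lambda>n. ennreal (iM \<theta> - indicator I \<theta> * v n \<theta>))"
      using limI
    proof eventually_elim
      case (elim \<theta>)
      show ?case
        by (rule lim_imp_Liminf[symmetric]) (auto intro!: tendsto_intros elim)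
    qed
  qed
  also have "\<dots> \<le> liminf (\<lambda>n. \<integral>\<^sup>+\<theta>. ennreal (iM \<theta> - indicator I \<theta> * v n \<theta>) \<partial>lborel)"
    by (rule nn_integral_liminf) measurable
  also have "\<dots> \<le> ennreal K"
  proof (rule Liminf_le)
    have "(\<integral>\<^sup>+\<theta>. ennreal (iM \<theta> - indicator I \<theta> * v n \<theta>) \<partial>lborel) \<le> ennreal K" for n
    proof -
      have "(\<integral>\<^sup>+\<theta>. ennreal (iM \<theta> - indicator I \<theta> * v n \<theta>) \<partial>lborel) = ennreal (\<integral>\<theta>. iM \<theta> - indicator I \<theta> * v n \<theta> \<partial>lborel)"
        by (intro nn_integral_eq_integral nonneg Bochner_Integration.integrable_diff iM vint)
      also have "\<dots> = ennreal ((\<integral>\<theta>. iM \<theta> \<partial>lborel) - (\<integral>\<theta>. indicator I \<theta> * v n \<theta> \<partial>lborel))"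
        by (subst Bochner_Integration.integral_diff) (auto intro: iM vint)
      also have "\<dots> \<le> ennreal K" unfolding K_def using vge[of n] by (intro ennreal_leI) auto
      finally show ?thesis .
    qed
    thus "\<forall>\<^sub>F n in sequentially. (\<integral>\<^sup>+\<theta>. ennreal (iM \<theta> - indicator I \<theta> * v n \<theta>) \<partial>lborel) \<le> ennreal K" by simp
  qed auto
  finally have le: "(\<integral>\<^sup>+\<theta>. ennreal (iM \<theta> - indicator I \<theta> * u \<theta>) \<partial>lborel) \<le> ennreal K" .
  have nonneg_u: "AE \<theta> in lborel. 0 \<le> iM \<theta> - indicator I \<theta> * u \<theta>"
  proof -
    have "AE \<theta> in lborel. \<forall>n. 0 \<le> iM \<theta> - indicator I \<theta> * v n \<theta>" using nonneg by (simp add: AE_all_countable)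
    with limI show ?thesis
    proof eventually_elim
      case (elim \<theta>)
      have "(\<lambda>n. iM \<theta> - indicator I \<theta> * v n \<theta>) \<longlonglongrightarrow> iM \<theta> - indicator I \<theta> * u \<theta>"
        using elim(1) by (intro tendsto_diff tendsto_const)
      thus ?case using elim by (intro LIMSEQ_le_const[of _ _ 0]) auto
    qed
  qed
  have int: "integrable lborel (\<lambda>\<theta>. iM \<theta> - indicator I \<theta> * u \<theta>)"
    using le nonneg_u by (intro integrableI_nonneg) (auto simp: top_unique le_less_trans)
  have uint: "integrable lborel (\<lambda>\<theta>. indicator I \<theta> * u \<theta>)"
    using Bochner_Integration.integrable_diff[OF iM int] by simp
  thus "set_integrable lborel {-pi/2..pi/2} u" by (simp add: set_integrable_def I_def)
  have "ennreal (\<integral>\<theta>. iM \<theta> - indicator I \<theta> * u \<theta> \<partial>lborel) \<le> ennreal K"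
    using le nn_integral_eq_integral[OF int nonneg_u] by simp
  \<comment> \<open>\<open>ennreal\<close> truncates negative numbers to 0, so the sign of
    \<open>K\<close> must be known before the inequality can be read over the reals.\<close>
  moreover have "K \<ge> 0"
  proof -
    have "0 \<le> (\<integral>\<theta>. iM \<theta> - indicator I \<theta> * v 0 \<theta> \<partial>lborel)" by (intro integral_nonneg_AE nonneg)
    also have "\<dots> = (\<integral>\<theta>. iM \<theta> \<partial>lborel) - (\<integral>\<theta>. indicator I \<theta> * v 0 \<theta> \<partial>lborel)"
      by (subst Bochner_Integration.integral_diff) (auto intro: iM vint)
    finally show ?thesis using vge[of 0] by (simp add: K_def)
  qed
  ultimately have "(\<integral>\<theta>. iM \<theta> - indicator I \<theta> * u \<theta> \<partial>lborel) \<le> K"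
    by (simp add: ennreal_le_iff)
  also have "(\<integral>\<theta>. iM \<theta> - indicator I \<theta> * u \<theta> \<partial>lborel) = (\<integral>\<theta>. iM \<theta> \<partial>lborel) - (\<integral>\<theta>. indicator I \<theta> * u \<theta> \<partial>lborel)"
    by (subst Bochner_Integration.integral_diff) (auto intro: iM uint)
  finally show "pi * ln (norm (g 0)) \<le> (LINT \<theta>:{-pi/2..pi/2}|lborel. u \<theta>)"
    by (simp add: K_def set_lebesgue_integral_def I_def)
qed

section \<open>Distances from the boundary point 1 and integrability of ln cos\<close>

lemma circ_1: "circ 1 \<theta> = - cis (- 2 * \<theta>)" by (simp add: circ_def)

lemma cos_pos_half_pi: "\<theta> \<in> {-pi/2<..<pi/2} \<Longrightarrow> cos \<theta> > 0"
  using cos_gt_zero_pi[of \<theta>] by auto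

lemma norm_1_minus_circ_sq: "norm (1 - circ r \<theta>) ^ 2 = (1 - r)\<^sup>2 + 4 * r * (cos \<theta>)\<^sup>2"
proof -
  have "norm (1 - circ r \<theta>) ^ 2 = (1 + r * cos (2 * \<theta>))\<^sup>2 + (r * sin (2 * \<theta>))\<^sup>2"
    by (simp add: cmod_power2 circ_def)
  also have "\<dots> = 1 + 2 * r * cos (2 * \<theta>) + r\<^sup>2 * ((sin (2 * \<theta>))\<^sup>2 + (cos (2 * \<theta>))\<^sup>2)"
    by algebra
  also have "\<dots> = 1 + 2 * r * cos (2 * \<theta>) + r\<^sup>2" by simp
  also have "\<dots> = (1 - r)\<^sup>2 + 4 * r * (cos \<theta>)\<^sup>2"
    unfolding cos_double_cos[of \<theta>] by algebra
  finally show ?thesis .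
qed

text \<open>The bound does not depend on \<open>r\<close>, as required of a majorant in
  \<open>ln_norm_boundary_integral\<close>.\<close>

lemma norm_1_minus_circ_ge:
  assumes "1/2 \<le> r" "\<theta> \<in> {-pi/2<..<pi/2}"
  shows "norm (1 - circ r \<theta>) \<ge> cos \<theta>"
proof (rule power2_le_imp_le)
  have "(cos \<theta>)\<^sup>2 \<le> 4 * r * (cos \<theta>)\<^sup>2" using assms mult_right_mono[of 1 "4 * r" "(cos \<theta>)\<^sup>2"] by simp
  thus "(cos \<theta>)\<^sup>2 \<le> (norm (1 - circ r \<theta>))\<^sup>2" unfolding norm_1_minus_circ_sq by (simp add: add_increasing)
qed auto

lemma norm_1_minus_circ_1:
  assumes "\<theta> \<in> {-pi/2<..<pi/2}" shows "norm (1 - circ 1 \<theta>) = 2 * cos \<theta>"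
proof (rule power2_eq_imp_eq)
  show "(norm (1 - circ 1 \<theta>))\<^sup>2 = (2 * cos \<theta>)\<^sup>2"
    unfolding norm_1_minus_circ_sq power_mult_distrib by simp
qed (use cos_pos_half_pi[OF assms] in auto)

lemma tendsto_circ_at_left: "((\<lambda>r. circ r \<theta>) \<longlongrightarrow> circ 1 \<theta>) (at_left 1)"
  unfolding circ_def by (intro tendsto_intros)

lemma set_integrable_const_half_pi: "set_integrable lborel {-pi/2..pi/2} (\<lambda>_. c::real)"
  by (intro borel_integrable_atLeastAtMost' continuous_intros)

text \<open>Jensen's inequality for 1 - z, whose boundary modulus is 2 cos \<theta> and whose
  logarithm is at most ln 2, yields the integrability at once.\<close>

lemma set_integrable_ln_cos: "set_integrable lborel {-pi/2..pi/2} (\<lambda>\<theta>. ln (cos \<theta>))"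
proof -
  have "set_integrable lborel {-pi/2..pi/2} (\<lambda>\<theta>. ln (2 * cos \<theta>))"
  proof (rule ln_norm_boundary_integral(1)[where g = "\<lambda>z. 1 - z" and M = "\<lambda>_. ln 2" and ?r0.0 = "1/2"])
    show "set_integrable lborel {-pi/2..pi/2} (\<lambda>_. ln 2 :: real)" by (rule set_integrable_const_half_pi)
    show "(\<lambda>z::complex. 1 - z) holomorphic_on ball 0 1" by (intro holomorphic_intros)
    show "ln (norm (1 - circ r \<theta>)) \<le> ln 2" if "1/2 \<le> r" "r < 1" "1 - circ r \<theta> \<noteq> 0" for r \<theta>
      using that norm_triangle_ineq4[of 1 "circ r \<theta>"] by auto
    show "AE \<theta> in lborel. \<theta> \<in> {-pi/2<..<pi/2} \<longrightarrow> ((\<lambda>r. ln (norm (1 - circ r \<theta>))) \<longlongrightarrow> ln (2 * cos \<theta>)) (at_left 1)"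
    proof (intro always_eventually allI impI)
      fix \<theta> assume \<theta>: "\<theta> \<in> {-pi/2<..<pi/2}"
      have "((\<lambda>r. ln (norm (1 - circ r \<theta>))) \<longlongrightarrow> ln (norm (1 - circ 1 \<theta>))) (at_left 1)"
        using cos_pos_half_pi[OF \<theta>] norm_1_minus_circ_1[OF \<theta>] by (intro tendsto_intros tendsto_circ_at_left) auto
      thus "((\<lambda>r. ln (norm (1 - circ r \<theta>))) \<longlongrightarrow> ln (2 * cos \<theta>)) (at_left 1)"
        by (simp add: norm_1_minus_circ_1[OF \<theta>])
    qed
  qed auto
  hence "set_integrable lborel {-pi/2..pi/2} (\<lambda>\<theta>. ln (2 * cos \<theta>) - ln 2)"
    by (intro set_integral_diff(1) set_integrable_const_half_pi)
  moreover have "AE \<theta> in lborel. \<theta> \<noteq> - pi/2 \<and> \<theta> \<noteq> pi/2"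
    using AE_lborel_singleton[of "-pi/2"] AE_lborel_singleton[of "pi/2"] by eventually_elim auto
  hence "AE \<theta> in lborel. \<theta> \<in> {-pi/2..pi/2} \<longrightarrow> ln (2 * cos \<theta>) - ln 2 = ln (cos \<theta>)"
  proof eventually_elim
    case (elim \<theta>)
    thus ?case using cos_pos_half_pi[of \<theta>] by (auto simp: ln_mult)
  qed
  ultimately show ?thesis
    by (subst (asm) set_integrable_cong_AE[where g = "\<lambda>\<theta>. ln (cos \<theta>)"]) auto
qed

section \<open>Bounds for ln |zeta| off the zeros\<close>

text \<open>Harnack's inequality at the centre, from the Schwarz lemma applied to the
  Cayley transform of \<open>H\<close>.\<close>

lemma harnack_center:
  assumes H: "H holomorphic_on ball 0 1" and pos: "\<And>z. z \<in> ball 0 1 \<Longrightarrow> Re (H z) > 0" and z: "norm z < 1"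
  shows "Re (H z) \<le> (1 + norm z) / (1 - norm z) * Re (H 0)"
proof -
  define a where "a = Re (H 0)"
  define K where "K = (\<lambda>z. H z - \<i> * of_real (Im (H 0)))"
  have a: "a > 0" using pos[of 0] by (simp add: a_def)
  have K0: "K 0 = of_real a" by (simp add: K_def a_def complex_eq_iff)
  have ReK: "Re (K w) = Re (H w)" for w by (simp add: K_def)
  have nz: "K w + of_real a \<noteq> 0" if "w \<in> ball 0 1" for w
    using pos[OF that] a ReK[of w] by (auto simp: complex_eq_iff)
  have lt: "norm ((K w - of_real a) / (K w + of_real a)) < 1" if "w \<in> ball 0 1" for w
  proof -
    have "(norm (K w - of_real a))\<^sup>2 < (norm (K w + of_real a))\<^sup>2"
      unfolding cmod_power2 using pos[OF that] a ReK[of w] by (simp add: power2_eq_square algebra_simps)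
    hence "norm (K w - of_real a) < norm (K w + of_real a)" by (rule power2_less_imp_less) auto
    thus ?thesis using nz[OF that] by (simp add: norm_divide)
  qed
  have "norm ((K z - of_real a) / (K z + of_real a)) \<le> norm z"
  proof (rule Schwarz_Lemma(1))
    show "(\<lambda>w. (K w - of_real a) / (K w + of_real a)) holomorphic_on ball 0 1"
      unfolding K_def by (intro holomorphic_intros H) (use nz in \<open>auto simp: K_def\<close>)
  qed (use lt K0 z in auto)
  hence "norm (K z - of_real a) \<le> norm z * norm (K z + of_real a)"
    using nz[of z] z by (simp add: norm_divide field_simps)
  also have "\<dots> \<le> norm z * (norm (K z) + a)"
    using norm_triangle_ineq[of "K z" "of_real a"] a by (intro mult_left_mono) auto
  finally have "norm (K z) - a \<le> norm z * (norm (K z) + a)"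
    using norm_triangle_ineq2[of "K z" "of_real a"] a by simp
  hence "norm (K z) * (1 - norm z) \<le> (1 + norm z) * a" by (simp add: algebra_simps)
  hence "norm (K z) \<le> (1 + norm z) * a / (1 - norm z)" using z by (simp add: pos_le_divide_eq)
  thus ?thesis using complex_Re_le_cmod[of "K z"] ReK[of z] by (simp add: a_def)
qed

text \<open>On a zero-free ball \<open>B - ln (norm (f z))\<close> is a positive harmonic function,
  namely the real part of B - h with exp h = f. Harnack's inequality, rescaled to this ball, bounds
  it by its value at \<open>c\<close>, so an upper bound for ln |f| turns into a lower one.\<close>

lemma ln_norm_lower_bound:
  assumes f: "f holomorphic_on ball c R" and nz: "\<And>w. w \<in> ball c R \<Longrightarrow> f w \<noteq> 0"
    and B: "\<And>w. w \<in> ball c R \<Longrightarrow> ln (norm (f w)) < B" and z: "norm (z - c) \<le> r" and r: "0 \<le> r" "r < R"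
  shows "ln (norm (f z)) \<ge> B - (R + r) / (R - r) * (B - ln (norm (f c)))"
proof -
  have R: "R > 0" using r by auto
  have zb: "c \<in> ball c R" using R by auto
  obtain h where h: "h holomorphic_on ball c R" "\<And>x. x \<in> ball c R \<Longrightarrow> exp (h x) = f x"
    using holomorphic_logarithm_exists[OF convex_ball open_ball f nz zb] by metis
  have ln: "ln (norm (f x)) = Re (h x)" if "x \<in> ball c R" for x
    using h(2)[OF that] by (metis ln_exp norm_exp_eq_Re)
  have im: "c + of_real R * w \<in> ball c R" if "w \<in> ball 0 1" for w
    using that R by (simp add: dist_norm norm_mult)
  define H where "H = (\<lambda>w. of_real B - h (c + of_real R * w))"
  define w where "w = (z - c) / of_real R"
  have w: "norm w \<le> r / R" "c + of_real R * w = z" using z R by (auto simp: w_def norm_divide divide_right_mono)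
  have w1: "norm w < 1" using w(1) r R by (smt (verit) divide_less_eq_1)
  have "Re (H w) \<le> (1 + norm w) / (1 - norm w) * Re (H 0)"
  proof (rule harnack_center[OF _ _ w1])
    have "(\<lambda>w. h (c + of_real R * w)) holomorphic_on ball 0 1"
      by (intro holomorphic_on_compose_gen[OF _ h(1), unfolded o_def] holomorphic_intros) (use im in auto)
    thus "H holomorphic_on ball 0 1" unfolding H_def by (intro holomorphic_intros)
    show "Re (H x) > 0" if "x \<in> ball 0 1" for x
      using B[OF im[OF that]] ln[OF im[OF that]] by (simp add: H_def)
  qed
  also have "\<dots> \<le> (R + r) / (R - r) * Re (H 0)"
  proof (rule mult_right_mono)
    have "(1 + norm w) / (1 - norm w) \<le> (1 + r / R) / (1 - r / R)"
      using w(1) r R w1 by (intro frac_le) auto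
    also have "\<dots> = (R + r) / (R - r)" using R r by (simp add: field_simps)
    finally show "(1 + norm w) / (1 - norm w) \<le> (R + r) / (R - r)" .
    show "Re (H 0) \<ge> 0" using B[OF zb] ln[OF zb] by (simp add: H_def)
  qed
  finally show ?thesis
    using ln[OF zb] ln[of z] im[of w] w1 w(2) by (simp add: H_def)
qed

lemma summable_zeta_2: "summable (\<lambda>n. real (Suc n) powr - 2)"
  by (intro summable_Suc_powr) auto

lemma zeta_sum_ge_1:
  assumes "c > 1" shows "(\<Sum>n. real (Suc n) powr - c) \<ge> 1"
proof -
  have "(\<Sum>n\<in>{0}. real (Suc n) powr - c) \<le> (\<Sum>n. real (Suc n) powr - c)"
    using assms by (intro sum_le_suminf summable_Suc_powr) auto
  thus ?thesis by simp
qed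

lemma ln_zeta_P_upper:
  obtains K where "K \<ge> 0" "\<And>s. Re s \<ge> 0 \<Longrightarrow> zeta_P s \<noteq> 0 \<Longrightarrow> ln (norm (zeta_P s)) \<le> K * (1 + ln (1 + norm s))"
proof -
  obtain C where C: "C \<ge> 1" "\<And>s. Re s \<ge> 0 \<Longrightarrow> norm (zeta_P s) \<le> C * (1 + norm s) ^ 3"
    using zeta_P_bound by blast
  have "ln (norm (zeta_P s)) \<le> (ln C + 3) * (1 + ln (1 + norm s))" if "Re s \<ge> 0" "zeta_P s \<noteq> 0" for s
  proof -
    have p: "1 + norm s > 0" by (simp add: add_pos_nonneg)
    have "ln (norm (zeta_P s)) \<le> ln (C * (1 + norm s) ^ 3)"
      using C that p by (subst ln_le_cancel_iff) auto
    also have "\<dots> = ln C + 3 * ln (1 + norm s)" using C(1) p by (simp add: ln_mult ln_realpow)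
    also have "\<dots> \<le> (ln C + 3) * (1 + ln (1 + norm s))" using C(1) by (simp add: algebra_simps)
    finally show ?thesis .
  qed
  thus ?thesis using C(1) that[of "ln C + 3"] by simp
qed

text \<open>For Re s >= 2 the Moebius series keeps |zeta| away from 0. Left of this line Harnack's
  inequality is used around 2 + i Im s: the ball is zero-free by assumption, so the logarithmic
  upper bound for ln |zeta_P| becomes a lower bound of the same order.\<close>

lemma ln_zeta_P_lower:
  assumes nz: "\<And>s. Re s > 1/2 \<Longrightarrow> zeta_P s \<noteq> 0" and \<alpha>: "0 < \<alpha>" "\<alpha> < 1/2"
  obtains K where "K \<ge> 0" "\<And>s. Re s \<ge> 1/2 + \<alpha> \<Longrightarrow> ln (norm (zeta_P s)) \<ge> - (K * (1 + ln (1 + norm s)))"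
proof -
  define S where "S = (\<Sum>n. real (Suc n) powr - 2)"
  have S: "S \<ge> 1" unfolding S_def by (rule zeta_sum_ge_1) auto
  obtain K0 where K0: "K0 \<ge> 0" "\<And>s. Re s \<ge> 0 \<Longrightarrow> zeta_P s \<noteq> 0 \<Longrightarrow> ln (norm (zeta_P s)) \<le> K0 * (1 + ln (1 + norm s))"
    using ln_zeta_P_upper by blast
  have low2: "ln (norm (zeta_P s)) \<ge> - ln S" if s: "Re s \<ge> 2" for s
  proof -
    have "norm (1 / zeta s) \<le> S" unfolding S_def using s by (intro norm_zeta_bounds(2)) auto
    moreover have "zeta s = zeta_P s / (s - 1)" using s by (intro zeta_eq_P) auto
    moreover have P: "zeta_P s \<noteq> 0" using s by (intro nz) auto
    ultimately have "norm (s - 1) \<le> S * norm (zeta_P s)" by (simp add: norm_divide field_simps)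
    moreover have "norm (s - 1) \<ge> 1" using complex_Re_le_cmod[of "s - 1"] s by simp
    ultimately have "1 / S \<le> norm (zeta_P s)" using S by (simp add: field_simps)
    hence "ln (1 / S) \<le> ln (norm (zeta_P s))" using S P by (subst ln_le_cancel_iff) auto
    thus ?thesis using S by (simp add: ln_div)
  qed
  \<comment> \<open>Around a centre with real part 2, radius \<open>r\<close> just reaches Re s =
    1/2 + \<alpha>, and radius \<open>R\<close> stays within Re s > 1/2 + \<alpha> / 2. The gap
    \<alpha> / 2 keeps \<open>q\<close> finite.\<close>
  define R where "R = 3/2 - \<alpha>/2"
  define r where "r = 3/2 - \<alpha>"
  define q where "q = (R + r) / (R - r)"
  have Rr: "0 \<le> r" "r < R" using \<alpha> by (auto simp: R_def r_def)
  have q: "q \<ge> 0" using Rr by (auto simp: q_def)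
  define K where "K = ln S + q * (K0 * (1 + ln 4) + 1 + ln S)"
  have K: "K \<ge> 0" using S q K0 by (auto simp: K_def intro!: add_nonneg_nonneg mult_nonneg_nonneg)
  have "ln (norm (zeta_P s)) \<ge> - (K * (1 + ln (1 + norm s)))" if s: "Re s \<ge> 1/2 + \<alpha>" for s
  proof -
    define l where "l = ln (1 + norm s)"
    have l: "l \<ge> 0" by (simp add: l_def)
    show ?thesis
    proof (cases "Re s \<ge> 2")
      case True
      have "K * (1 + l) \<ge> ln S * 1" unfolding K_def using S q K0 l by (intro mult_mono) auto
      thus ?thesis using low2[OF True] by (simp add: l_def)
    next
      case False
      define c where "c = Complex 2 (Im s)"
      \<comment> \<open>Points \<open>w\<close> of the ball satisfy |w| <= |s| + r + R <= |s| + 3,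
        hence 1 + |w| <= 4 (1 + |s|); the final 1 makes the bound strict.\<close>
      define B where "B = K0 * (1 + ln 4 + l) + 1"
      have zc: "norm (s - c) \<le> r"
      proof -
        have "s - c = of_real (Re s - 2)" by (simp add: c_def complex_eq_iff)
        hence "norm (s - c) = \<bar>Re s - 2\<bar>" by (simp only: norm_of_real)
        thus ?thesis using False s by (simp add: r_def)
      qed
      have half: "Re w > 1/2" if "w \<in> ball c R" for w
        using that complex_Re_le_cmod[of "c - w"] \<alpha> by (simp add: dist_norm c_def R_def)
      have "B - q * (B - ln (norm (zeta_P c))) \<le> ln (norm (zeta_P s))"
        unfolding q_def
      proof (rule ln_norm_lower_bound[OF _ _ _ zc Rr])
        show "zeta_P holomorphic_on ball c R"
          by (rule holomorphic_on_subset[OF holomorphic_zeta_P]) (use half in force)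
        show "zeta_P w \<noteq> 0" if "w \<in> ball c R" for w using half[OF that] by (rule nz)
        show "ln (norm (zeta_P w)) < B" if w: "w \<in> ball c R" for w
        proof -
          have "norm w \<le> norm s + norm (s - c) + norm (c - w)"
            using norm_triangle_ineq4[of s "s - w"] norm_triangle_ineq[of "s - c" "c - w"] by simp
          also have "\<dots> \<le> norm s + 3" using zc w Rr \<alpha> by (simp add: dist_norm R_def r_def)
          finally have "1 + norm w \<le> 4 * (1 + norm s)" using norm_ge_zero[of s] unfolding distrib_left by linarith
          hence "ln (1 + norm w) \<le> ln (4 * (1 + norm s))"
            by (subst ln_le_cancel_iff) (auto simp: add_pos_nonneg)
          also have "\<dots> = ln 4 + l" 
          proof -
            have "1 + norm s > 0" using norm_ge_zero[of s] by linarith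
            thus ?thesis unfolding l_def by (subst ln_mult) (simp_all add: less_imp_neq[symmetric])
          qed
          finally have "K0 * (1 + ln (1 + norm w)) \<le> K0 * (1 + ln 4 + l)"
            using K0(1) by (intro mult_left_mono) auto
          thus ?thesis using K0(2)[of w] half[OF w] nz[of w] by (simp add: B_def)
        qed
      qed
      moreover have "q * (B - ln (norm (zeta_P c))) \<le> q * (B + ln S)"
        using low2[of c] q by (intro mult_left_mono) (auto simp: c_def)
      moreover have "B \<ge> 0" using K0(1) l by (auto simp: B_def intro!: add_nonneg_nonneg mult_nonneg_nonneg)
      moreover have "q * (B + ln S) \<le> K * (1 + l)"
      proof -
        have "B + ln S \<le> (K0 * (1 + ln 4) + 1 + ln S) * (1 + l)"
          using K0(1) l S by (simp add: B_def algebra_simps)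
        hence "q * (B + ln S) \<le> q * ((K0 * (1 + ln 4) + 1 + ln S) * (1 + l))" using q by (rule mult_left_mono)
        also have "\<dots> \<le> K * (1 + l)" using S l by (simp add: K_def algebra_simps)
        finally show ?thesis .
      qed
      ultimately show ?thesis by (simp add: l_def)
    qed
  qed
  thus ?thesis using K that by blast
qed

section \<open>The Cayley map onto a half plane and its boundary line\<close>

definition half_plane_map :: "real \<Rightarrow> real \<Rightarrow> complex \<Rightarrow> complex" where
  "half_plane_map c b z = of_real c + of_real b * ((1 + z) / (1 - z))"

definition vline :: "real \<Rightarrow> real \<Rightarrow> real \<Rightarrow> complex" where
  "vline c b \<theta> = of_real c + \<i> * of_real (b * tan \<theta>)"

lemma half_plane_map_0 [simp]: "half_plane_map c b 0 = of_real (c + b)"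
  by (simp add: half_plane_map_def)

lemma Re_cayley:
  assumes "norm z < 1" shows "Re ((1 + z) / (1 - z)) > 0"
proof -
  have nz: "1 - z \<noteq> 0" using assms by auto
  have "(1 + z) / (1 - z) = ((1 + z) * cnj (1 - z)) / of_real ((norm (1 - z))\<^sup>2)"
    unfolding complex_norm_square using nz 
    by (intro nonzero_mult_divide_mult_cancel_right[symmetric]) (simp del: complex_cnj_diff)
  also have "Re \<dots> = Re ((1 + z) * cnj (1 - z)) / (norm (1 - z))\<^sup>2" by (simp only: Re_divide_of_real)
  also have "Re ((1 + z) * cnj (1 - z)) = 1 - (norm z)\<^sup>2" unfolding cmod_power2 by (simp add: power2_eq_square algebra_simps)
  finally show ?thesis using assms nz by (simp add: abs_square_less_1)
qed

lemma Re_half_plane_map: "b > 0 \<Longrightarrow> norm z < 1 \<Longrightarrow> Re (half_plane_map c b z) > c"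
  using Re_cayley[of z] 
  by (simp only: half_plane_map_def plus_complex.sel times_complex.sel Re_complex_of_real Im_complex_of_real) simp

lemma holomorphic_half_plane_map: "half_plane_map c b holomorphic_on ball 0 1"
  unfolding half_plane_map_def by (intro holomorphic_intros) auto

lemma circ_1_neq_1: "\<theta> \<in> {-pi/2<..<pi/2} \<Longrightarrow> circ 1 \<theta> \<noteq> 1"
  using norm_1_minus_circ_1[of \<theta>] cos_pos_half_pi[of \<theta>] by auto

lemma half_plane_map_circ_1:
  assumes "\<theta> \<in> {-pi/2<..<pi/2}" shows "half_plane_map c b (circ 1 \<theta>) = vline c b \<theta>"
proof -
  have c: "cos \<theta> \<noteq> 0" using cos_pos_half_pi[OF assms] by simp
  have "cis (-2 * \<theta>) = cis (- \<theta>) * cis (- \<theta>)" by (simp add: cis_mult)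
  moreover have "cis \<theta> * cis (- \<theta>) = 1" by (simp add: cis_mult)
  ultimately have "1 + circ 1 \<theta> = cis (- \<theta>) * (cis \<theta> - cis (- \<theta>))" "1 - circ 1 \<theta> = cis (- \<theta>) * (cis \<theta> + cis (- \<theta>))"
    by (simp_all add: circ_1 algebra_simps)
  hence "(1 + circ 1 \<theta>) / (1 - circ 1 \<theta>) = (cis \<theta> - cis (- \<theta>)) / (cis \<theta> + cis (- \<theta>))" by simp
  also have "\<dots> = (2 * \<i> * of_real (sin \<theta>)) / (2 * of_real (cos \<theta>))"
    by (rule arg_cong2[where f = "(/)"]) (simp_all add: complex_eq_iff)
  finally show ?thesis using c by (simp add: half_plane_map_def vline_def tan_def)
qed

lemma half_plane_map_tendsto:
  assumes "\<theta> \<in> {-pi/2<..<pi/2}"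
  shows "((\<lambda>r. half_plane_map c b (circ r \<theta>)) \<longlongrightarrow> vline c b \<theta>) (at_left 1)"
  unfolding half_plane_map_circ_1[OF assms, symmetric] half_plane_map_def
  using circ_1_neq_1[OF assms] by (intro tendsto_intros tendsto_circ_at_left) auto

lemma Re_vline [simp]: "Re (vline c b \<theta>) = c" by (simp add: vline_def)

lemma ln_zeta_vline_measurable [measurable]: "(\<lambda>\<theta>. ln (norm (zeta (vline c b \<theta>)))) \<in> borel_measurable borel"
  unfolding vline_def tan_def by measurable

text \<open>The reflection zeta(conj s) = conj(zeta s) makes the integrand even, so the mean over
  the full circle is twice the half integral in \<open>phi_in\<close> and \<open>phi_out\<close>.
  The integrand is Borel measurable, whence Lebesgue and Borel integral agree.\<close>

lemma line_average:
  assumes c: "c > 0" and w: "w = (\<lambda>\<theta>. ln (norm (zeta (vline c b \<theta>))))" 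
    and int: "set_integrable lborel {-pi/2..pi/2} w"
  shows "(LINT \<theta>:{-pi/2..pi/2}|lborel. w \<theta>) = 2 * (LINT \<theta>:{0..pi/2}|lebesgue. w \<theta>)"
proof -
  have even: "w (- \<theta>) = w \<theta>" for \<theta>
  proof -
    have "vline c b (- \<theta>) = cnj (vline c b \<theta>)" by (simp add: vline_def complex_eq_iff)
    thus ?thesis using c by (simp add: w zeta_cnj)
  qed
  have [measurable]: "w \<in> borel_measurable borel" unfolding w by measurable
  have int': "set_integrable lborel {0..pi/2} w" "set_integrable lborel {-pi/2..<0} w"
    by (rule set_integrable_subset[OF int]; force)+
  have "{-pi/2..pi/2} = {-pi/2..<0} \<union> {0..pi/2}" by auto
  hence "(LINT \<theta>:{-pi/2..pi/2}|lborel. w \<theta>) = (LINT \<theta>:{-pi/2..<0}|lborel. w \<theta>) + (LINT \<theta>:{0..pi/2}|lborel. w \<theta>)"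
    using int' by (simp only:) (rule set_integral_Un, auto)
  also have "(LINT \<theta>:{-pi/2..<0}|lborel. w \<theta>) = (\<integral>\<theta>. indicator {-pi/2..<0} (0 + (-1) * \<theta>) * w (0 + (-1) * \<theta>) \<partial>lborel)"
    using lborel_integral_real_affine[of "-1" "\<lambda>\<theta>. indicator {-pi/2..<0} \<theta> * w \<theta>" 0] by (simp add: set_lebesgue_integral_def)
  also have "\<dots> = (\<integral>\<theta>. indicator {0..pi/2} \<theta> * w \<theta> \<partial>lborel)"
  proof (rule integral_cong_AE)
    show "AE \<theta> in lborel. indicator {-pi/2..<0} (0 + (-1) * \<theta>) * w (0 + (-1) * \<theta>) = indicator {0..pi/2} \<theta> * w \<theta>"
      using AE_lborel_singleton[of 0] by eventually_elim (auto simp: indicator_def even)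
  qed (auto simp: even)
  also have "\<dots> = (LINT \<theta>:{0..pi/2}|lborel. w \<theta>)" by (simp add: set_lebesgue_integral_def)
  also have "(LINT \<theta>:{0..pi/2}|lborel. w \<theta>) = (LINT \<theta>:{0..pi/2}|lebesgue. w \<theta>)"
    unfolding set_lebesgue_integral_def by (subst integral_completion) auto
  finally show ?thesis by simp
qed

section \<open>Poisson averages of ln |zeta| on vertical lines\<close>

lemma zeta_continuous: "s \<noteq> 1 \<Longrightarrow> isCont zeta s"
proof -
  assume "s \<noteq> 1"
  have "isCont zeta_F s"
    using holomorphic_zeta_F[of UNIV] holomorphic_on_imp_continuous_on continuous_on_eq_continuous_at by blast
  thus ?thesis unfolding zeta_eq[abs_def] using \<open>s \<noteq> 1\<close> by (intro continuous_intros) auto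
qed

lemma holomorphic_zeta: "1 \<notin> A \<Longrightarrow> zeta holomorphic_on A"
  unfolding zeta_eq[abs_def] by (intro holomorphic_intros holomorphic_zeta_F) auto

text \<open>For c > 1 both g and 1 / g are holomorphic and bounded on the disc, with constant
  majorants. Jensen's inequality for g and for 1 / g gives the two halves of the equality.\<close>

lemma zeta_mean_right_half_plane:
  assumes c: "c > 1" and b: "b > 0"
  shows "set_integrable lborel {-pi/2..pi/2} (\<lambda>\<theta>. ln (norm (zeta (vline c b \<theta>))))" (is ?A)
    and "(LINT \<theta>:{-pi/2..pi/2}|lborel. ln (norm (zeta (vline c b \<theta>)))) = pi * ln (norm (zeta (of_real (c + b))))" (is ?B)
proof -
  define S where "S = (\<Sum>n. real (Suc n) powr - c)"
  have S: "S \<ge> 1" unfolding S_def by (rule zeta_sum_ge_1[OF c])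
  define g where "g = (\<lambda>z. zeta (half_plane_map c b z))"
  have Re: "Re (half_plane_map c b z) > c" if "norm z < 1" for z using Re_half_plane_map[OF b that] .
  have gnz: "g z \<noteq> 0" if "norm z < 1" for z unfolding g_def using Re[OF that] c by (intro zeta_nonzero) auto
  have z_hol: "zeta holomorphic_on {s. Re s > c}" by (rule holomorphic_zeta) (use c in auto)
  have g_hol: "g holomorphic_on ball 0 1" unfolding g_def
    by (rule holomorphic_on_compose_gen[OF holomorphic_half_plane_map z_hol, unfolded o_def]) (use Re in auto)
  have lim: "((\<lambda>r. ln (norm (g (circ r \<theta>)))) \<longlongrightarrow> ln (norm (zeta (vline c b \<theta>)))) (at_left 1)" if "\<theta> \<in> {-pi/2<..<pi/2}" for \<theta>
  proof -
    have "zeta (vline c b \<theta>) \<noteq> 0" using c by (intro zeta_nonzero) auto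
    moreover have "vline c b \<theta> \<noteq> 1" using c Re_vline[of c b \<theta>] by (metis less_irrefl one_complex.sel(1))
    ultimately show ?thesis unfolding g_def
      by (intro tendsto_intros isCont_tendsto_compose[OF zeta_continuous] half_plane_map_tendsto that) auto
  qed
  have bnd: "ln (norm (g z)) \<le> ln S" "ln (norm (1 / g z)) \<le> ln S" if "norm z < 1" for z
  proof -
    have "norm (g z) \<le> S" "norm (1 / g z) \<le> S"
      using norm_zeta_bounds[OF c, of "half_plane_map c b z"] Re[OF that] by (auto simp: S_def g_def)
    thus "ln (norm (g z)) \<le> ln S" "ln (norm (1 / g z)) \<le> ln S"
      using gnz[OF that] S by (auto simp del: norm_divide simp: iffD2[OF ln_le_cancel_iff])
  qed
  note D = ln_norm_boundary_integral[where M = "\<lambda>_. ln S" and ?r0.0 = "1/2"]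
  have 1: "set_integrable lborel {-pi/2..pi/2} (\<lambda>\<theta>. ln (norm (zeta (vline c b \<theta>))))"
    "pi * ln (norm (g 0)) \<le> (LINT \<theta>:{-pi/2..pi/2}|lborel. ln (norm (zeta (vline c b \<theta>))))"
    by (rule D[OF g_hol]; (use gnz[of 0] bnd lim set_integrable_const_half_pi in auto))+
  have 2: "pi * ln (norm (1 / g 0)) \<le> (LINT \<theta>:{-pi/2..pi/2}|lborel. - ln (norm (zeta (vline c b \<theta>))))"
  proof (rule D(2))
    show "(\<lambda>z. 1 / g z) holomorphic_on ball 0 1" by (intro holomorphic_intros g_hol) (use gnz in auto)
    show "ln (norm (1 / g (circ r \<theta>))) \<le> ln S" if "1/2 \<le> r" "r < 1" for r \<theta>
      using that by (intro bnd) auto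
    show "AE \<theta> in lborel. \<theta> \<in> {-pi/2<..<pi/2} \<longrightarrow> ((\<lambda>r. ln (norm (1 / g (circ r \<theta>)))) \<longlongrightarrow> - ln (norm (zeta (vline c b \<theta>)))) (at_left 1)"
    proof (intro always_eventually allI impI)
      fix \<theta> assume "\<theta> \<in> {-pi/2<..<pi/2}"
      from tendsto_minus[OF lim[OF this]]
      have "((\<lambda>r. - ln (norm (g (circ r \<theta>)))) \<longlongrightarrow> - ln (norm (zeta (vline c b \<theta>)))) (at_left 1)" .
      moreover have "ln (norm (1 / w)) = - ln (norm w)" for w :: complex by (simp add: norm_divide ln_div)
      ultimately show "((\<lambda>r. ln (norm (1 / g (circ r \<theta>)))) \<longlongrightarrow> - ln (norm (zeta (vline c b \<theta>)))) (at_left 1)"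
        by (simp only:)
    qed
  qed (use gnz[of 0] set_integrable_const_half_pi in auto)
  have "ln (norm (1 / g 0)) = - ln (norm (g 0))" using gnz[of 0] by (simp add: norm_divide ln_div)
  with 2 have "pi * ln (norm (g 0)) \<ge> (LINT \<theta>:{-pi/2..pi/2}|lborel. ln (norm (zeta (vline c b \<theta>))))"
    by (simp add: set_lebesgue_integral_def)
  with 1 show ?A ?B by (auto simp: g_def)
qed

text \<open>The entire function \<open>zeta_F\<close> has countably many zeros and tan is injective
  on the interval, so the exceptional angles are countable. With c different from 1 the line misses
  s = 1, where \<open>zeta\<close> is 0 by convention only.\<close>

lemma AE_zeta_vline_nonzero:
  assumes c: "c > 0" "c \<noteq> 1" and b: "b > 0"
  shows "AE \<theta> in lborel. \<theta> \<in> {-pi/2<..<pi/2} \<longrightarrow> zeta (vline c b \<theta>) \<noteq> 0"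
proof -
  have ne1: "vline c b \<theta> \<noteq> 1" for \<theta> using c Re_vline[of c b \<theta>] by (metis one_complex.sel(1))
  have "zeta_F \<noteq> (\<lambda>_. 0)"
  proof
    assume "zeta_F = (\<lambda>_. 0)"
    from fun_cong[OF this, of 1] show False by (simp add: zeta_F_eq_P zeta_P_1)
  qed
  hence cF: "countable {z. zeta_F z = 0}"
    using holomorphic_countable_equal_UNIV[OF holomorphic_zeta_F, of "\<lambda>_. 0"] by auto
  define A where "A = {\<theta> \<in> {-pi/2<..<pi/2}. zeta (vline c b \<theta>) = 0}"
  have "countable A"
  proof (rule countable_image_inj_on)
    have "vline c b ` A \<subseteq> {z. zeta_F z = 0}" using ne1 by (auto simp: A_def zeta_eq)
    thus "countable (vline c b ` A)" using cF countable_subset by blast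
    show "inj_on (vline c b) A"
    proof (rule inj_onI)
      fix x y assume x: "x \<in> A" and y: "y \<in> A" and eq: "vline c b x = vline c b y"
      have "Im (vline c b x) = Im (vline c b y)" by (rule arg_cong[OF eq])
      hence "tan x = tan y" using b by (simp add: vline_def)
      moreover have "arctan (tan x) = x" "arctan (tan y) = y" using x y by (intro arctan_tan; simp add: A_def)+
      ultimately show "x = y" by metis
    qed
  qed
  hence "A \<in> null_sets lborel" by (rule countable_imp_null_set_lborel)
  hence "AE \<theta> in lborel. \<theta> \<notin> A" by (rule AE_not_in)
  thus ?thesis by eventually_elim (auto simp: A_def)
qed

text \<open>Using \<open>zeta_P\<close> avoids the removable singularity at the origin of the form 2
  b z zeta(s).\<close>

definition zeta_disc :: "real \<Rightarrow> complex \<Rightarrow> complex" where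
  "zeta_disc b z = (1 - z) * zeta_P (half_plane_map (1 - b) b z)"

context
  fixes b :: real
  assumes b: "0 < b" "b < 1/2"
begin

lemma zeta_disc_0: "zeta_disc b 0 = 1"
  by (simp add: zeta_disc_def zeta_P_1)

lemma holomorphic_zeta_disc: "zeta_disc b holomorphic_on ball 0 1"
  unfolding zeta_disc_def
proof (intro holomorphic_intros holomorphic_on_compose_gen[OF holomorphic_half_plane_map holomorphic_zeta_P, unfolded o_def])
  show "half_plane_map (1 - b) b ` ball 0 1 \<subseteq> {s. - 1 < Re s}"
  proof safe
    fix z :: complex assume "z \<in> ball 0 1"
    thus "- 1 < Re (half_plane_map (1 - b) b z)" using Re_half_plane_map[OF b(1), of z "1 - b"] b by simp
  qed
qed

lemma zeta_disc_tendsto: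
  assumes \<theta>: "\<theta> \<in> {-pi/2<..<pi/2}"
  shows "((\<lambda>r. norm (zeta_disc b (circ r \<theta>))) \<longlongrightarrow> 2 * b * norm (zeta (vline (1 - b) b \<theta>))) (at_left 1)"
proof -
  have cont: "isCont zeta_P (vline (1 - b) b \<theta>)"
    using holomorphic_on_imp_continuous_on[OF holomorphic_zeta_P] b
    by (auto simp: continuous_on_eq_continuous_at open_halfspace_Re_gt)
  have "((\<lambda>r. norm (zeta_disc b (circ r \<theta>))) \<longlongrightarrow> norm ((1 - circ 1 \<theta>) * zeta_P (vline (1 - b) b \<theta>))) (at_left 1)"
    unfolding zeta_disc_def
    by (intro tendsto_intros isCont_tendsto_compose[OF cont] half_plane_map_tendsto \<theta> tendsto_circ_at_left)
  moreover have "(1 - circ 1 \<theta>) * zeta_P (vline (1 - b) b \<theta>) = of_real (2 * b) * circ 1 \<theta> * zeta (vline (1 - b) b \<theta>)"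
  proof -
    define z where "z = circ 1 \<theta>"
    have z: "1 - z \<noteq> 0" using circ_1_neq_1[OF \<theta>] by (simp add: z_def)
    have s1: "vline (1 - b) b \<theta> - 1 = of_real (2 * b) * z / (1 - z)"
      using z unfolding half_plane_map_circ_1[OF \<theta>, symmetric] half_plane_map_def z_def[symmetric] by (simp add: field_simps)
    have "Re (vline (1 - b) b \<theta>) \<noteq> Re 1" using b by simp
    hence ne: "vline (1 - b) b \<theta> \<noteq> 1" by metis
    have "zeta_P (vline (1 - b) b \<theta>) = zeta (vline (1 - b) b \<theta>) * (vline (1 - b) b \<theta> - 1)"
      using ne b by (subst zeta_eq_P) auto
    thus ?thesis unfolding s1 z_def[symmetric] using z by (simp add: field_simps)
  qed
  ultimately show ?thesis using b by (simp add: norm_mult)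
qed

text \<open>The point z = 1 corresponds to s = infinity. Polynomial growth in s thus becomes a
  singularity of size - ln cos \<theta> at the ends of the interval, uniformly in \<open>r\<close>
  and integrable.\<close>

lemma ln_half_plane_map_le:
  assumes r: "1/2 \<le> r" "r < 1" and \<theta>: "\<theta> \<in> {-pi/2<..<pi/2}"
  shows "ln (1 + norm (half_plane_map (1 - b) b (circ r \<theta>))) \<le> ln 5 - ln (cos \<theta>)"
proof -
  define z where "z = circ r \<theta>"
  define x where "x = norm (1 - z)"
  have x: "x \<ge> cos \<theta>" using norm_1_minus_circ_ge[OF r(1) \<theta>] by (simp add: x_def z_def)
  have c: "cos \<theta> > 0" by (rule cos_pos_half_pi[OF \<theta>])
  have z1: "norm z \<le> 1" using r by (simp add: z_def)
  have x2: "x \<le> 2" unfolding x_def using norm_triangle_ineq4[of 1 z] z1 by simp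
  have "norm (of_real b * ((1 + z) / (1 - z))) = b * norm (1 + z) / x" using b by (simp add: norm_mult norm_divide x_def)
  also have "\<dots> \<le> 1 / x"
    using b x c z1 norm_triangle_ineq[of 1 z] mult_mono[of b "1/2" "norm (1 + z)" 2] by (intro divide_right_mono) auto
  finally have "norm (half_plane_map (1 - b) b z) \<le> 1 + 1 / x"
    unfolding half_plane_map_def using norm_triangle_ineq[of "of_real (1 - b)" "of_real b * ((1 + z) / (1 - z))"] b by (simp del: of_real_diff)
  \<comment> \<open>2 + 1 / x <= 5 / x amounts to 2 x + 1 <= 5, which follows from x <= 2.\<close>
  hence "1 + norm (half_plane_map (1 - b) b z) \<le> 5 / x"
    using x x2 c by (simp add: field_simps) 
  also have "\<dots> \<le> 5 / cos \<theta>" using x c by (intro divide_left_mono) auto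
  finally have "ln (1 + norm (half_plane_map (1 - b) b z)) \<le> ln (5 / cos \<theta>)"
    using c by (subst ln_le_cancel_iff) (auto simp: add_pos_nonneg)
  thus ?thesis using c by (simp add: ln_div z_def)
qed

lemma ln_1_minus_circ:
  assumes r: "1/2 \<le> r" "r < 1" and \<theta>: "\<theta> \<in> {-pi/2<..<pi/2}"
  shows "ln (norm (1 - circ r \<theta>)) \<le> ln 2" "ln (norm (1 - circ r \<theta>)) \<ge> ln (cos \<theta>)" "1 - circ r \<theta> \<noteq> 0"
proof -
  have x: "norm (1 - circ r \<theta>) \<ge> cos \<theta>" by (rule norm_1_minus_circ_ge[OF r(1) \<theta>])
  have c: "cos \<theta> > 0" by (rule cos_pos_half_pi[OF \<theta>])
  show ne: "1 - circ r \<theta> \<noteq> 0" using x c by auto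
  have "norm (1 - circ r \<theta>) \<le> 2" using norm_triangle_ineq4[of 1 "circ r \<theta>"] r by simp
  thus "ln (norm (1 - circ r \<theta>)) \<le> ln 2" using ne by (subst ln_le_cancel_iff) auto
  show "ln (norm (1 - circ r \<theta>)) \<ge> ln (cos \<theta>)" using x c ne by (subst ln_le_cancel_iff) auto
qed

lemma set_integrable_majorant: "set_integrable lborel {-pi/2..pi/2} (\<lambda>\<theta>. A + K * (B - ln (cos \<theta>)))"
  by (intro set_integral_add(1) set_integrable_mult_right set_integral_diff(1) set_integrable_const_half_pi set_integrable_ln_cos)

lemma ln_zeta_disc_upper:
  obtains K where "K \<ge> 0" "\<And>r \<theta>. 1/2 \<le> r \<Longrightarrow> r < 1 \<Longrightarrow> \<theta> \<in> {-pi/2<..<pi/2} \<Longrightarrow> zeta_disc b (circ r \<theta>) \<noteq> 0 \<Longrightarrow>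
    ln (norm (zeta_disc b (circ r \<theta>))) \<le> ln 2 + K * ((1 + ln 5) - ln (cos \<theta>))"
proof -
  obtain K where K: "K \<ge> 0" "\<And>s. Re s \<ge> 0 \<Longrightarrow> zeta_P s \<noteq> 0 \<Longrightarrow> ln (norm (zeta_P s)) \<le> K * (1 + ln (1 + norm s))"
    using ln_zeta_P_upper by blast
  have "ln (norm (zeta_disc b (circ r \<theta>))) \<le> ln 2 + K * ((1 + ln 5) - ln (cos \<theta>))"
    if r: "1/2 \<le> r" "r < 1" and \<theta>: "\<theta> \<in> {-pi/2<..<pi/2}" and nz: "zeta_disc b (circ r \<theta>) \<noteq> 0" for r \<theta>
  proof -
    define s where "s = half_plane_map (1 - b) b (circ r \<theta>)"
    have s: "Re s \<ge> 0" using Re_half_plane_map[OF b(1), of "circ r \<theta>" "1 - b"] r b by (simp add: s_def)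
    have P: "zeta_P s \<noteq> 0" using nz by (simp add: zeta_disc_def s_def)
    have "ln (norm (zeta_disc b (circ r \<theta>))) = ln (norm (1 - circ r \<theta>)) + ln (norm (zeta_P s))"
      using P ln_1_minus_circ(3)[OF r \<theta>] by (simp add: zeta_disc_def s_def norm_mult ln_mult)
    also have "ln (norm (zeta_P s)) \<le> K * (1 + ln (1 + norm s))" by (rule K(2)[OF s P])
    also have "\<dots> \<le> K * ((1 + ln 5) - ln (cos \<theta>))"
      using ln_half_plane_map_le[OF r \<theta>] K(1) by (intro mult_left_mono) (auto simp: s_def)
    finally show ?thesis using ln_1_minus_circ(1)[OF r \<theta>] by linarith
  qed
  thus ?thesis using K(1) that by blast
qed

lemma zeta_disc_boundary_AE:
  "AE \<theta> in lborel. \<theta> \<in> {-pi/2<..<pi/2} \<longrightarrow> 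
     ((\<lambda>r. ln (norm (zeta_disc b (circ r \<theta>)))) \<longlongrightarrow> ln (2 * b) + ln (norm (zeta (vline (1 - b) b \<theta>)))) (at_left 1)"
proof -
  have "AE \<theta> in lborel. \<theta> \<in> {-pi/2<..<pi/2} \<longrightarrow> zeta (vline (1 - b) b \<theta>) \<noteq> 0"
    using b by (intro AE_zeta_vline_nonzero) auto
  thus ?thesis
  proof eventually_elim
    case (elim \<theta>)
    show ?case
    proof
      assume \<theta>: "\<theta> \<in> {-pi/2<..<pi/2}"
      hence nz: "zeta (vline (1 - b) b \<theta>) \<noteq> 0" using elim by blast
      have "((\<lambda>r. ln (norm (zeta_disc b (circ r \<theta>)))) \<longlongrightarrow> ln (2 * b * norm (zeta (vline (1 - b) b \<theta>)))) (at_left 1)"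
        using b nz by (intro tendsto_ln zeta_disc_tendsto \<theta>) auto
      thus "((\<lambda>r. ln (norm (zeta_disc b (circ r \<theta>)))) \<longlongrightarrow> ln (2 * b) + ln (norm (zeta (vline (1 - b) b \<theta>)))) (at_left 1)"
        using b nz by (simp add: ln_mult)
    qed
  qed
qed

lemma zeta_disc_integral_eq:
  assumes int: "set_integrable lborel {-pi/2..pi/2} (\<lambda>\<theta>. ln (2 * b) + ln (norm (zeta (vline (1 - b) b \<theta>))))"
  shows "set_integrable lborel {-pi/2..pi/2} (\<lambda>\<theta>. ln (norm (zeta (vline (1 - b) b \<theta>))))"
    and "(LINT \<theta>:{-pi/2..pi/2}|lborel. ln (2 * b) + ln (norm (zeta (vline (1 - b) b \<theta>)))) = 
      pi * ln (2 * b) + (LINT \<theta>:{-pi/2..pi/2}|lborel. ln (norm (zeta (vline (1 - b) b \<theta>))))"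
proof -
  show int': "set_integrable lborel {-pi/2..pi/2} (\<lambda>\<theta>. ln (norm (zeta (vline (1 - b) b \<theta>))))"
    using set_integral_diff(1)[OF int set_integrable_const_half_pi[of "ln (2 * b)"]] by simp
  have "(LINT \<theta>:{-pi/2..pi/2}|lborel. ln (2 * b) + ln (norm (zeta (vline (1 - b) b \<theta>)))) = 
    (LINT \<theta>:{-pi/2..pi/2}|lborel. ln (2 * b)) + (LINT \<theta>:{-pi/2..pi/2}|lborel. ln (norm (zeta (vline (1 - b) b \<theta>))))"
    by (intro set_integral_add(2) set_integrable_const_half_pi int')
  thus "(LINT \<theta>:{-pi/2..pi/2}|lborel. ln (2 * b) + ln (norm (zeta (vline (1 - b) b \<theta>)))) = 
      pi * ln (2 * b) + (LINT \<theta>:{-pi/2..pi/2}|lborel. ln (norm (zeta (vline (1 - b) b \<theta>))))"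
    by (simp add: set_lebesgue_integral_def)
qed

text \<open>As \<open>zeta_disc b 0 = 1\<close>, Jensen's inequality bounds the integral of
  \<open>u\<close> below by 0. Without zeros the reciprocal of \<open>zeta_disc b\<close> is
  holomorphic as well, and it gives the upper bound 0.\<close>

lemma zeta_mean_if_nonzero:
  assumes nz: "\<And>s. Re s > 1/2 \<Longrightarrow> zeta_P s \<noteq> 0"
  shows "set_integrable lborel {-pi/2..pi/2} (\<lambda>\<theta>. ln (norm (zeta (vline (1 - b) b \<theta>))))"
    and "(LINT \<theta>:{-pi/2..pi/2}|lborel. ln (norm (zeta (vline (1 - b) b \<theta>)))) = - pi * ln (2 * b)"
proof -
  define u where "u = (\<lambda>\<theta>. ln (2 * b) + ln (norm (zeta (vline (1 - b) b \<theta>))))"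
  have um: "u \<in> borel_measurable borel" unfolding u_def by measurable
  obtain K where K: "K \<ge> 0" "\<And>r \<theta>. 1/2 \<le> r \<Longrightarrow> r < 1 \<Longrightarrow> \<theta> \<in> {-pi/2<..<pi/2} \<Longrightarrow> zeta_disc b (circ r \<theta>) \<noteq> 0 \<Longrightarrow>
    ln (norm (zeta_disc b (circ r \<theta>))) \<le> ln 2 + K * ((1 + ln 5) - ln (cos \<theta>))"
    using ln_zeta_disc_upper by blast
  have U: "set_integrable lborel {-pi/2..pi/2} u" "pi * ln (norm (zeta_disc b 0)) \<le> (LINT \<theta>:{-pi/2..pi/2}|lborel. u \<theta>)"
    by (rule ln_norm_boundary_integral[OF holomorphic_zeta_disc _ set_integrable_majorant, where ?r0.0 = "1/2"];
        use K(2) zeta_disc_boundary_AE um in \<open>auto simp: zeta_disc_0 u_def\<close>)+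
  \<comment> \<open>Here 1/2 - b takes the place of \<alpha>, so that 1/2 + (1/2 - b) = 1 - b is the
    abscissa of the line.\<close>
  obtain K' where K': "K' \<ge> 0" "\<And>s. Re s \<ge> 1/2 + (1/2 - b) \<Longrightarrow> ln (norm (zeta_P s)) \<ge> - (K' * (1 + ln (1 + norm s)))"
    using ln_zeta_P_lower[OF nz, of "1/2 - b"] b by auto
  have Gnz: "zeta_disc b z \<noteq> 0" if "norm z < 1" for z
    using Re_half_plane_map[OF b(1) that, of "1 - b"] nz[of "half_plane_map (1 - b) b z"] b that by (auto simp: zeta_disc_def)
  have "pi * ln (norm (1 / zeta_disc b 0)) \<le> (LINT \<theta>:{-pi/2..pi/2}|lborel. - u \<theta>)"
  proof (rule ln_norm_boundary_integral(2)[OF _ _ set_integrable_majorant, where ?r0.0 = "1/2"])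
    show "(\<lambda>z. 1 / zeta_disc b z) holomorphic_on ball 0 1" 
      by (intro holomorphic_intros holomorphic_zeta_disc) (use Gnz in auto)
    show "ln (norm (1 / zeta_disc b (circ r \<theta>))) \<le> 0 + (1 + K') * ((1 + ln 5) - ln (cos \<theta>))"
      if r: "1/2 \<le> r" "r < 1" and \<theta>: "\<theta> \<in> {-pi/2<..<pi/2}" for r \<theta>
    proof -
      define s where "s = half_plane_map (1 - b) b (circ r \<theta>)"
      have s: "Re s \<ge> 1/2 + (1/2 - b)" using Re_half_plane_map[OF b(1), of "circ r \<theta>" "1 - b"] r b by (simp add: s_def)
      have P: "zeta_P s \<noteq> 0" using s b by (intro nz) auto
      have "ln (norm (1 / zeta_disc b (circ r \<theta>))) = - ln (norm (1 - circ r \<theta>)) - ln (norm (zeta_P s))"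
        using P ln_1_minus_circ(3)[OF r \<theta>] by (simp add: zeta_disc_def s_def norm_mult norm_divide ln_mult ln_div)
      also have "\<dots> \<le> - ln (cos \<theta>) + K' * (1 + ln (1 + norm s))"
        using K'(2)[OF s] ln_1_minus_circ(2)[OF r \<theta>] by linarith
      also have "K' * (1 + ln (1 + norm s)) \<le> K' * ((1 + ln 5) - ln (cos \<theta>))"
        using ln_half_plane_map_le[OF r \<theta>] K'(1) by (intro mult_left_mono) (auto simp: s_def)
      finally have "ln (norm (1 / zeta_disc b (circ r \<theta>))) \<le> - ln (cos \<theta>) + K' * ((1 + ln 5) - ln (cos \<theta>))" by simp
      \<comment> \<open>Adding 1 + ln 5 > 0 gives the part from ln |1 - z| the same shape as the
        part from \<open>zeta_P\<close>; this is the extra 1 in the coefficient 1 + K'.\<close>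
      also have "- ln (cos \<theta>) + K' * ((1 + ln 5) - ln (cos \<theta>)) \<le> ((1 + ln 5) - ln (cos \<theta>)) + K' * ((1 + ln 5) - ln (cos \<theta>))"
        by (rule add_right_mono) simp
      finally show ?thesis by (simp only: distrib_right mult_1 add_0)
    qed
    show "AE \<theta> in lborel. \<theta> \<in> {-pi/2<..<pi/2} \<longrightarrow> ((\<lambda>r. ln (norm (1 / zeta_disc b (circ r \<theta>)))) \<longlongrightarrow> - u \<theta>) (at_left 1)"
      using zeta_disc_boundary_AE
    proof eventually_elim
      case (elim \<theta>)
      show ?case
      proof
        assume "\<theta> \<in> {-pi/2<..<pi/2}"
        with elim have "((\<lambda>r. - ln (norm (zeta_disc b (circ r \<theta>)))) \<longlongrightarrow> - u \<theta>) (at_left 1)"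
          unfolding u_def by (intro tendsto_minus) blast
        moreover have "ln (norm (1 / w)) = - ln (norm w)" for w :: complex by (simp add: norm_divide ln_div)
        ultimately show "((\<lambda>r. ln (norm (1 / zeta_disc b (circ r \<theta>)))) \<longlongrightarrow> - u \<theta>) (at_left 1)" by (simp only:)
      qed
    qed
  qed (use um in \<open>auto simp: zeta_disc_0\<close>)
  hence "(LINT \<theta>:{-pi/2..pi/2}|lborel. u \<theta>) \<le> 0"
    by (simp add: zeta_disc_0 set_lebesgue_integral_def)
  with U have "(LINT \<theta>:{-pi/2..pi/2}|lborel. u \<theta>) = 0" by (simp add: zeta_disc_0)
  thus "set_integrable lborel {-pi/2..pi/2} (\<lambda>\<theta>. ln (norm (zeta (vline (1 - b) b \<theta>))))"
    "(LINT \<theta>:{-pi/2..pi/2}|lborel. ln (norm (zeta (vline (1 - b) b \<theta>)))) = - pi * ln (2 * b)"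
    using zeta_disc_integral_eq[OF U(1)[unfolded u_def]] by (auto simp: u_def)
qed

text \<open>Dividing \<open>zeta_disc b\<close> by the Blaschke factor of the zero makes the value at the origin larger
  than 1 in modulus without changing the modulus on the circle.\<close>

lemma zeta_mean_if_zero:
  assumes \<rho>: "zeta_P \<rho> = 0" "Re \<rho> > 1 - b"
  shows "set_integrable lborel {-pi/2..pi/2} (\<lambda>\<theta>. ln (norm (zeta (vline (1 - b) b \<theta>))))"
    and "(LINT \<theta>:{-pi/2..pi/2}|lborel. ln (norm (zeta (vline (1 - b) b \<theta>)))) > - pi * ln (2 * b)"
proof -
  define u where "u = (\<lambda>\<theta>. ln (2 * b) + ln (norm (zeta (vline (1 - b) b \<theta>))))"
  have um: "u \<in> borel_measurable borel" unfolding u_def by measurable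
  \<comment> \<open>\<open>q\<close> and \<open>a\<close> invert the Cayley map: \<open>a\<close> is
    the point of the disc that is sent to \<open>\<rho>\<close>.\<close>
  define q where "q = (\<rho> - of_real (1 - b)) / of_real b"
  have q: "Re q > 0" using \<rho>(2) b by (simp add: q_def)
  define a where "a = (q - 1) / (q + 1)"
  have q1: "q + 1 \<noteq> 0" using q by (auto simp: complex_eq_iff)
  have a1: "1 - a = 2 / (q + 1)" using q1 by (simp add: a_def field_simps)
  have a2: "1 + a = 2 * q / (q + 1)" using q1 by (simp add: a_def field_simps)
  have "half_plane_map (1 - b) b a = of_real (1 - b) + of_real b * q"
    unfolding half_plane_map_def a1 a2 using q1 by simp
  also have "\<dots> = \<rho>" using b by (simp add: q_def)
  finally have \<rho>_eq: "half_plane_map (1 - b) b a = \<rho>" .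
  have na: "norm a < 1"
  proof -
    have "(norm (q - 1))\<^sup>2 < (norm (q + 1))\<^sup>2" unfolding cmod_power2 using q by (simp add: power2_eq_square algebra_simps)
    hence "norm (q - 1) < norm (q + 1)" by (rule power2_less_imp_less) auto
    thus ?thesis using q1 by (simp add: a_def norm_divide)
  qed
  have a0: "a \<noteq> 0" using \<rho>_eq \<rho>(1) zeta_P_1 by auto
  have Ga: "zeta_disc b a = 0" by (simp add: zeta_disc_def \<rho>_eq \<rho>)
  have "\<exists>w\<in>ball 0 1. zeta_disc b w \<noteq> 0" by (rule bexI[of _ 0]) (auto simp: zeta_disc_0)
  moreover have "a \<in> ball 0 1" using na by simp
  ultimately obtain n h where h: "h holomorphic_on ball 0 1" "h a \<noteq> 0" "\<And>w. w \<in> ball 0 1 \<Longrightarrow> zeta_disc b w = h w * (w - a) ^ n"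
    using holomorphic_factor_out_zero[OF holomorphic_zeta_disc open_ball connected_ball] by metis
  have n: "n > 0" using h(2) h(3)[of a] Ga na by (cases n) auto
  \<comment> \<open>The factor (z - a)^n becomes (1 - cnj a z)^n, which has the same modulus on the
    unit circle, whereas the modulus at the origin rises from 1 to 1 / |a|^n > 1.\<close>
  define g where "g = (\<lambda>z. h z * (1 - cnj a * z) ^ n)"
  have g_hol: "g holomorphic_on ball 0 1" unfolding g_def by (intro holomorphic_intros h)
  have ng: "norm (g z) = norm (zeta_disc b z) * (norm (1 - cnj a * z) / norm (z - a)) ^ n" if "norm z < 1" "z \<noteq> a" for z
    using h(3)[of z] that by (simp add: g_def norm_mult norm_power power_divide)
  have g0: "norm (g 0) = 1 / norm a ^ n"
    using ng[of 0] a0 by (simp add: zeta_disc_0 power_divide)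
  \<comment> \<open>Midway between 1 and the larger of 1/2 and |a|: radii from \<open>r0\<close> on
    keep z - a bounded away from 0, so the quotient of the two factors is bounded and
    \<open>L\<close> bounds its logarithm.\<close>
  define r0 where "r0 = (1 + max (1/2) (norm a)) / 2"
  have r0: "1/2 \<le> r0" "r0 < 1" "norm a < r0" using na by (auto simp: r0_def max_def field_simps)
  define L where "L = ln (2 / (r0 - norm a))"
  obtain K where K: "K \<ge> 0" "\<And>r \<theta>. 1/2 \<le> r \<Longrightarrow> r < 1 \<Longrightarrow> \<theta> \<in> {-pi/2<..<pi/2} \<Longrightarrow> zeta_disc b (circ r \<theta>) \<noteq> 0 \<Longrightarrow>
    ln (norm (zeta_disc b (circ r \<theta>))) \<le> ln 2 + K * ((1 + ln 5) - ln (cos \<theta>))"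
    using ln_zeta_disc_upper by blast
  have bound: "ln (norm (g (circ r \<theta>))) \<le> (ln 2 + n * L) + K * ((1 + ln 5) - ln (cos \<theta>))"
    if r: "r0 \<le> r" "r < 1" and \<theta>: "\<theta> \<in> {-pi/2<..<pi/2}" and nz: "g (circ r \<theta>) \<noteq> 0" for r \<theta>
  proof -
    define z where "z = circ r \<theta>"
    have z: "norm z = r" using r r0 by (simp add: z_def)
    have za: "norm (z - a) \<ge> r0 - norm a" using norm_triangle_ineq2[of z a] z r by simp
    have z_ne: "z \<noteq> a" using z r r0 by auto
    have nz': "zeta_disc b z \<noteq> 0" "1 - cnj a * z \<noteq> 0"
      using nz ng[of z] z z_ne r n by (auto simp: z_def[symmetric] g_def)
    have "norm (1 - cnj a * z) \<le> 2"
      using norm_triangle_ineq4[of 1 "cnj a * z"] mult_mono[of "norm a" 1 "norm z" 1] na z r r0 by (simp add: norm_mult)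
    hence "norm (1 - cnj a * z) / norm (z - a) \<le> 2 / (r0 - norm a)"
      using za r0 by (intro frac_le) auto
    hence "ln (norm (1 - cnj a * z) / norm (z - a)) \<le> L"
      unfolding L_def using nz' z_ne r0 by (subst ln_le_cancel_iff) auto
    hence "n * ln (norm (1 - cnj a * z) / norm (z - a)) \<le> n * L" by (intro mult_left_mono) auto
    moreover have "ln (norm (g z)) = ln (norm (zeta_disc b z)) + n * ln (norm (1 - cnj a * z) / norm (z - a))"
      using ng[of z] z z_ne r nz' by (simp add: ln_mult ln_realpow)
    moreover have "ln (norm (zeta_disc b z)) \<le> ln 2 + K * ((1 + ln 5) - ln (cos \<theta>))"
      using K(2)[of r \<theta>] r r0 \<theta> nz' by (simp add: z_def)
    ultimately show ?thesis unfolding z_def by linarith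
  qed
  have lim: "AE \<theta> in lborel. \<theta> \<in> {-pi/2<..<pi/2} \<longrightarrow> ((\<lambda>r. ln (norm (g (circ r \<theta>)))) \<longlongrightarrow> u \<theta>) (at_left 1)"
  proof -
    have "AE \<theta> in lborel. \<theta> \<in> {-pi/2<..<pi/2} \<longrightarrow> zeta (vline (1 - b) b \<theta>) \<noteq> 0"
      using b by (intro AE_zeta_vline_nonzero) auto
    thus ?thesis
    proof eventually_elim
      case (elim \<theta>)
      show ?case
      proof
        assume \<theta>: "\<theta> \<in> {-pi/2<..<pi/2}"
        hence nz: "zeta (vline (1 - b) b \<theta>) \<noteq> 0" using elim by blast
        define w where "w = circ 1 \<theta>"
        have w: "norm w = 1" by (simp add: w_def)
        hence wa: "w - a \<noteq> 0" using na by auto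
        have "1 - cnj a * w = w * cnj (w - a)"
          using complex_norm_square[of w] w by (simp add: algebra_simps)
        hence "norm (1 - cnj a * w) = norm (w - a)" using w by (simp add: norm_mult del: complex_cnj_diff)
        hence 1: "norm (1 - cnj a * w) / norm (w - a) = 1" using wa by simp
        have "((\<lambda>r. norm (zeta_disc b (circ r \<theta>)) * (norm (1 - cnj a * circ r \<theta>) / norm (circ r \<theta> - a)) ^ n) \<longlongrightarrow> 
          2 * b * norm (zeta (vline (1 - b) b \<theta>)) * (norm (1 - cnj a * w) / norm (w - a)) ^ n) (at_left 1)"
          unfolding w_def using wa[unfolded w_def]
          by (intro tendsto_intros zeta_disc_tendsto \<theta> tendsto_circ_at_left) auto
        moreover have "eventually (\<lambda>r. r \<in> {r0<..<1}) (at_left 1)"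
          using r0 by (intro eventually_at_leftI[of r0]) auto
        hence "eventually (\<lambda>r. norm (zeta_disc b (circ r \<theta>)) * (norm (1 - cnj a * circ r \<theta>) / norm (circ r \<theta> - a)) ^ n = norm (g (circ r \<theta>))) (at_left 1)"
        proof eventually_elim
          case (elim r)
          hence "norm (circ r \<theta>) = r" using r0 by simp
          thus ?case using elim r0 by (intro ng[symmetric]) auto
        qed
        ultimately have "((\<lambda>r. norm (g (circ r \<theta>))) \<longlongrightarrow> 2 * b * norm (zeta (vline (1 - b) b \<theta>))) (at_left 1)"
          unfolding 1 by (simp add: tendsto_cong)
        hence "((\<lambda>r. ln (norm (g (circ r \<theta>)))) \<longlongrightarrow> ln (2 * b * norm (zeta (vline (1 - b) b \<theta>)))) (at_left 1)"
          using b nz by (intro tendsto_ln) auto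
        thus "((\<lambda>r. ln (norm (g (circ r \<theta>)))) \<longlongrightarrow> u \<theta>) (at_left 1)"
          using b nz by (simp add: u_def ln_mult)
      qed
    qed
  qed
  have g0nz: "g 0 \<noteq> 0" using g0 a0 by auto
  have U: "set_integrable lborel {-pi/2..pi/2} u" "pi * ln (norm (g 0)) \<le> (LINT \<theta>:{-pi/2..pi/2}|lborel. u \<theta>)"
    by (rule ln_norm_boundary_integral[OF g_hol g0nz set_integrable_majorant _ _ bound um lim]; use r0 in force)+
  have "norm a ^ n < 1" using na n by (simp add: power_less_one_iff)
  hence "norm (g 0) > 1" unfolding g0 using a0 by simp
  hence "pi * ln (norm (g 0)) > 0" by (intro mult_pos_pos ln_gt_zero pi_gt_zero)
  with U have pos: "(LINT \<theta>:{-pi/2..pi/2}|lborel. u \<theta>) > 0" by linarith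
  show "set_integrable lborel {-pi/2..pi/2} (\<lambda>\<theta>. ln (norm (zeta (vline (1 - b) b \<theta>))))"
    "(LINT \<theta>:{-pi/2..pi/2}|lborel. ln (norm (zeta (vline (1 - b) b \<theta>)))) > - pi * ln (2 * b)"
    using zeta_disc_integral_eq[OF U(1)[unfolded u_def]] pos by (auto simp: u_def)
qed

end

section \<open>The hidden symmetry\<close>

definition zeta_real :: "real \<Rightarrow> real" where
  "zeta_real \<sigma> = (\<Sum>n. real (Suc n) powr - \<sigma>)"

lemma npow_of_real: "npow (of_real x) n = of_real (real n powr - x)"
  using of_nat_powr_of_real[of n x] by (simp add: npow_def powr_minus_divide)

lemma zeta_of_real:
  assumes "\<sigma> > 1" shows "zeta (of_real \<sigma>) = of_real (zeta_real \<sigma>)"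
proof -
  have "(\<lambda>n. npow (of_real \<sigma>) (Suc n)) sums zeta (of_real \<sigma>)"
    using zeta_sums[of "of_real \<sigma>"] assms by (simp add: npow_def)
  moreover have "(\<lambda>n. npow (of_real \<sigma>) (Suc n)) sums of_real (zeta_real \<sigma>)"
    unfolding npow_of_real zeta_real_def using summable_Suc_powr[of "-\<sigma>"] assms
    by (simp add: sums_of_real_iff summable_sums del: of_nat_Suc)
  ultimately show ?thesis by (rule sums_unique2)
qed

lemma zeta_real_gt_1:
  assumes "\<sigma> > 1" shows "zeta_real \<sigma> > 1"
proof -
  have "(\<Sum>n\<in>{0,1}. real (Suc n) powr - \<sigma>) \<le> zeta_real \<sigma>"
    unfolding zeta_real_def using assms by (intro sum_le_suminf summable_Suc_powr) auto
  hence "1 + 2 powr - \<sigma> \<le> zeta_real \<sigma>" by simp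
  moreover have "2 powr - \<sigma> > 0" by simp
  ultimately show ?thesis by linarith
qed

text \<open>Comparison of the series with the integral of \<open>t powr - \<sigma>\<close> over [1,
  infinity), done by the mean value theorem and telescoping.\<close>

lemma zeta_real_ge:
  assumes \<sigma>: "\<sigma> > 1" shows "zeta_real \<sigma> \<ge> 1 / (\<sigma> - 1)"
proof -
  define F where "F = (\<lambda>t::real. t powr (1 - \<sigma>) / (1 - \<sigma>))"
  have step: "F (real (Suc n) + 1) - F (real (Suc n)) \<le> real (Suc n) powr - \<sigma>" for n
  proof -
    have "\<exists>z. real (Suc n) < z \<and> z < real (Suc n) + 1 \<and> F (real (Suc n) + 1) - F (real (Suc n)) = (real (Suc n) + 1 - real (Suc n)) * (z powr - \<sigma>)"
    proof (rule MVT2)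
      fix x assume x: "real (Suc n) \<le> x"
      hence "x > 0" by (simp add: less_le_trans[of 0 "real (Suc n)" x])
      thus "(F has_real_derivative x powr - \<sigma>) (at x)"
        unfolding F_def using \<sigma> DERIV_cdivide[OF has_real_derivative_powr[of x "1 - \<sigma>"], of "1 - \<sigma>"] by simp
    qed simp
    then obtain z where z: "real (Suc n) < z" "F (real (Suc n) + 1) - F (real (Suc n)) = z powr - \<sigma>" by auto
    have "z powr - \<sigma> \<le> real (Suc n) powr - \<sigma>" using z \<sigma> by (intro powr_mono2') auto
    thus ?thesis using z by simp
  qed
  have F0: "(\<lambda>n. F (real (Suc n))) \<longlonglongrightarrow> 0"
  proof -
    have "(\<lambda>n. real (Suc n) powr (1 - \<sigma>)) \<longlonglongrightarrow> 0" using \<sigma> by real_asymp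
    thus ?thesis unfolding F_def by (rule tendsto_divide_zero)
  qed
  have "(\<lambda>n. F (real (Suc (Suc n))) - F (real (Suc n))) sums (0 - F (real (Suc 0)))"
    by (rule telescope_sums[OF F0])
  hence "(\<lambda>n. F (real (Suc n) + 1) - F (real (Suc n))) sums (1 / (\<sigma> - 1))"
    using \<sigma> minus_divide_right[of 1 "1 - \<sigma>"] by (simp add: F_def add_ac)
  moreover have "(\<lambda>n. real (Suc n) powr - \<sigma>) sums zeta_real \<sigma>"
    unfolding zeta_real_def using \<sigma> by (intro summable_sums summable_Suc_powr) auto
  ultimately show ?thesis by (rule sums_le[OF step])
qed

text \<open>At 2 + k every term after the first is at most 2^(-k) times its value at 2. This
  provides related pairs with arbitrarily small \<alpha>.\<close>

lemma zeta_real_close_to_1: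
  assumes \<epsilon>: "\<epsilon> > 0" obtains \<sigma> where "\<sigma> > 1" "zeta_real \<sigma> < 1 + \<epsilon>"
proof -
  define S where "S = (\<Sum>n. real (Suc (Suc n)) powr - 2)"
  have s2: "summable (\<lambda>n. real (Suc (Suc n)) powr - 2)"
    using summable_zeta_2 by (subst (asm) summable_Suc_iff[symmetric])
  obtain k :: nat where k: "S * (1/2) ^ k < \<epsilon>"
  proof -
    have "(\<lambda>k. S * (1/2) ^ k) \<longlonglongrightarrow> S * 0" by (intro tendsto_intros) auto
    hence "eventually (\<lambda>k. S * (1/2) ^ k < \<epsilon>) sequentially" using \<epsilon> by (intro order_tendstoD(2)) auto
    thus ?thesis using that by (auto simp: eventually_sequentially)
  qed
  have sm: "summable (\<lambda>n. real (Suc n) powr - (2 + real k))" by (intro summable_Suc_powr) auto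
  hence sm': "summable (\<lambda>n. real (Suc (Suc n)) powr - (2 + real k))" by (subst summable_Suc_iff)
  have "zeta_real (2 + real k) = 1 + (\<Sum>n. real (Suc (Suc n)) powr - (2 + real k))"
    unfolding zeta_real_def using suminf_split_head[OF sm] by simp
  also have "(\<Sum>n. real (Suc (Suc n)) powr - (2 + real k)) \<le> (\<Sum>n. real (Suc (Suc n)) powr - 2 * (1/2) ^ k)"
  proof (intro suminf_le sm' summable_mult2 s2)
    fix n
    have "real (Suc (Suc n)) powr - (2 + real k) = real (Suc (Suc n)) powr - 2 * real (Suc (Suc n)) powr - real k"
      by (simp flip: powr_add)
    also have "real (Suc (Suc n)) powr - real k \<le> 2 powr - real k" by (intro powr_mono2') auto
    also have "2 powr - real k = (1/2) ^ k" by (simp add: powr_minus powr_realpow power_one_over inverse_eq_divide)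
    finally show "real (Suc (Suc n)) powr - (2 + real k) \<le> real (Suc (Suc n)) powr - 2 * (1/2) ^ k"
      by (simp add: mult_left_mono)
  qed
  also have "\<dots> = S * (1/2) ^ k" unfolding S_def by (rule suminf_mult2[symmetric, OF s2])
  finally show ?thesis using k that[of "2 + real k"] by simp
qed

lemma zeta_real_prodinf:
  assumes \<sigma>: "\<sigma> > 1"
  shows "(\<Prod>p. if prime p then 1 - 1 / real p powr \<sigma> else 1) = 1 / zeta_real \<sigma>"
proof -
  define f where "f = (\<lambda>p. if prime p then 1 - 1 / real p powr \<sigma> else 1)"
  have f: "(if prime p then 1 - npow (of_real \<sigma>) p else 1) = complex_of_real (f p)" for p
    by (simp add: f_def npow_of_real powr_minus_divide)
  have "(\<lambda>N. \<Prod>p<N. if prime p then 1 - npow (of_real \<sigma>) p else 1) \<longlonglongrightarrow> 1 / zeta (of_real \<sigma>)"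
    using \<sigma> by (intro zeta_euler_product) auto
  hence "(\<lambda>N. complex_of_real (\<Prod>p<N. f p)) \<longlonglongrightarrow> of_real (1 / zeta_real \<sigma>)"
    unfolding f by (simp add: zeta_of_real[OF \<sigma>])
  hence "(\<lambda>N. \<Prod>p<N. f p) \<longlonglongrightarrow> 1 / zeta_real \<sigma>" by (simp only: tendsto_of_real_iff)
  \<comment> \<open>Infinite products are defined through partial products over
    \<open>{..N}\<close>, hence the shift, and need a nonzero limit, which holds because 1 / zeta is
    nonzero here.\<close>
  hence "(\<lambda>N. \<Prod>p<Suc N. f p) \<longlonglongrightarrow> 1 / zeta_real \<sigma>" by (rule LIMSEQ_Suc)
  hence "raw_has_prod f 0 (1 / zeta_real \<sigma>)"
    using zeta_real_gt_1[OF \<sigma>] by (simp add: raw_has_prod_def lessThan_Suc_atMost)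
  hence "f has_prod (1 / zeta_real \<sigma>)" by (simp add: has_prod_def)
  thus ?thesis unfolding f_def by (rule has_prod_unique[symmetric])
qed

lemma zeta_real_moebius:
  assumes \<sigma>: "\<sigma> > 1"
  shows "(\<Sum>n. real_of_int (moebius_mu (Suc n)) / real (Suc n) powr \<sigma>) = 1 / zeta_real \<sigma>"
proof -
  have "(\<lambda>n. of_int (moebius_mu (Suc n)) * npow (of_real \<sigma>) (Suc n)) sums (1 / zeta (of_real \<sigma>))"
    using \<sigma> by (intro zeta_moebius_sums) auto
  hence "(\<lambda>n. complex_of_real (real_of_int (moebius_mu (Suc n)) / real (Suc n) powr \<sigma>)) sums of_real (1 / zeta_real \<sigma>)"
    by (simp add: npow_of_real powr_minus_divide zeta_of_real[OF \<sigma>] del: of_nat_Suc)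
  thus ?thesis by (simp only: sums_of_real_iff sums_unique[symmetric])
qed

text \<open>For 2 \<alpha>' > 1 the Euler product and the Moebius series both equal 1 / zeta, so the
  three relations collapse to one; zeta > 1 then forces \<alpha> into (0, 1/2).\<close>

lemma related_pair_iff:
  "related_pair \<alpha> \<alpha>' \<longleftrightarrow> \<alpha>' > 1/2 \<and> \<alpha> = 1/2 * (1 - 1 / zeta_real (2 * \<alpha>'))"
proof (cases "\<alpha>' > 1/2")
  case True
  hence \<sigma>: "2 * \<alpha>' > 1" by simp
  have "complex_of_real \<alpha> = 1/2 * (1 - 1 / zeta (complex_of_real (2 * \<alpha>'))) \<longleftrightarrow> \<alpha> = 1/2 * (1 - 1 / zeta_real (2 * \<alpha>'))"
  proof -
    have "1/2 * (1 - 1 / zeta (complex_of_real (2 * \<alpha>'))) = complex_of_real (1/2 * (1 - 1 / zeta_real (2 * \<alpha>')))"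
      unfolding zeta_of_real[OF \<sigma>] by simp
    thus ?thesis by (simp only: of_real_eq_iff)
  qed
  moreover have "0 < 1/2 * (1 - 1 / zeta_real (2 * \<alpha>'))" "1/2 * (1 - 1 / zeta_real (2 * \<alpha>')) < 1/2"
    using zeta_real_gt_1[OF \<sigma>] by (auto simp: field_simps)
  ultimately show ?thesis
    unfolding related_pair_def zeta_real_prodinf[OF \<sigma>] zeta_real_moebius[OF \<sigma>] using True by blast
qed (simp add: related_pair_def)

lemma phi_in_eq:
  assumes \<alpha>: "0 < \<alpha>" "\<alpha> < 1/2"
    and int: "set_integrable lborel {-pi/2..pi/2} (\<lambda>\<theta>. ln (norm (zeta (vline (1 - (1/2 - \<alpha>)) (1/2 - \<alpha>) \<theta>))))"
  shows "phi_in \<alpha> = 1 / pi * (LINT \<theta>:{-pi/2..pi/2}|lborel. ln (norm (zeta (vline (1 - (1/2 - \<alpha>)) (1/2 - \<alpha>) \<theta>))))"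
proof -
  have "1 / 2 + complex_of_real \<alpha> + \<i> * (1 / 2 - complex_of_real \<alpha>) * complex_of_real (tan \<theta>) = vline (1 - (1/2 - \<alpha>)) (1/2 - \<alpha>) \<theta>" for \<theta>
    by (simp add: vline_def algebra_simps)
  thus ?thesis unfolding phi_in_def using line_average[OF _ refl int] \<alpha> by simp
qed

text \<open>This holds unconditionally. The image of the origin is c + b = 2 \<alpha>', and the
  relation between \<alpha> and \<alpha>' says that zeta takes the value 1 / (1 - 2 \<alpha>)
  there.\<close>

lemma phi_out_eq:
  assumes R: "related_pair \<alpha> \<alpha>'"
  shows "phi_out \<alpha> \<alpha>' = ln (1 / (1 - 2 * \<alpha>))" "Re (zeta (complex_of_real (2 * \<alpha>'))) = 1 / (1 - 2 * \<alpha>)"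
proof -
  have \<alpha>: "0 < \<alpha>" "\<alpha> < 1/2" using R by (auto simp: related_pair_def)
  have \<alpha>': "\<alpha>' > 1/2" "\<alpha> = 1/2 * (1 - 1 / zeta_real (2 * \<alpha>'))" using R unfolding related_pair_iff by auto
  have \<sigma>: "2 * \<alpha>' > 1" using \<alpha>' by simp
  define Z where "Z = zeta_real (2 * \<alpha>')"
  have Z: "Z > 1" unfolding Z_def by (rule zeta_real_gt_1[OF \<sigma>])
  have Z': "1 - 2 * \<alpha> = 1 / Z" using \<alpha>'(2) by (simp add: Z_def)
  show "Re (zeta (complex_of_real (2 * \<alpha>'))) = 1 / (1 - 2 * \<alpha>)"
    unfolding zeta_of_real[OF \<sigma>] Z' by (simp add: Z_def)
  define c where "c = 2 * \<alpha>' + \<alpha> - 1/2"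
  define b where "b = 1/2 - \<alpha>"
  have b: "b > 0" using \<alpha> by (simp add: b_def)
  \<comment> \<open>As c = 2 \<alpha>' - 1 / (2 Z), this bound gives c - 1 >= (2 \<alpha>' - 1) / 2
    > 0.\<close>
  have "1 / Z \<le> 2 * \<alpha>' - 1" using zeta_real_ge[OF \<sigma>] Z \<sigma> by (simp add: Z_def field_simps)
  hence c: "c > 1" using Z' \<sigma> by (simp add: c_def)
  have eq: "2 * complex_of_real \<alpha>' + complex_of_real \<alpha> - 1 / 2 + \<i> * (1 / 2 - complex_of_real \<alpha>) * complex_of_real (tan \<theta>) = vline c b \<theta>" for \<theta>
    by (simp add: vline_def c_def b_def algebra_simps)
  have "phi_out \<alpha> \<alpha>' = 1 / pi * (LINT \<theta>:{-pi/2..pi/2}|lborel. ln (norm (zeta (vline c b \<theta>))))"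
    unfolding phi_out_def eq using line_average[OF _ refl zeta_mean_right_half_plane(1)[OF c b]] c by simp
  also have "\<dots> = ln (norm (zeta (of_real (c + b))))"
    unfolding zeta_mean_right_half_plane(2)[OF c b] by simp
  also have "c + b = 2 * \<alpha>'" by (simp add: c_def b_def)
  also have "norm (zeta (of_real (2 * \<alpha>'))) = 1 / (1 - 2 * \<alpha>)"
    unfolding zeta_of_real[OF \<sigma>] Z' using Z by (simp add: Z_def)
  finally show "phi_out \<alpha> \<alpha>' = ln (1 / (1 - 2 * \<alpha>))" .
qed

text \<open>The hypothesis covers only Re s < 1; the line Re s = 1 and the half plane beyond it come
  from the Mertens argument and the Euler product.\<close>

lemma zeta_P_nonzero_if_RH:
  assumes RH: "riemann_hypothesis" and s: "Re s > 1/2" shows "zeta_P s \<noteq> 0"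
proof
  assume 0: "zeta_P s = 0"
  hence "zeta s = 0" using s by (simp add: zeta_eq_P)
  hence "Re s \<ge> 1" using RH s unfolding riemann_hypothesis_def by force
  moreover have "Re s \<noteq> 1" using zeta_P_nonzero_1_line 0 by blast
  moreover have "\<not> Re s > 1" using zeta_nonzero \<open>zeta s = 0\<close> by blast
  ultimately show False by linarith
qed

lemma phi_in_if_RH:
  assumes RH: "riemann_hypothesis" and \<alpha>: "0 < \<alpha>" "\<alpha> < 1/2"
  shows "phi_in \<alpha> = ln (1 / (1 - 2 * \<alpha>))"
proof -
  have b: "0 < 1/2 - \<alpha>" "1/2 - \<alpha> < 1/2" using \<alpha> by auto
  have nz: "\<And>s. Re s > 1/2 \<Longrightarrow> zeta_P s \<noteq> 0" by (rule zeta_P_nonzero_if_RH[OF RH])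
  have "phi_in \<alpha> = 1 / pi * (- pi * ln (2 * (1/2 - \<alpha>)))"
    using phi_in_eq[OF \<alpha> zeta_mean_if_nonzero(1)[OF b nz]] zeta_mean_if_nonzero(2)[OF b nz] by (simp only:)
  also have "\<dots> = - ln (1 - 2 * \<alpha>)" by (simp add: algebra_simps)
  finally have "phi_in \<alpha> = - ln (1 - 2 * \<alpha>)" .
  thus ?thesis using \<alpha> by (simp add: ln_div)
qed

lemma zero_right_of_critical_line:
  assumes "\<not> riemann_hypothesis"
  obtains \<rho> where "zeta_P \<rho> = 0" "Re \<rho> > 1/2"
proof -
  obtain s where s: "zeta s = 0" "0 < Re s" "Re s < 1" "Re s \<noteq> 1/2"
    using assms unfolding riemann_hypothesis_def by blast
  have "s \<noteq> 1" using s by auto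
  hence 0: "zeta_P s = 0" using s by (simp add: zeta_eq_P)
  show ?thesis
  proof (cases "Re s > 1/2")
    case False
    thus ?thesis using that[of "1 - s"] zeta_P_reflect_zero[OF s(2,3) 0] s by simp
  qed (use 0 that in blast)
qed

text \<open>A zero \<open>\<rho>\<close> to the right of the critical line is visible to
  \<open>phi_in \<alpha>\<close> once 1/2 + \<alpha> < Re \<rho>. One related pair with such an
  \<alpha> makes \<open>phi_in\<close> strictly larger than \<open>phi_out\<close>.\<close>

lemma hidden_symmetry_imp_RH:
  assumes HS: "hidden_symmetry" shows "riemann_hypothesis"
proof (rule ccontr)
  assume "\<not> riemann_hypothesis"
  then obtain \<rho> where \<rho>: "zeta_P \<rho> = 0" "Re \<rho> > 1/2" by (rule zero_right_of_critical_line)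
  \<comment> \<open>By 2 \<alpha> = 1 - 1 / Z <= Z - 1 with Z = \<open>zeta_real \<sigma>\<close>,
    this choice gives 2 \<alpha> < Re \<rho> - 1/2, more than is required.\<close>
  obtain \<sigma> where \<sigma>: "\<sigma> > 1" "zeta_real \<sigma> < 1 + (Re \<rho> - 1/2)"
    using zeta_real_close_to_1[of "Re \<rho> - 1/2"] \<rho>(2) by auto
  define \<alpha> where "\<alpha> = 1/2 * (1 - 1 / zeta_real \<sigma>)"
  have R: "related_pair \<alpha> (\<sigma> / 2)" unfolding related_pair_iff \<alpha>_def using \<sigma> by simp
  have \<alpha>: "0 < \<alpha>" "\<alpha> < 1/2" using R by (auto simp: related_pair_def)
  have Z: "zeta_real \<sigma> > 1" by (rule zeta_real_gt_1[OF \<sigma>(1)])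
  have "1 - 1 / zeta_real \<sigma> \<le> zeta_real \<sigma> - 1"
  proof -
    have "1 - 1 / zeta_real \<sigma> = (zeta_real \<sigma> - 1) / zeta_real \<sigma>" using Z by (simp add: field_simps)
    also have "\<dots> \<le> (zeta_real \<sigma> - 1) / 1" using Z by (intro divide_left_mono) auto
    finally show ?thesis by simp
  qed
  moreover have "2 * \<alpha> = 1 - 1 / zeta_real \<sigma>" by (simp add: \<alpha>_def)
  ultimately have \<rho>': "Re \<rho> > 1 - (1/2 - \<alpha>)" using \<sigma>(2) \<rho>(2) by linarith
  have b: "0 < 1/2 - \<alpha>" "1/2 - \<alpha> < 1/2" using \<alpha> by auto
  note M = zeta_mean_if_zero[OF b \<rho>(1) \<rho>']
  have "phi_in \<alpha> > 1 / pi * (- pi * ln (2 * (1/2 - \<alpha>)))"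
    unfolding phi_in_eq[OF \<alpha> M(1)] using M(2) by (intro mult_strict_left_mono) auto
  moreover have "1 / pi * (- pi * ln (2 * (1/2 - \<alpha>))) = ln (1 / (1 - 2 * \<alpha>))"
    using \<alpha> by (simp add: ln_div)
  ultimately have "phi_in \<alpha> > phi_out \<alpha> (\<sigma> / 2)" using phi_out_eq(1)[OF R] by simp
  thus False using HS R unfolding hidden_symmetry_def by force
qed

theorem theorem2p2:
  shows "(riemann_hypothesis \<longleftrightarrow> hidden_symmetry) \<and>
    (riemann_hypothesis \<longrightarrow>
      (\<forall>\<alpha> \<alpha>'. related_pair \<alpha> \<alpha>' \<longrightarrow>
        phi_in \<alpha> = ln (1 / (1 - 2 * \<alpha>)) \<and>
        ln (1 / (1 - 2 * \<alpha>)) = phi_out \<alpha> \<alpha>' \<and>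
        phi_out \<alpha> \<alpha>' = ln (Re (zeta (complex_of_real (2 * \<alpha>'))))))"
proof -
  have *: "phi_in \<alpha> = ln (1 / (1 - 2 * \<alpha>)) \<and> ln (1 / (1 - 2 * \<alpha>)) = phi_out \<alpha> \<alpha>' \<and>
      phi_out \<alpha> \<alpha>' = ln (Re (zeta (complex_of_real (2 * \<alpha>'))))"
    if "riemann_hypothesis" "related_pair \<alpha> \<alpha>'" for \<alpha> \<alpha>'
    using phi_out_eq[OF that(2)] phi_in_if_RH[OF that(1)] that(2) by (simp add: related_pair_def)
  hence "hidden_symmetry" if "riemann_hypothesis"
    using that unfolding hidden_symmetry_def by auto
  thus ?thesis using * hidden_symmetry_imp_RH by blast
qed

end
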